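(* Let $\alpha\in\mathbb{R}$. A special class of exact solutions of the equation $$\rho^2\Big(\frac{\partial^2 h}{\partial x_0^2}+\frac{\partial^2 h}{\partial\rho^2}\Big)-(\alpha-1)\rho\,\frac{\partial h}{\partial\rho}+\frac{\partial^2 h}{\partial\theta^2}=0\qquad(\rho>0)$$ satisfying the separation relations $$-\frac{1}{s}\frac{\partial^2 s}{\partial\theta^2}=\frac{\rho^2}{g}\Big(\frac{\partial^2 g}{\partial x_0^2}+\frac{\partial^2 g}{\partial\rho^2}\Big)-\frac{(\alpha-1)\rho}{g}\frac{\partial g}{\partial\rho}=\lambda^2,$$ $$-\frac{1}{\Xi}\frac{d^2\Xi}{dx_0^2}=\frac{1}{\Upsilon}\frac{d^2\Upsilon}{d\rho^2}-\frac{(\alpha-1)}{\Upsilon\rho}\frac{d\Upsilon}{d\rho}-\frac{\lambda^2}{\rho^2}=-\beta^2,$$ with $\beta\neq0$, in three dimensional setting may be obtained using Bessel functions of the first and second kind in cylindrical coordinates: $$h_\beta(x_0,\theta,\rho)=\sum_{\lambda=-\infty}^{\infty}\big(C_{1,\lambda}\cos(\lambda\theta)+C_{2,\lambda}\sin(\lambda\theta)\big)\,g_{\lambda,\beta}(x_0,\rho),$$ where $$g_{\lambda,\beta}(x_0,\rho)=\big(B_{1,\beta}\cosh(\beta x_0)+B_{2,\beta}\sinh(\beta x_0)\big)\,\Upsilon_{\lambda,\beta}(\rho)$$ and $$\Upsilon_{\lambda,\beta}(\rho)=\rho^{\frac{\alpha}{2}}\Big[A_{1,\lambda,\beta}J_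{\frac{\sqrt{\alpha^2+4\lambda^2}}{2}}(\rho\beta)+A_{2,\lambda,\beta}Y_{\frac{\sqrt{\alpha^2+4\lambda^2}}{2}}(\rho\beta)\Big].$$
   Context: $(x_0,\theta,\rho)$ are cylindrical coordinates on $\mathbb{R}^3=\{(x_0,x_1,x_2)\}$: $x_1=\rho\cos\theta$, $x_2=\rho\sin\theta$, $\rho=\sqrt{x_1^2+x_2^2}>0$. The separation relations arise by looking for solutions of the form $h(x_0,\theta,\rho)=g(x_0,\rho)\,s(\theta)$ with separation constant $\lambda$ (first relation), and then $g(x_0,\rho)=\Xi(x_0)\,\Upsilon(\rho)$ with separation constant $\beta\in\mathbb{R}$ (second relation); in the trigonometric solutions $s$ one takes $\lambda\in\mathbb{Z}$. $C_{1,\lambda},C_{2,\lambda},B_{1,\beta},B_{2,\beta},A_{1,\lambda,\beta},A_{2,\lambda,\beta}$ are real constants. $J_\nu$ and $Y_\nu$ denote the Bessel functions of the first and second kind of real order $\nu$ (here $\nu=\frac{\sqrt{\alpha^2+4\lambda^2}}{2}$) and real argument. *)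

theory Defs
  imports "HOL-Analysis.Analysis"
begin

text \<open>
  Bessel functions of the first and second kind.  Powers are principal, so for a negative real
  argument and a non-integer order the values are not real; this is why solutions are
  complex-valued functions of real variables below.  The value at \<open>z = 0\<close> is not meaningful,
  since \<open>0 powr \<nu> = 0\<close> even for \<open>\<nu> = 0\<close>.
\<close>

definition bessel_J :: "complex \<Rightarrow> complex \<Rightarrow> complex" where
  "bessel_J \<nu> z =
     (z / 2) powr \<nu> * (\<Sum>k. (-1) ^ k * rGamma (\<nu> + of_nat k + 1) / fact k * (z / 2) ^ (2 * k))"

text \<open>At integer order the usual quotient is \<open>0 / 0\<close> and is replaced by its limit in the order.\<close>

definition bessel_Y_quotient :: "complex \<Rightarrow> complex \<Rightarrow> complex" where
  "bessel_Y_quotient \<nu> z =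
     (bessel_J \<nu> z * cos (of_real pi * \<nu>) - bessel_J (- \<nu>) z) / sin (of_real pi * \<nu>)"

definition bessel_Y :: "complex \<Rightarrow> complex \<Rightarrow> complex" where
  "bessel_Y \<nu> z =
     (if \<nu> \<in> \<int> then Lim (at \<nu>) (\<lambda>\<mu>. bessel_Y_quotient \<mu> z) else bessel_Y_quotient \<nu> z)"


definition D :: "(real \<Rightarrow> complex) \<Rightarrow> real \<Rightarrow> complex" where
  "D f x = vector_derivative f (at x)"

text \<open>
  \<open>D f\<close> is total and says nothing about differentiability, which is therefore required
  separately.
\<close>

definition twice_differentiable_at :: "(real \<Rightarrow> complex) \<Rightarrow> real \<Rightarrow> bool" where
  "twice_differentiable_at f x \<longleftrightarrow>
     (\<forall>\<^sub>F t in nhds x. f differentiable (at t)) \<and> D f differentiable (at x)"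

text \<open>Functions of the cylindrical coordinates are taken in the order \<open>x\<^sub>0\<close>, \<open>\<theta>\<close>, \<open>\<rho>\<close>.\<close>

type_synonym cyl_fun = "real \<Rightarrow> real \<Rightarrow> real \<Rightarrow> complex"

definition D_x0 :: "cyl_fun \<Rightarrow> cyl_fun" where
  "D_x0 h x0 \<theta> \<rho> = D (\<lambda>t. h t \<theta> \<rho>) x0"

definition D_theta :: "cyl_fun \<Rightarrow> cyl_fun" where
  "D_theta h x0 \<theta> \<rho> = D (\<lambda>t. h x0 t \<rho>) \<theta>"

definition D_rho :: "cyl_fun \<Rightarrow> cyl_fun" where
  "D_rho h x0 \<theta> \<rho> = D (\<lambda>t. h x0 \<theta> t) \<rho>"

definition half_space :: "(real \<times> real \<times> real) set" where
  "half_space = {(x0, \<theta>, \<rho>). \<rho> > 0}"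

definition cont_on :: "(real \<times> real \<times> real) set \<Rightarrow> cyl_fun \<Rightarrow> bool" where
  "cont_on U h \<longleftrightarrow> continuous_on U (\<lambda>(x0, \<theta>, \<rho>). h x0 \<theta> \<rho>)"

definition C1_on :: "(real \<times> real \<times> real) set \<Rightarrow> cyl_fun \<Rightarrow> bool" where
  "C1_on U h \<longleftrightarrow>
     (\<forall>(x0, \<theta>, \<rho>) \<in> U.
        (\<lambda>t. h t \<theta> \<rho>) differentiable (at x0) \<and>
        (\<lambda>t. h x0 t \<rho>) differentiable (at \<theta>) \<and>
        (\<lambda>t. h x0 \<theta> t) differentiable (at \<rho>)) \<and>
     cont_on U h \<and> cont_on U (D_x0 h) \<and> cont_on U (D_theta h) \<and> cont_on U (D_rho h)"

definition C2_on :: "(real \<times> real \<times> real) set \<Rightarrow> cyl_fun \<Rightarrow> bool" where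
  "C2_on U h \<longleftrightarrow> C1_on U h \<and> C1_on U (D_x0 h) \<and> C1_on U (D_theta h) \<and> C1_on U (D_rho h)"

definition solution_on :: "real \<Rightarrow> (real \<times> real \<times> real) set \<Rightarrow> cyl_fun \<Rightarrow> bool" where
  "solution_on \<alpha> U h \<longleftrightarrow>
     C2_on U h \<and>
     (\<forall>(x0, \<theta>, \<rho>) \<in> U.
        of_real (\<rho>\<^sup>2) * (D_x0 (D_x0 h) x0 \<theta> \<rho> + D_rho (D_rho h) x0 \<theta> \<rho>)
        - of_real ((\<alpha> - 1) * \<rho>) * D_rho h x0 \<theta> \<rho>
        + D_theta (D_theta h) x0 \<theta> \<rho> = 0)"

text \<open>
  The separation relations, for \<open>h = g s\<close> and \<open>g = \<Xi> \<Upsilon>\<close>, with separation constants \<open>l\<^sup>2\<close> and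
  \<open>- \<beta>\<^sup>2\<close>.  Each of the two quotient expressions is required to equal the separation constant
  wherever its own denominator does not vanish; where both do not, this is the chain of two
  equalities.
\<close>

definition first_separation ::
  "real \<Rightarrow> int \<Rightarrow> (real \<Rightarrow> complex) \<Rightarrow> (real \<Rightarrow> real \<Rightarrow> complex) \<Rightarrow> bool" where
  "first_separation \<alpha> l s g \<longleftrightarrow>
     (\<forall>\<theta>. twice_differentiable_at s \<theta> \<and>
        (s \<theta> \<noteq> 0 \<longrightarrow> - (1 / s \<theta>) * D (D s) \<theta> = of_int (l\<^sup>2))) \<and>
     (\<forall>x0 \<rho>. \<rho> > 0 \<longrightarrow>
        twice_differentiable_at (\<lambda>t. g t \<rho>) x0 \<and>
        twice_differentiable_at (\<lambda>t. g x0 t) \<rho> \<and>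
        (g x0 \<rho> \<noteq> 0 \<longrightarrow>
           of_real (\<rho>\<^sup>2) / g x0 \<rho> * (D (D (\<lambda>t. g t \<rho>)) x0 + D (D (\<lambda>t. g x0 t)) \<rho>)
           - of_real ((\<alpha> - 1) * \<rho>) / g x0 \<rho> * D (\<lambda>t. g x0 t) \<rho> = of_int (l\<^sup>2)))"

definition second_separation ::
  "real \<Rightarrow> int \<Rightarrow> real \<Rightarrow> (real \<Rightarrow> complex) \<Rightarrow> (real \<Rightarrow> complex) \<Rightarrow> bool" where
  "second_separation \<alpha> l \<beta> \<Xi> \<Upsilon> \<longleftrightarrow>
     (\<forall>x0. twice_differentiable_at \<Xi> x0 \<and>
        (\<Xi> x0 \<noteq> 0 \<longrightarrow> - (1 / \<Xi> x0) * D (D \<Xi>) x0 = - of_real (\<beta>\<^sup>2))) \<and>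
     (\<forall>\<rho>. \<rho> > 0 \<longrightarrow>
        twice_differentiable_at \<Upsilon> \<rho> \<and>
        (\<Upsilon> \<rho> \<noteq> 0 \<longrightarrow>
           (1 / \<Upsilon> \<rho>) * D (D \<Upsilon>) \<rho> - of_real (\<alpha> - 1) / (\<Upsilon> \<rho> * of_real \<rho>) * D \<Upsilon> \<rho>
           - of_real ((of_int l)\<^sup>2 / \<rho>\<^sup>2) = - of_real (\<beta>\<^sup>2)))"


definition s_fun :: "(int \<Rightarrow> real) \<Rightarrow> (int \<Rightarrow> real) \<Rightarrow> int \<Rightarrow> real \<Rightarrow> complex" where
  "s_fun C1 C2 l \<theta> = of_real (C1 l * cos (of_int l * \<theta>) + C2 l * sin (of_int l * \<theta>))"

definition Xi_fun :: "(real \<Rightarrow> real) \<Rightarrow> (real \<Rightarrow> real) \<Rightarrow> real \<Rightarrow> real \<Rightarrow> complex" where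
  "Xi_fun B1 B2 \<beta> x0 = of_real (B1 \<beta> * cosh (\<beta> * x0) + B2 \<beta> * sinh (\<beta> * x0))"

definition Upsilon_fun ::
  "real \<Rightarrow> (int \<Rightarrow> real \<Rightarrow> real) \<Rightarrow> (int \<Rightarrow> real \<Rightarrow> real) \<Rightarrow> int \<Rightarrow> real \<Rightarrow> real \<Rightarrow> complex" where
  "Upsilon_fun \<alpha> A1 A2 l \<beta> \<rho> =
     (let \<nu> = of_real (sqrt (\<alpha>\<^sup>2 + 4 * (of_int l)\<^sup>2) / 2)
      in of_real (\<rho> powr (\<alpha> / 2)) *
           (of_real (A1 l \<beta>) * bessel_J \<nu> (of_real (\<rho> * \<beta>)) +
            of_real (A2 l \<beta>) * bessel_Y \<nu> (of_real (\<rho> * \<beta>))))"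

definition g_fun ::
  "real \<Rightarrow> (real \<Rightarrow> real) \<Rightarrow> (real \<Rightarrow> real) \<Rightarrow> (int \<Rightarrow> real \<Rightarrow> real) \<Rightarrow> (int \<Rightarrow> real \<Rightarrow> real) \<Rightarrow>
   int \<Rightarrow> real \<Rightarrow> real \<Rightarrow> real \<Rightarrow> complex" where
  "g_fun \<alpha> B1 B2 A1 A2 l \<beta> x0 \<rho> = Xi_fun B1 B2 \<beta> x0 * Upsilon_fun \<alpha> A1 A2 l \<beta> \<rho>"

definition h_term ::
  "real \<Rightarrow> (int \<Rightarrow> real) \<Rightarrow> (int \<Rightarrow> real) \<Rightarrow> (real \<Rightarrow> real) \<Rightarrow> (real \<Rightarrow> real) \<Rightarrow>
   (int \<Rightarrow> real \<Rightarrow> real) \<Rightarrow> (int \<Rightarrow> real \<Rightarrow> real) \<Rightarrow> int \<Rightarrow> real \<Rightarrow> cyl_fun" where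
  "h_term \<alpha> C1 C2 B1 B2 A1 A2 l \<beta> x0 \<theta> \<rho> = s_fun C1 C2 l \<theta> * g_fun \<alpha> B1 B2 A1 A2 l \<beta> x0 \<rho>"

text \<open>
  Bilateral series are limits of symmetric partial sums.  As a hypothesis this is the weakest of
  the usual notions of convergence, and its sum agrees with the others when they apply.
\<close>

definition bilateral_convergent :: "(int \<Rightarrow> complex) \<Rightarrow> bool" where
  "bilateral_convergent f \<longleftrightarrow> convergent (\<lambda>N::nat. \<Sum>l\<in>{- int N..int N}. f l)"

definition bilateral_sum :: "(int \<Rightarrow> complex) \<Rightarrow> complex" where
  "bilateral_sum f = lim (\<lambda>N::nat. \<Sum>l\<in>{- int N..int N}. f l)"

definition h_fun ::
  "real \<Rightarrow> (int \<Rightarrow> real) \<Rightarrow> (int \<Rightarrow> real) \<Rightarrow> (real \<Rightarrow> real) \<Rightarrow> (real \<Rightarrow> real) \<Rightarrow>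
   (int \<Rightarrow> real \<Rightarrow> real) \<Rightarrow> (int \<Rightarrow> real \<Rightarrow> real) \<Rightarrow> real \<Rightarrow> cyl_fun" where
  "h_fun \<alpha> C1 C2 B1 B2 A1 A2 \<beta> x0 \<theta> \<rho> =
     bilateral_sum (\<lambda>l. h_term \<alpha> C1 C2 B1 B2 A1 A2 l \<beta> x0 \<theta> \<rho>)"

end

(*
  In the variable t = ln rho every factor Upsilon_l is the restriction of an entire function and
  solves v'' = alpha v' + (l^2 - beta^2 exp(2t)) v.  For J this is a comparison of coefficients;
  for Y of integer order one differentiates the coefficients with respect to the order.

  Mere pointwise convergence of the symmetric partial sums on an open set suffices, because it
  bounds the combined terms l and -l at each point.  By a Cantor-Lebesgue argument (Baire category
  in theta) the coefficients of cos(n theta) and sin(n theta) are then bounded at every radius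
  involved.  For large n the zeroth-order coefficient in the equation is positive, so comparison
  with the barriers exp(-n(t - a)/2) and exp(-n(b - t)/2) gives exponential decay in n strictly
  between two such radii, and the series may be differentiated term by term.
*)
theory Submission
  imports Defs "HOL-Complex_Analysis.Complex_Analysis"
begin

subsection \<open>Bessel functions in the logarithmic variable\<close>

text \<open>For negative \<open>\<beta>\<close> the argument \<open>\<rho> * \<beta>\<close> lies on
  the branch cut of the principal power. As \<open>\<rho>\<close> is positive,
  \<open>Ln (\<rho> * \<beta> / 2)\<close> is still \<open>ln \<rho>\<close> plus the constant
  \<open>Ln (\<beta> / 2)\<close>. In the logarithmic variable a negative \<open>\<beta>\<close> is
  thus only a translation by a complex constant, and both signs share one proof. The constants are
  arbitrary, so the growth of Bessel functions in the order cannot control the series. The estimate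
  has to come from the equation, and openness of the domain makes this possible: every radius lies
  between two others at which the coefficients are bounded. The axial factor may vanish at a given
  \<open>x0\<close> and hide the coefficients there; unless it is identically zero it has at most
  one zero, so a nearby \<open>x0\<close> serves. Decay at a radius forces convergence for all
  \<open>x0\<close> and \<open>\<theta>\<close>, so the sum solves the equation on the whole
  cylinder over the radii of \<open>U\<close> and is restricted to \<open>U\<close> at the
  end.\<close>

definition bessel_coeff :: "complex \<Rightarrow> nat \<Rightarrow> complex" where
  "bessel_coeff \<mu> k = (-1) ^ k * rGamma (\<mu> + of_nat k + 1) / fact k"

definition bessel_coeff_deriv :: "complex \<Rightarrow> nat \<Rightarrow> complex" where
  "bessel_coeff_deriv \<mu> k = deriv (\<lambda>\<mu>. bessel_coeff \<mu> k) \<mu>"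

text \<open>The reciprocal Gamma function is entire, so no order is exceptional. This is what allows
  differentiation in the order at integers, where the formula for \<open>Y\<close>
  degenerates.\<close>

lemma has_field_derivative_bessel_coeff:
  "((\<lambda>\<mu>. bessel_coeff \<mu> k) has_field_derivative bessel_coeff_deriv \<mu> k) (at \<mu>)"
proof -
  have "(\<lambda>\<mu>. bessel_coeff \<mu> k) field_differentiable (at \<mu>)"
    unfolding bessel_coeff_def field_differentiable_def
    by (rule exI) (rule derivative_eq_intros refl | simp)+
  then show ?thesis
    unfolding bessel_coeff_deriv_def by (simp add: DERIV_deriv_iff_field_differentiable)
qed

text \<open>This is the functional equation of the reciprocal Gamma function. The factor
  \<open>\<mu> + of_nat (Suc k)\<close> stays on the left because it vanishes for some negative
  integer orders, which are needed for \<open>Y\<close>.\<close>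

lemma bessel_coeff_Suc:
  "of_nat (Suc k) * (\<mu> + of_nat (Suc k)) * bessel_coeff \<mu> (Suc k) = - bessel_coeff \<mu> k"
proof -
  have cancel: "n * m * (- (s * x / (n * f))) = - (s * (m * x) / f)" if "n \<noteq> 0" for n m s x f :: complex
    using that by simp
  have "bessel_coeff \<mu> (Suc k)
      = - ((-1) ^ k * rGamma (\<mu> + of_nat (Suc k) + 1) / (of_nat (Suc k) * fact k))"
    unfolding bessel_coeff_def by simp
  moreover have "(\<mu> + of_nat (Suc k)) * rGamma (\<mu> + of_nat (Suc k) + 1) = rGamma (\<mu> + of_nat k + 1)"
    using rGamma_plus1[of "\<mu> + of_nat (Suc k)"] by (simp add: add_ac)
  ultimately show ?thesis
    unfolding bessel_coeff_def by (simp only: cancel of_nat_neq_0 not_False_eq_True)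
qed

text \<open>The recurrence for the coefficients is differentiated in the order; the product rule
  contributes the extra last term.\<close>

lemma bessel_coeff_deriv_Suc:
  "of_nat (Suc k) * (\<mu> + of_nat (Suc k)) * bessel_coeff_deriv \<mu> (Suc k)
     = - bessel_coeff_deriv \<mu> k - of_nat (Suc k) * bessel_coeff \<mu> (Suc k)"
proof -
  have "((\<lambda>\<mu>. of_nat (Suc k) * (\<mu> + of_nat (Suc k)) * bessel_coeff \<mu> (Suc k)) has_field_derivative
     of_nat (Suc k) * bessel_coeff \<mu> (Suc k)
     + of_nat (Suc k) * (\<mu> + of_nat (Suc k)) * bessel_coeff_deriv \<mu> (Suc k)) (at \<mu>)"
    by (auto intro!: derivative_eq_intros has_field_derivative_bessel_coeff simp: algebra_simps)
  then have "((\<lambda>\<mu>. - bessel_coeff \<mu> k) has_field_derivative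
     of_nat (Suc k) * bessel_coeff \<mu> (Suc k)
     + of_nat (Suc k) * (\<mu> + of_nat (Suc k)) * bessel_coeff_deriv \<mu> (Suc k)) (at \<mu>)"
    unfolding bessel_coeff_Suc .
  moreover have "((\<lambda>\<mu>. - bessel_coeff \<mu> k) has_field_derivative - bessel_coeff_deriv \<mu> k) (at \<mu>)"
    by (intro DERIV_minus has_field_derivative_bessel_coeff)
  ultimately show ?thesis
    using DERIV_unique by (fastforce simp: algebra_simps)
qed

text \<open>From an index \<open>N \<ge> norm \<mu>0 + 2\<close> on,
  \<open>\<mu> + of_nat (Suc k)\<close> has norm at least 1 for every \<open>\<mu>\<close> in the
  unit ball around \<open>\<mu>0\<close>. The recurrence then makes
  \<open>norm (bessel_coeff \<mu> k) * fact k\<close> nonincreasing in \<open>k\<close>, and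
  compactness bounds its value at \<open>N\<close>. The majorant is a multiple of the exponential
  series and does not depend on \<open>\<mu>\<close>.\<close>

lemma bessel_coeff_locally_summable:
  "\<exists>d h. 0 < d \<and> summable h \<and>
     (\<forall>\<^sub>F k in sequentially. \<forall>\<mu>\<in>ball \<mu>0 d. norm (bessel_coeff \<mu> k * w ^ k) \<le> h k)"
proof -
  obtain N :: nat where N: "norm \<mu>0 + 2 \<le> real N"
    using real_arch_simple by blast
  have "continuous_on (cball \<mu>0 1) (\<lambda>\<mu>. bessel_coeff \<mu> N)"
    by (rule DERIV_continuous_on)
      (rule has_field_derivative_at_within[OF has_field_derivative_bessel_coeff])
  then have "bounded ((\<lambda>\<mu>. bessel_coeff \<mu> N) ` cball \<mu>0 1)"
    by (intro compact_imp_bounded compact_continuous_image) auto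
  then obtain B where B: "\<And>\<mu>. \<mu> \<in> cball \<mu>0 1 \<Longrightarrow> norm (bessel_coeff \<mu> N) \<le> B"
    unfolding bounded_iff by (elim exE) (blast intro: imageI)
  have bound: "norm (bessel_coeff \<mu> k) * fact k \<le> B * fact N"
    if \<mu>: "\<mu> \<in> ball \<mu>0 1" and "N \<le> k" for \<mu> k
    using \<open>N \<le> k\<close>
  proof (induction k rule: dec_induct)
    case base
    then show ?case using B[of \<mu>] \<mu> by auto
  next
    case (step k)
    have "norm \<mu> \<le> norm \<mu>0 + 1"
      using \<mu> norm_triangle_ineq2[of \<mu> \<mu>0] by (simp add: dist_norm norm_minus_commute)
    moreover have "real (Suc k) - norm \<mu> \<le> norm (\<mu> + of_nat (Suc k))"
      using norm_diff_ineq[of "of_nat (Suc k)" \<mu>] by (simp add: add_ac del: of_nat_Suc)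
    moreover have "real N \<le> real k"
      using step by simp
    ultimately have "1 \<le> norm (\<mu> + of_nat (Suc k))"
      using N unfolding of_nat_Suc by linarith
    then have "real (Suc k) * norm (bessel_coeff \<mu> (Suc k))
        \<le> real (Suc k) * norm (bessel_coeff \<mu> (Suc k)) * norm (\<mu> + of_nat (Suc k))"
      using mult_left_mono[of 1 _ "real (Suc k) * norm (bessel_coeff \<mu> (Suc k))"] by simp
    also have "\<dots> = norm (of_nat (Suc k) * (\<mu> + of_nat (Suc k)) * bessel_coeff \<mu> (Suc k))"
      by (simp only: norm_mult norm_of_nat mult_ac)
    also have "\<dots> = norm (bessel_coeff \<mu> k)"
      unfolding bessel_coeff_Suc by simp
    finally have "real (Suc k) * norm (bessel_coeff \<mu> (Suc k)) * fact k \<le> norm (bessel_coeff \<mu> k) * fact k"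
      by (intro mult_right_mono) auto
    then show ?case using step.IH by (simp add: algebra_simps)
  qed
  show ?thesis
  proof (intro exI conjI)
    show "summable (\<lambda>k. B * fact N * (inverse (fact k) * norm w ^ k))"
      by (intro summable_mult summable_exp)
    show "\<forall>\<^sub>F k in sequentially. \<forall>\<mu>\<in>ball \<mu>0 1.
        norm (bessel_coeff \<mu> k * w ^ k) \<le> B * fact N * (inverse (fact k) * norm w ^ k)"
      using eventually_ge_at_top[of N]
    proof (eventually_elim, intro ballI)
      fix k \<mu> assume k: "N \<le> k" and \<mu>: "\<mu> \<in> ball \<mu>0 1"
      have "norm (bessel_coeff \<mu> k) \<le> B * fact N * inverse (fact k)"
        using bound[of \<mu> k] k \<mu> by (simp add: field_simps)
      then have "norm (bessel_coeff \<mu> k) * norm w ^ k \<le> B * fact N * inverse (fact k) * norm w ^ k"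
        by (intro mult_right_mono) auto
      then show "norm (bessel_coeff \<mu> k * w ^ k) \<le> B * fact N * (inverse (fact k) * norm w ^ k)"
        by (simp add: norm_mult norm_power mult_ac)
    qed
  qed simp
qed

text \<open>The locally uniform majorant permits termwise differentiation of a series of holomorphic
  functions of the order; convergence of the differentiated series comes with it.\<close>

lemma bessel_series:
  shows summable_bessel_coeff: "summable (\<lambda>k. bessel_coeff \<mu> k * w ^ k)"
    and summable_bessel_coeff_deriv: "summable (\<lambda>k. bessel_coeff_deriv \<mu> k * w ^ k)"
    and has_field_derivative_bessel_series:
      "((\<lambda>\<mu>. \<Sum>k. bessel_coeff \<mu> k * w ^ k) has_field_derivative
         (\<Sum>k. bessel_coeff_deriv \<mu> k * w ^ k)) (at \<mu>)"
proof -
  have "\<exists>g g'. \<forall>\<mu>\<in>UNIV. ((\<lambda>k. bessel_coeff \<mu> k * w ^ k) sums g \<mu>) \<and>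
      ((\<lambda>k. bessel_coeff_deriv \<mu> k * w ^ k) sums g' \<mu>) \<and> (g has_field_derivative g' \<mu>) (at \<mu>)"
    by (rule series_and_derivative_comparison_local[OF open_UNIV])
      (auto intro: bessel_coeff_locally_summable[simplified] DERIV_cmult_right
        has_field_derivative_bessel_coeff)
  then obtain g g' where g: "\<And>\<mu>. (\<lambda>k. bessel_coeff \<mu> k * w ^ k) sums g \<mu>"
    "\<And>\<mu>. (\<lambda>k. bessel_coeff_deriv \<mu> k * w ^ k) sums g' \<mu>"
    "\<And>\<mu>. (g has_field_derivative g' \<mu>) (at \<mu>)"
    by auto
  show "summable (\<lambda>k. bessel_coeff \<mu> k * w ^ k)" "summable (\<lambda>k. bessel_coeff_deriv \<mu> k * w ^ k)"
    using g sums_summable by blast+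
  have "g = (\<lambda>\<mu>. \<Sum>k. bessel_coeff \<mu> k * w ^ k)" "g' \<mu> = (\<Sum>k. bessel_coeff_deriv \<mu> k * w ^ k)"
    using g(1,2) by (auto simp: sums_iff)
  then show "((\<lambda>\<mu>. \<Sum>k. bessel_coeff \<mu> k * w ^ k) has_field_derivative
         (\<Sum>k. bessel_coeff_deriv \<mu> k * w ^ k)) (at \<mu>)"
    using g(3) by metis
qed

section \<open>Exponential series and Bessel's equation in the logarithmic variable\<close>

text \<open>A Frobenius series, a power with exponent \<open>\<mu>\<close> times a power series in
  the square, evaluated at \<open>exp \<tau>\<close>. In this variable it is single-valued for every
  \<open>\<mu>\<close>.\<close>

definition exp_series :: "complex \<Rightarrow> (nat \<Rightarrow> complex) \<Rightarrow> complex \<Rightarrow> complex" where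
  "exp_series \<mu> c \<tau> = exp (\<mu> * \<tau>) * (\<Sum>k. c k * exp (2 * \<tau>) ^ k)"

lemma summable_of_nat_mult_power_series:
  fixes c :: "nat \<Rightarrow> complex"
  assumes "\<And>w. summable (\<lambda>k. c k * w ^ k)"
  shows "summable (\<lambda>k. of_nat k * c k * w ^ k)"
proof -
  have "summable (\<lambda>k. diffs c k * w ^ k)"
    by (rule termdiff_converges_all[OF assms])
  then have "summable (\<lambda>k. w * (diffs c k * w ^ k))"
    by (rule summable_mult)
  then have "summable (\<lambda>k. of_nat (Suc k) * c (Suc k) * w ^ Suc k)"
    by (simp add: diffs_def mult_ac)
  then show ?thesis
    by (subst summable_Suc_iff[symmetric])
qed

lemma summable_exp_series_deriv:
  fixes c :: "nat \<Rightarrow> complex"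
  assumes "\<And>w. summable (\<lambda>k. c k * w ^ k)"
  shows "summable (\<lambda>k. (2 * of_nat k + \<mu>) * c k * w ^ k)"
proof -
  have "summable (\<lambda>k. 2 * (of_nat k * c k * w ^ k) + \<mu> * (c k * w ^ k))"
    by (intro summable_add summable_mult summable_of_nat_mult_power_series assms)
  then show ?thesis by (simp add: algebra_simps)
qed

text \<open>Each summand is a multiple of \<open>exp ((2 * of_nat k + \<mu>) * \<tau>)\<close>, so
  differentiation acts diagonally on the coefficients. The derivative is again an exponential series
  and the rule can be iterated.\<close>

lemma has_field_derivative_exp_series:
  assumes c: "\<And>w. summable (\<lambda>k. c k * w ^ k)"
  shows "(exp_series \<mu> c has_field_derivative
    exp_series \<mu> (\<lambda>k. (2 * of_nat k + \<mu>) * c k) \<tau>) (at \<tau>)"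
proof -
  define w where "w = exp (2 * \<tau>)"
  have s: "summable (\<lambda>k. of_nat k * c k * w ^ k)"
    by (rule summable_of_nat_mult_power_series[OF c])
  have "w * (\<Sum>k. diffs c k * w ^ k) = (\<Sum>k. w * (diffs c k * w ^ k))"
    by (rule suminf_mult[symmetric]) (rule termdiff_converges_all[OF c])
  also have "\<dots> = (\<Sum>k. of_nat (Suc k) * c (Suc k) * w ^ Suc k)"
    by (simp add: diffs_def mult_ac)
  also have "\<dots> = (\<Sum>k. of_nat k * c k * w ^ k)"
    using suminf_split_head[OF s] by simp
  finally have eq: "w * (\<Sum>k. diffs c k * w ^ k) = (\<Sum>k. of_nat k * c k * w ^ k)" .
  have "((\<lambda>\<tau>. \<Sum>k. c k * exp (2 * \<tau>) ^ k) has_field_derivative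
      (\<Sum>k. diffs c k * w ^ k) * (w * 2)) (at \<tau>)"
    unfolding w_def
    by (rule DERIV_chain2[OF termdiffs_strong_converges_everywhere[OF c]])
      (auto intro!: derivative_eq_intros)
  then have "(exp_series \<mu> c has_field_derivative
      exp (\<mu> * \<tau>) * \<mu> * (\<Sum>k. c k * exp (2 * \<tau>) ^ k)
      + (\<Sum>k. diffs c k * w ^ k) * (w * 2) * exp (\<mu> * \<tau>)) (at \<tau>)"
    unfolding exp_series_def
    by (intro DERIV_mult) (auto intro!: derivative_eq_intros)
  moreover have "exp (\<mu> * \<tau>) * \<mu> * (\<Sum>k. c k * exp (2 * \<tau>) ^ k)
      + (\<Sum>k. diffs c k * w ^ k) * (w * 2) * exp (\<mu> * \<tau>)
    = exp (\<mu> * \<tau>) * (2 * (w * (\<Sum>k. diffs c k * w ^ k)) + \<mu> * (\<Sum>k. c k * w ^ k))"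
    unfolding w_def[symmetric] by (simp only: ring_distribs mult_ac add_ac)
  moreover have "2 * (\<Sum>k. of_nat k * c k * w ^ k) + \<mu> * (\<Sum>k. c k * w ^ k)
    = (\<Sum>k. 2 * (of_nat k * c k * w ^ k) + \<mu> * (c k * w ^ k))"
    using s c[of w] by (simp add: suminf_add[symmetric] suminf_mult summable_mult)
  moreover have "\<dots> = (\<Sum>k. (2 * of_nat k + \<mu>) * c k * w ^ k)"
    by (simp add: algebra_simps)
  ultimately show ?thesis
    unfolding eq by (simp add: exp_series_def w_def)
qed

text \<open>Two derivatives multiply the coefficient by the square of \<open>2 * k + \<mu>\<close>,
  which exceeds the square of \<open>\<mu>\<close> by \<open>4 * k * (k + \<mu>)\<close>. The
  recurrence turns this excess into an index shift, that is, into multiplication by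
  \<open>- 4 * exp (2 * \<tau>)\<close>. With \<open>d = 0\<close> it serves for \<open>J\<close>;
  with \<open>c\<close> the order derivatives and \<open>d\<close> the coefficients themselves it
  serves for the order derivative of \<open>J\<close>.\<close>

lemma exp_series_bessel_recurrence:
  assumes c: "\<And>w. summable (\<lambda>k. c k * w ^ k)" and d: "\<And>w. summable (\<lambda>k. d k * w ^ k)"
    and rec: "\<And>k. of_nat (Suc k) * (\<mu> + of_nat (Suc k)) * c (Suc k) = - c k - of_nat (Suc k) * d (Suc k)"
  shows "exp_series \<mu> (\<lambda>k. (2 * of_nat k + \<mu>) * ((2 * of_nat k + \<mu>) * c k)) \<tau>
    = (\<mu>\<^sup>2 - 4 * exp (2 * \<tau>)) * exp_series \<mu> c \<tau>
      - 2 * (exp_series \<mu> (\<lambda>k. (2 * of_nat k + \<mu>) * d k) \<tau> - \<mu> * exp_series \<mu> d \<tau>)"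
proof -
  define w where "w = exp (2 * \<tau>)"
  define f where "f k = (2 * of_nat k + \<mu>) * ((2 * of_nat k + \<mu>) * c k) * w ^ k" for k
  define g where "g k = (2 * of_nat k + \<mu>) * d k * w ^ k" for k
  have sf: "summable f" and sg: "summable g"
    unfolding f_def g_def by (intro summable_exp_series_deriv c d)+
  have "(\<Sum>k. f k - \<mu>\<^sup>2 * (c k * w ^ k) + 2 * (g k - \<mu> * (d k * w ^ k)))
    = (\<Sum>k. f k) - \<mu>\<^sup>2 * (\<Sum>k. c k * w ^ k) + 2 * ((\<Sum>k. g k) - \<mu> * (\<Sum>k. d k * w ^ k))"
    using sf sg c[of w] d[of w]
    by (simp add: suminf_mult suminf_add[symmetric] suminf_diff[symmetric] summable_mult
      summable_diff)
  \<comment> \<open>The summand at \<open>k = 0\<close> vanishes, so dropping it costs nothing and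
    the recurrence for \<open>c (Suc k)\<close> becomes applicable.\<close>
  moreover have "(\<Sum>k. f k - \<mu>\<^sup>2 * (c k * w ^ k) + 2 * (g k - \<mu> * (d k * w ^ k)))
    = (\<Sum>k. f (Suc k) - \<mu>\<^sup>2 * (c (Suc k) * w ^ Suc k)
         + 2 * (g (Suc k) - \<mu> * (d (Suc k) * w ^ Suc k)))"
    by (subst suminf_split_head)
     (auto simp: f_def g_def power2_eq_square intro!: summable_add summable_diff summable_mult
      sf[unfolded f_def] sg[unfolded g_def] c d)
  moreover have "f (Suc k) - \<mu>\<^sup>2 * (c (Suc k) * w ^ Suc k)
         + 2 * (g (Suc k) - \<mu> * (d (Suc k) * w ^ Suc k)) = - 4 * w * (c k * w ^ k)" for k
  proof -
    have "f (Suc k) - \<mu>\<^sup>2 * (c (Suc k) * w ^ Suc k)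
         + 2 * (g (Suc k) - \<mu> * (d (Suc k) * w ^ Suc k))
      = 4 * (of_nat (Suc k) * (\<mu> + of_nat (Suc k)) * c (Suc k) + of_nat (Suc k) * d (Suc k)) * w ^ Suc k"
      unfolding f_def g_def power2_eq_square by (simp only: algebra_simps) algebra
    then show ?thesis unfolding rec by simp
  qed
  ultimately have "(\<Sum>k. f k) - \<mu>\<^sup>2 * (\<Sum>k. c k * w ^ k) + 2 * ((\<Sum>k. g k) - \<mu> * (\<Sum>k. d k * w ^ k))
    = - 4 * w * (\<Sum>k. c k * w ^ k)"
    using suminf_mult[OF c[of w], of "- 4 * w"] by simp
  then have sums: "(\<Sum>k. f k) = \<mu>\<^sup>2 * (\<Sum>k. c k * w ^ k)
      - 2 * ((\<Sum>k. g k) - \<mu> * (\<Sum>k. d k * w ^ k)) - 4 * w * (\<Sum>k. c k * w ^ k)"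
    by (simp add: algebra_simps)
  have "exp (\<mu> * \<tau>) * (\<Sum>k. f k) = (\<mu>\<^sup>2 - 4 * w) * (exp (\<mu> * \<tau>) * (\<Sum>k. c k * w ^ k))
      - 2 * (exp (\<mu> * \<tau>) * (\<Sum>k. g k) - \<mu> * (exp (\<mu> * \<tau>) * (\<Sum>k. d k * w ^ k)))"
    unfolding sums by (simp add: algebra_simps)
  then show ?thesis
    by (simp only: exp_series_def f_def g_def w_def)
qed

text \<open>Bessel's equation of order \<open>\<nu>\<close> in the variable
  \<open>z = 2 * exp \<tau>\<close>, a substitution that removes the first-order term. The forcing
  term \<open>r\<close> is there because an order derivative satisfies only an inhomogeneous
  equation.\<close>

definition bessel_ode :: "complex \<Rightarrow> (complex \<Rightarrow> complex) \<Rightarrow> (complex \<Rightarrow> complex) \<Rightarrow> bool" where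
  "bessel_ode \<nu> r y \<longleftrightarrow> (\<exists>y'. \<forall>\<tau>. (y has_field_derivative y' \<tau>) (at \<tau>) \<and>
     (y' has_field_derivative (\<nu>\<^sup>2 - 4 * exp (2 * \<tau>)) * y \<tau> + r \<tau>) (at \<tau>))"

lemma bessel_ode_linear_combination:
  assumes "bessel_ode \<nu> r y" "bessel_ode \<nu> s z"
  shows "bessel_ode \<nu> (\<lambda>\<tau>. a * r \<tau> + b * s \<tau>) (\<lambda>\<tau>. a * y \<tau> + b * z \<tau>)"
proof -
  obtain y' z' where
    "\<And>\<tau>. (y has_field_derivative y' \<tau>) (at \<tau>)"
    "\<And>\<tau>. (y' has_field_derivative (\<nu>\<^sup>2 - 4 * exp (2 * \<tau>)) * y \<tau> + r \<tau>) (at \<tau>)"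
    "\<And>\<tau>. (z has_field_derivative z' \<tau>) (at \<tau>)"
    "\<And>\<tau>. (z' has_field_derivative (\<nu>\<^sup>2 - 4 * exp (2 * \<tau>)) * z \<tau> + s \<tau>) (at \<tau>)"
    using assms unfolding bessel_ode_def by blast
  then show ?thesis
    unfolding bessel_ode_def
    by (intro exI[of _ "\<lambda>\<tau>. a * y' \<tau> + b * z' \<tau>"])
      (auto intro!: derivative_eq_intros simp: algebra_simps)
qed

definition bessel_J_log :: "complex \<Rightarrow> complex \<Rightarrow> complex" where
  "bessel_J_log \<mu> = exp_series \<mu> (bessel_coeff \<mu>)"

definition bessel_J_log_order_deriv :: "complex \<Rightarrow> complex \<Rightarrow> complex" where
  "bessel_J_log_order_deriv \<mu> \<tau> = \<tau> * bessel_J_log \<mu> \<tau> + exp_series \<mu> (bessel_coeff_deriv \<mu>) \<tau>"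

text \<open>The principal power is by definition the exponential of a multiple of \<open>Ln\<close>,
  and the even powers do not depend on the branch. Hence negative real arguments are covered
  too.\<close>

lemma bessel_J_eq_log:
  assumes "z \<noteq> 0"
  shows "bessel_J \<nu> z = bessel_J_log \<nu> (Ln (z / 2))"
proof -
  have z: "z / 2 \<noteq> 0" using assms by simp
  have "(z / 2) ^ (2 * k) = exp (2 * Ln (z / 2)) ^ k" for k
    unfolding exp_double exp_Ln[OF z] power_mult ..
  then show ?thesis
    using z by (simp only: bessel_J_def bessel_J_log_def exp_series_def bessel_coeff_def powr_def
      if_False)
qed

lemma has_field_derivative_bessel_J_log_order:
  "((\<lambda>\<mu>. bessel_J_log \<mu> \<tau>) has_field_derivative bessel_J_log_order_deriv \<mu> \<tau>) (at \<mu>)"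
  unfolding bessel_J_log_def bessel_J_log_order_deriv_def exp_series_def
  by (auto intro!: derivative_eq_intros has_field_derivative_bessel_series simp: algebra_simps)

lemma exp_series_zero [simp]: "exp_series \<mu> (\<lambda>k. 0) \<tau> = 0"
  by (simp add: exp_series_def)

lemma bessel_ode_J_log: "bessel_ode \<mu> (\<lambda>_. 0) (bessel_J_log \<mu>)"
proof -
  let ?c = "bessel_coeff \<mu>"
  have "exp_series \<mu> (\<lambda>k. (2 * of_nat k + \<mu>) * ((2 * of_nat k + \<mu>) * ?c k)) \<tau>
    = (\<mu>\<^sup>2 - 4 * exp (2 * \<tau>)) * exp_series \<mu> ?c \<tau>" for \<tau>
    using exp_series_bessel_recurrence[of ?c "\<lambda>_. 0" \<mu> \<tau>] bessel_coeff_Suc summable_bessel_coeff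
    by simp
  then show ?thesis
    unfolding bessel_ode_def bessel_J_log_def
    using has_field_derivative_exp_series[of ?c \<mu>]
      has_field_derivative_exp_series[of "\<lambda>k. (2 * of_nat k + \<mu>) * ?c k" \<mu>]
      summable_bessel_coeff[of \<mu>] summable_exp_series_deriv[of ?c \<mu>]
    by (intro exI[of _ "exp_series \<mu> (\<lambda>k. (2 * of_nat k + \<mu>) * ?c k)"]) simp
qed

text \<open>Formally this is the homogeneous equation differentiated in the order. The proof avoids
  exchanging derivatives: twice differentiating \<open>\<tau> * J\<close> leaves an extra
  \<open>2 * J'\<close>, the series of differentiated coefficients leaves
  \<open>- 2 * (J' - \<mu> * J)\<close>, and their sum is the forcing term.\<close>

lemma bessel_ode_J_log_order_deriv:
  "bessel_ode \<mu> (\<lambda>\<tau>. 2 * \<mu> * bessel_J_log \<mu> \<tau>) (bessel_J_log_order_deriv \<mu>)"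
proof -
  let ?c = "bessel_coeff \<mu>" and ?d = "bessel_coeff_deriv \<mu>"
  define J1 where "J1 = exp_series \<mu> (\<lambda>k. (2 * of_nat k + \<mu>) * ?c k)"
  define K1 where "K1 = exp_series \<mu> (\<lambda>k. (2 * of_nat k + \<mu>) * ?d k)"
  have J: "(bessel_J_log \<mu> has_field_derivative J1 \<tau>) (at \<tau>)" for \<tau>
    unfolding bessel_J_log_def J1_def
    by (rule has_field_derivative_exp_series[OF summable_bessel_coeff])
  have "exp_series \<mu> (\<lambda>k. (2 * of_nat k + \<mu>) * ((2 * of_nat k + \<mu>) * ?c k)) \<tau>
    = (\<mu>\<^sup>2 - 4 * exp (2 * \<tau>)) * exp_series \<mu> ?c \<tau>" for \<tau>
    using exp_series_bessel_recurrence[of ?c "\<lambda>_. 0" \<mu> \<tau>] bessel_coeff_Suc summable_bessel_coeff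
    by simp
  then have J1: "(J1 has_field_derivative (\<mu>\<^sup>2 - 4 * exp (2 * \<tau>)) * bessel_J_log \<mu> \<tau>) (at \<tau>)" for \<tau>
    using has_field_derivative_exp_series[of "\<lambda>k. (2 * of_nat k + \<mu>) * ?c k" \<mu> \<tau>]
      summable_exp_series_deriv[of ?c \<mu>] summable_bessel_coeff[of \<mu>]
    by (simp add: J1_def bessel_J_log_def)
  have K: "(exp_series \<mu> ?d has_field_derivative K1 \<tau>) (at \<tau>)" for \<tau>
    unfolding K1_def by (rule has_field_derivative_exp_series[OF summable_bessel_coeff_deriv])
  have "exp_series \<mu> (\<lambda>k. (2 * of_nat k + \<mu>) * ((2 * of_nat k + \<mu>) * ?d k)) \<tau>
    = (\<mu>\<^sup>2 - 4 * exp (2 * \<tau>)) * exp_series \<mu> ?d \<tau> - 2 * (J1 \<tau> - \<mu> * bessel_J_log \<mu> \<tau>)" for \<tau>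
    unfolding J1_def bessel_J_log_def
    by (rule exp_series_bessel_recurrence)
      (rule summable_bessel_coeff summable_bessel_coeff_deriv bessel_coeff_deriv_Suc)+
  then have K1: "(K1 has_field_derivative
      (\<mu>\<^sup>2 - 4 * exp (2 * \<tau>)) * exp_series \<mu> ?d \<tau> - 2 * (J1 \<tau> - \<mu> * bessel_J_log \<mu> \<tau>)) (at \<tau>)" for \<tau>
    using has_field_derivative_exp_series[of "\<lambda>k. (2 * of_nat k + \<mu>) * ?d k" \<mu> \<tau>]
      summable_exp_series_deriv[of ?d \<mu>] summable_bessel_coeff_deriv[of \<mu>]
    by (simp add: K1_def)
  show ?thesis
    unfolding bessel_ode_def bessel_J_log_order_deriv_def
  proof (intro exI[of _ "\<lambda>\<tau>. bessel_J_log \<mu> \<tau> + \<tau> * J1 \<tau> + K1 \<tau>"] allI conjI)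
    fix \<tau>
    show "((\<lambda>\<tau>. \<tau> * bessel_J_log \<mu> \<tau> + exp_series \<mu> ?d \<tau>) has_field_derivative
        bessel_J_log \<mu> \<tau> + \<tau> * J1 \<tau> + K1 \<tau>) (at \<tau>)"
      using J K by (auto intro!: derivative_eq_intros)
    show "((\<lambda>\<tau>. bessel_J_log \<mu> \<tau> + \<tau> * J1 \<tau> + K1 \<tau>) has_field_derivative
        (\<mu>\<^sup>2 - 4 * exp (2 * \<tau>)) * (\<tau> * bessel_J_log \<mu> \<tau> + exp_series \<mu> ?d \<tau>)
        + 2 * \<mu> * bessel_J_log \<mu> \<tau>) (at \<tau>)"
      using J J1 K1 by (auto intro!: derivative_eq_intros simp: algebra_simps)
  qed
qed

text \<open>The reciprocal Gamma function vanishes at nonpositive integers, so the first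
  \<open>n\<close> coefficients of order \<open>- n\<close> are zero. Shifting the index by
  \<open>n\<close> gives the series of order \<open>n\<close> up to sign.\<close>

lemma bessel_J_log_minus_nat:
  "bessel_J_log (- of_nat n) \<tau> = (- 1) ^ n * bessel_J_log (of_nat n) \<tau>"
proof -
  define w where "w = exp (2 * \<tau>)"
  let ?c = "\<lambda>k. bessel_coeff (- of_nat n) k * w ^ k"
  have "?c k = 0" if "k < n" for k
  proof -
    have "- of_nat n + of_nat k + 1 = (- of_nat (n - Suc k) :: complex)"
      using that by (simp add: of_nat_diff)
    then have "rGamma (- of_nat n + of_nat k + 1 :: complex) = 0"
      by (simp only: rGamma_eq_zero_iff minus_of_nat_in_nonpos_Ints)
    then show ?thesis by (simp add: bessel_coeff_def)
  qed
  then have "(\<Sum>k<n. ?c k) = 0"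
    by (intro sum.neutral) auto
  then have "(\<Sum>k. ?c k) = (\<Sum>k. ?c (k + n))"
    using suminf_split_initial_segment[OF summable_bessel_coeff, of "- of_nat n" w n] by simp
  also have "\<dots> = (\<Sum>k. (- 1) ^ n * w ^ n * (bessel_coeff (of_nat n) k * w ^ k))"
  proof (rule suminf_cong)
    fix k
    have *: "rGamma (of_nat m + 1 :: complex) = inverse (fact m)" for m
      unfolding rGamma_inverse_Gamma add.commute[of _ 1] Gamma_fact ..
    have "- of_nat n + of_nat (k + n) + 1 = (of_nat k + 1 :: complex)"
      "of_nat n + of_nat k + 1 = (of_nat (k + n) + 1 :: complex)"
      by simp_all
    then have "rGamma (- of_nat n + of_nat (k + n) + 1 :: complex) = inverse (fact k)"
      "rGamma (of_nat n + of_nat k + 1 :: complex) = inverse (fact (k + n))"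
      by (simp_all only: *)
    then show "?c (k + n) = (- 1) ^ n * w ^ n * (bessel_coeff (of_nat n) k * w ^ k)"
      unfolding bessel_coeff_def divide_inverse by (simp only: power_add mult_ac)
  qed
  also have "\<dots> = (- 1) ^ n * w ^ n * (\<Sum>k. bessel_coeff (of_nat n) k * w ^ k)"
    by (rule suminf_mult[OF summable_bessel_coeff])
  finally have "bessel_J_log (- of_nat n) \<tau> = (- 1) ^ n * (exp (- of_nat n * \<tau>) * w ^ n)
      * (\<Sum>k. bessel_coeff (of_nat n) k * w ^ k)"
    unfolding bessel_J_log_def exp_series_def w_def by (simp only: mult_ac)
  moreover have "exp (- of_nat n * \<tau>) * w ^ n = exp (of_nat n * \<tau>)"
  proof -
    have "- of_nat n * \<tau> + of_nat n * (2 * \<tau>) = of_nat n * \<tau>" by simp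
    then show ?thesis
      unfolding w_def exp_of_nat_mult[symmetric] exp_add[symmetric] by (rule arg_cong)
  qed
  ultimately show ?thesis
    unfolding bessel_J_log_def exp_series_def w_def by (simp only: mult.assoc)
qed

section \<open>Bessel functions of the second kind\<close>

text \<open>At the order \<open>n\<close> the numerator vanishes by the relation between the orders
  \<open>n\<close> and \<open>- n\<close>, and so does the sine. L'Hopital's rule in the complex
  order applies; the derivative of the cosine factor drops out because it contains the sine.\<close>

lemma tendsto_bessel_Y_quotient:
  assumes "z \<noteq> 0"
  defines "\<tau> \<equiv> Ln (z / 2)"
  shows "((\<lambda>\<mu>. bessel_Y_quotient \<mu> z) \<longlongrightarrow>
    1 / of_real pi * bessel_J_log_order_deriv (of_nat n) \<tau>
    + (- 1) ^ n / of_real pi * bessel_J_log_order_deriv (- of_nat n) \<tau>) (at (of_nat n))"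
proof -
  have trig: "cos (of_real pi * of_nat n :: complex) = (- 1) ^ n"
    "sin (of_real pi * of_nat n :: complex) = 0"
    using cos_npi_complex'[of n, where ?'a = complex] sin_npi_complex'[of n, where ?'a = complex]
    by (simp_all only: mult.commute)
  have sq: "(- 1) ^ n * (- 1) ^ n = (1 :: complex)"
    by (simp flip: power_add)
  have "((\<lambda>\<mu>. (bessel_J_log \<mu> \<tau> * cos (of_real pi * \<mu>) - bessel_J_log (- \<mu>) \<tau>) / sin (of_real pi * \<mu>))
      \<longlongrightarrow> 1 / of_real pi * bessel_J_log_order_deriv (of_nat n) \<tau>
        + (- 1) ^ n / of_real pi * bessel_J_log_order_deriv (- of_nat n) \<tau>) (at (of_nat n))"
  proof (rule lhopital_complex_simple)
    have "((\<lambda>\<mu>. bessel_J_log (- \<mu>) \<tau>) has_field_derivative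
        bessel_J_log_order_deriv (- of_nat n) \<tau> * - 1) (at (of_nat n))"
      by (rule DERIV_chain2[OF has_field_derivative_bessel_J_log_order])
        (auto intro!: derivative_eq_intros)
    then show "((\<lambda>\<mu>. bessel_J_log \<mu> \<tau> * cos (of_real pi * \<mu>) - bessel_J_log (- \<mu>) \<tau>) has_field_derivative
        (- 1) ^ n * bessel_J_log_order_deriv (of_nat n) \<tau> + bessel_J_log_order_deriv (- of_nat n) \<tau>)
        (at (of_nat n))"
      by (auto intro!: derivative_eq_intros has_field_derivative_bessel_J_log_order simp: trig)
    show "((\<lambda>\<mu> :: complex. sin (of_real pi * \<mu>)) has_field_derivative of_real pi * (- 1) ^ n) (at (of_nat n))"
      by (auto intro!: derivative_eq_intros simp: trig)
    show "bessel_J_log (of_nat n) \<tau> * cos (of_real pi * of_nat n) - bessel_J_log (- of_nat n) \<tau> = 0"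
      unfolding trig bessel_J_log_minus_nat by simp
    show "((- 1) ^ n * bessel_J_log_order_deriv (of_nat n) \<tau> + bessel_J_log_order_deriv (- of_nat n) \<tau>) /
        (of_real pi * (- 1) ^ n) =
      1 / of_real pi * bessel_J_log_order_deriv (of_nat n) \<tau>
        + (- 1) ^ n / of_real pi * bessel_J_log_order_deriv (- of_nat n) \<tau>"
      using sq by (simp add: field_simps)
  qed (simp_all add: trig)
  then show ?thesis
    unfolding bessel_Y_quotient_def using assms by (simp add: bessel_J_eq_log)
qed

text \<open>A single solution \<open>y\<close> has to represent \<open>Y\<close> at all nonzero
  arguments, since the radius moves along a line in the variable \<open>Ln (z / 2)\<close>. For
  non-integer order \<open>y\<close> is a combination of \<open>J\<close> at the orders
  \<open>r\<close> and \<open>- r\<close>; for integer order it is the limit given by L'Hopital's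
  rule.\<close>

lemma bessel_Y_ode:
  assumes "0 \<le> r"
  shows "\<exists>y. bessel_ode (of_real r) (\<lambda>_. 0) y \<and> (\<forall>z. z \<noteq> 0 \<longrightarrow> bessel_Y (of_real r) z = y (Ln (z / 2)))"
proof (cases "of_real r \<in> (\<int> :: complex set)")
  case True
  then obtain m where "of_real r = (of_int m :: complex)"
    by (elim Ints_cases)
  then have "r = of_int m"
    by (metis of_real_eq_iff of_real_of_int_eq)
  then obtain n where n: "r = of_nat n"
    using assms by (metis of_int_0_le_iff of_int_of_nat_eq zero_le_imp_eq_int)
  let ?y = "\<lambda>\<tau>. 1 / of_real pi * bessel_J_log_order_deriv (of_nat n) \<tau>
    + (- 1) ^ n / of_real pi * bessel_J_log_order_deriv (- of_nat n) \<tau>"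
  have "bessel_Y (of_real r) z = ?y (Ln (z / 2))" if "z \<noteq> 0" for z
    using tendsto_Lim[OF _ tendsto_bessel_Y_quotient[OF that, of n]] True
    by (simp add: bessel_Y_def n)
  moreover have "bessel_ode (of_real r) (\<lambda>_. 0) ?y"
  proof -
    \<comment> \<open>The homogeneous part contains the order only through its square, so a function
      of order \<open>- n\<close> satisfies the equation of order \<open>n\<close>.\<close>
    have "bessel_ode (of_nat n) (\<lambda>\<tau>. 2 * (- of_nat n) * bessel_J_log (- of_nat n) \<tau>)
        (bessel_J_log_order_deriv (- of_nat n))"
      using bessel_ode_J_log_order_deriv[of "- of_nat n"] unfolding bessel_ode_def by simp
    from bessel_ode_linear_combination[OF bessel_ode_J_log_order_deriv this,
        of "1 / of_real pi" "(- 1) ^ n / of_real pi"]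
    \<comment> \<open>The two forcing terms cancel because \<open>J\<close> at order
      \<open>- n\<close> is \<open>J\<close> at order \<open>n\<close> up to the sign
      \<open>(- 1) ^ n\<close>.\<close>
    moreover have "1 / of_real pi * (2 * of_nat n * bessel_J_log (of_nat n) \<tau>)
        + (- 1) ^ n / of_real pi * (2 * (- of_nat n) * bessel_J_log (- of_nat n) \<tau>) = 0" for \<tau>
    proof -
      have "(- 1) ^ n * (- 1) ^ n = (1 :: complex)"
        by (simp flip: power_add)
      then show ?thesis
        unfolding bessel_J_log_minus_nat by (simp add: field_simps)
    qed
    ultimately show ?thesis
      by (simp only: n of_real_of_nat_eq)
  qed
  ultimately show ?thesis by blast
next
  case False
  let ?y = "\<lambda>\<tau>. cos (of_real pi * of_real r) / sin (of_real pi * of_real r) * bessel_J_log (of_real r) \<tau>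
    + - 1 / sin (of_real pi * of_real r) * bessel_J_log (- of_real r) \<tau>"
  have "bessel_Y (of_real r) z = ?y (Ln (z / 2))" if "z \<noteq> 0" for z
    using False that
    by (simp add: bessel_Y_def bessel_Y_quotient_def bessel_J_eq_log diff_divide_distrib mult_ac)
  moreover have "bessel_ode (of_real r) (\<lambda>_. 0) ?y"
  proof -
    have "bessel_ode (of_real r) (\<lambda>_. 0) (bessel_J_log (- of_real r))"
      using bessel_ode_J_log[of "- of_real r"] unfolding bessel_ode_def by simp
    from bessel_ode_linear_combination[OF bessel_ode_J_log this,
        of "cos (of_real pi * of_real r) / sin (of_real pi * of_real r)" "- 1 / sin (of_real pi * of_real r)"]
    show ?thesis by simp
  qed
  ultimately show ?thesis by blast
qed

subsection \<open>Decay of solutions of the radial equation\<close>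

text \<open>At a positive interior maximum the first derivative vanishes, and with it the damping
  term, whatever the sign of \<open>\<alpha>\<close>. Positivity of \<open>q\<close> then makes the
  second derivative positive, so \<open>z\<close> would increase to the right of its
  maximum.\<close>

lemma maximum_principle:
  fixes z :: "real \<Rightarrow> real"
  assumes "a \<le> b"
    and z: "\<And>t. (z has_real_derivative z' t) (at t)"
    and z': "\<And>t. (z' has_real_derivative z'' t) (at t)"
    and sub: "\<And>t. a < t \<Longrightarrow> t < b \<Longrightarrow> \<alpha> * z' t + q t * z t \<le> z'' t"
    and q: "\<And>t. a < t \<Longrightarrow> t < b \<Longrightarrow> 0 < q t"
    and bdry: "z a \<le> 0" "z b \<le> 0"
    and t: "t \<in> {a..b}"
  shows "z t \<le> 0"
proof (rule ccontr)
  assume "\<not> z t \<le> 0"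
  have "continuous_on {a..b} z"
    using z by (meson DERIV_isCont continuous_at_imp_continuous_on)
  then obtain c where c: "c \<in> {a..b}" "\<And>s. s \<in> {a..b} \<Longrightarrow> z s \<le> z c"
    using continuous_attains_sup[of "{a..b}" z] t by auto
  then have "0 < z c"
    using \<open>\<not> z t \<le> 0\<close> t by fastforce
  then have ab: "a < c" "c < b"
    using c(1) bdry by (auto simp: less_le)
  have "z' c = 0"
  proof (rule DERIV_local_max[OF z])
    show "0 < min (c - a) (b - c)" using ab by simp
    show "\<forall>s. \<bar>c - s\<bar> < min (c - a) (b - c) \<longrightarrow> z s \<le> z c"
      using c(2) by (auto simp: abs_less_iff)
  qed
  then have "0 < z'' c"
    using sub[OF ab] mult_pos_pos[OF q[OF ab] \<open>0 < z c\<close>] by simp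
  from DERIV_pos_inc_right[OF z' this] obtain d where d: "0 < d" "\<And>h. 0 < h \<Longrightarrow> h < d \<Longrightarrow> 0 < z' (c + h)"
    using \<open>z' c = 0\<close> by auto
  \<comment> \<open>This point lies to the right of \<open>c\<close>, still inside
    \<open>{a..b}\<close>, and \<open>z'\<close> is positive strictly between \<open>c\<close> and
    \<open>s\<close>.\<close>
  define s where "s = c + min (d / 2) (b - c)"
  have "z c < z s"
  proof (rule DERIV_pos_imp_increasing_open[of c s z])
    show "c < s" using d(1) ab by (simp add: s_def)
    show "\<exists>y. (z has_real_derivative y) (at x) \<and> 0 < y" if "c < x" "x < s" for x
      using z[of x] d(2)[of "x - c"] that d(1) by (auto simp: s_def min_def split: if_splits)
    show "continuous_on {c..s} z"
      using z by (meson DERIV_isCont continuous_at_imp_continuous_on)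
  qed
  moreover have "s \<in> {a..b}" using ab d(1) by (auto simp: s_def min_def)
  ultimately show False using c(2) by fastforce
qed

text \<open>The range is kept general because the comparison argument concerns real solutions while
  the radial factors are complex. The derivative is an explicit argument because its decay in
  \<open>n\<close> is needed as well.\<close>

definition radial_ode :: "real \<Rightarrow> real \<Rightarrow> real \<Rightarrow> (real \<Rightarrow> 'a :: real_normed_vector) \<Rightarrow> (real \<Rightarrow> 'a) \<Rightarrow> bool" where
  "radial_ode \<alpha> \<beta> n v v' \<longleftrightarrow> (\<forall>t. (v has_vector_derivative v' t) (at t) \<and>
     (v' has_vector_derivative \<alpha> *\<^sub>R v' t + (n\<^sup>2 - \<beta>\<^sup>2 * exp (2 * t)) *\<^sub>R v t) (at t))"

lemma radial_ode_linear_combination: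
  fixes v w :: "real \<Rightarrow> 'a :: real_normed_algebra"
  assumes "radial_ode \<alpha> \<beta> n v v'" "radial_ode \<alpha> \<beta> n w w'"
  shows "radial_ode \<alpha> \<beta> n (\<lambda>t. c * v t + d * w t) (\<lambda>t. c * v' t + d * w' t)"
  using assms unfolding radial_ode_def
  by (auto intro!: derivative_eq_intros has_vector_derivative_mult_right simp: algebra_simps)

text \<open>The coefficients of the equation are real, so real-linear maps preserve solutions. It is
  used for real and imaginary parts and for their negatives.\<close>

lemma radial_ode_bounded_linear:
  assumes "bounded_linear f" "radial_ode \<alpha> \<beta> n v v'"
  shows "radial_ode \<alpha> \<beta> n (\<lambda>t. f (v t)) (\<lambda>t. f (v' t))"
proof -
  interpret bounded_linear f by fact
  show ?thesis
    unfolding radial_ode_def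
  proof (intro allI conjI)
    fix t
    show "((\<lambda>t. f (v t)) has_vector_derivative f (v' t)) (at t)"
      using assms(2) unfolding radial_ode_def by (blast intro: has_vector_derivative)
    have "((\<lambda>t. f (v' t)) has_vector_derivative
        f (\<alpha> *\<^sub>R v' t + (n\<^sup>2 - \<beta>\<^sup>2 * exp (2 * t)) *\<^sub>R v t)) (at t)"
      using assms(2) unfolding radial_ode_def by (blast intro: has_vector_derivative)
    then show "((\<lambda>t. f (v' t)) has_vector_derivative
        \<alpha> *\<^sub>R f (v' t) + (n\<^sup>2 - \<beta>\<^sup>2 * exp (2 * t)) *\<^sub>R f (v t)) (at t)"
      by (simp add: add scaleR)
  qed
qed

text \<open>The barrier is a supersolution as soon as \<open>n\<close> is large.\<close>

lemma radial_ode_barrier: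
  fixes v :: "real \<Rightarrow> real"
  assumes ode: "radial_ode \<alpha> \<beta> n v v'" and "a \<le> b" "0 < n"
    and n: "n\<^sup>2 / 4 + \<bar>\<alpha>\<bar> * n / 2 + \<beta>\<^sup>2 * exp (2 * b) \<le> n\<^sup>2"
    and bdry: "v a \<le> M" "v b \<le> M" and "0 \<le> M" and t: "t \<in> {a..b}"
  shows "v t \<le> M * (exp (- (n / 2) * (t - a)) + exp (- (n / 2) * (b - t)))"
proof -
  define e where "e t = exp (- (n / 2) * (t - a))" for t
  define f where "f t = exp (- (n / 2) * (b - t))" for t
  define z where "z t = v t - M * (e t + f t)" for t
  define z' where "z' t = v' t - M * (n / 2) * (f t - e t)" for t
  define z'' where "z'' t = \<alpha> * v' t + (n\<^sup>2 - \<beta>\<^sup>2 * exp (2 * t)) * v t - M * (n / 2)\<^sup>2 * (e t + f t)" for t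
  have v: "(v has_real_derivative v' t) (at t)"
    "(v' has_real_derivative \<alpha> * v' t + (n\<^sup>2 - \<beta>\<^sup>2 * exp (2 * t)) * v t) (at t)" for t
    using ode unfolding radial_ode_def has_real_derivative_iff_has_vector_derivative by auto
  have e: "(e has_real_derivative - (n / 2) * e t) (at t)"
    and f: "(f has_real_derivative n / 2 * f t) (at t)" for t
    unfolding e_def f_def by (auto intro!: derivative_eq_intros)
  have "z t \<le> 0"
  proof (rule maximum_principle[OF \<open>a \<le> b\<close>, where z = z and t = t and \<alpha> = \<alpha> and q = "\<lambda>t. n\<^sup>2 - \<beta>\<^sup>2 * exp (2 * t)"
        and z' = z' and z'' = z''])
    fix t
    show "(z has_real_derivative z' t) (at t)"
      unfolding z_def z'_def
      by (rule derivative_eq_intros v e f refl)+ (simp add: field_simps)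
    show "(z' has_real_derivative z'' t) (at t)"
      unfolding z'_def z''_def
      by (rule derivative_eq_intros v e f refl)+ (simp add: field_simps power2_eq_square)
  next
    fix t assume t: "a < t" "t < b"
    have "\<beta>\<^sup>2 * exp (2 * t) \<le> \<beta>\<^sup>2 * exp (2 * b)"
      using t by (intro mult_left_mono) auto
    then have q: "n\<^sup>2 / 4 + \<bar>\<alpha>\<bar> * n / 2 \<le> n\<^sup>2 - \<beta>\<^sup>2 * exp (2 * t)"
      using n by linarith
    show "0 < n\<^sup>2 - \<beta>\<^sup>2 * exp (2 * t)"
    proof -
      have "0 < n\<^sup>2 / 4" "0 \<le> \<bar>\<alpha>\<bar> * n / 2" using \<open>0 < n\<close> by auto
      then show ?thesis using q by linarith
    qed
    have an: "\<alpha> * (n / 2) \<le> \<bar>\<alpha>\<bar> * n / 2" "- \<alpha> * (n / 2) \<le> \<bar>\<alpha>\<bar> * n / 2"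
      using mult_right_mono[of \<alpha> "\<bar>\<alpha>\<bar>" "n / 2"] mult_right_mono[of "- \<alpha>" "\<bar>\<alpha>\<bar>" "n / 2"] \<open>0 < n\<close>
      by auto
    \<comment> \<open>An exponential with rate \<open>n / 2\<close> contributes a quarter of the
      square of \<open>n\<close> through its second derivative and at most
      \<open>\<bar>\<alpha>\<bar> * n / 2\<close> through the damping. The largeness assumption on
      \<open>n\<close> says that the zeroth-order coefficient dominates both.\<close>
    have "0 \<le> M * e t * (n\<^sup>2 - \<beta>\<^sup>2 * exp (2 * t) - n\<^sup>2 / 4 - \<alpha> * (n / 2))"
      "0 \<le> M * f t * (n\<^sup>2 - \<beta>\<^sup>2 * exp (2 * t) - n\<^sup>2 / 4 + \<alpha> * (n / 2))"
      using q an \<open>0 \<le> M\<close> by (auto intro!: mult_nonneg_nonneg simp: e_def f_def)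
    moreover have "z'' t - (\<alpha> * z' t + (n\<^sup>2 - \<beta>\<^sup>2 * exp (2 * t)) * z t)
      = M * e t * (n\<^sup>2 - \<beta>\<^sup>2 * exp (2 * t) - n\<^sup>2 / 4 - \<alpha> * (n / 2))
        + M * f t * (n\<^sup>2 - \<beta>\<^sup>2 * exp (2 * t) - n\<^sup>2 / 4 + \<alpha> * (n / 2))"
      unfolding z_def z'_def z''_def by (simp add: field_simps power2_eq_square)
    ultimately show "\<alpha> * z' t + (n\<^sup>2 - \<beta>\<^sup>2 * exp (2 * t)) * z t \<le> z'' t"
      by linarith
  next
    \<comment> \<open>At each endpoint one of the two exponentials equals 1, so the barrier is at
      least \<open>M\<close> there.\<close>
    have "M * 1 \<le> M * (e a + f a)" "M * 1 \<le> M * (e b + f b)"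
      using \<open>0 \<le> M\<close> by (intro mult_left_mono; simp add: e_def f_def)+
    then show "z a \<le> 0" "z b \<le> 0"
      using bdry by (auto simp: z_def)
  qed (use t in auto)
  then show ?thesis by (simp add: z_def e_def f_def)
qed

text \<open>The barrier bounds the real and the imaginary part from both sides; the factor 2 comes
  from adding the two bounds.\<close>

lemma radial_ode_decay:
  fixes v :: "real \<Rightarrow> complex"
  assumes ode: "radial_ode \<alpha> \<beta> n v v'" and "a \<le> b" "0 < n"
    and n: "n\<^sup>2 / 4 + \<bar>\<alpha>\<bar> * n / 2 + \<beta>\<^sup>2 * exp (2 * b) \<le> n\<^sup>2"
    and bdry: "norm (v a) \<le> M" "norm (v b) \<le> M" and t: "t \<in> {a..b}"
  shows "norm (v t) \<le> 2 * M * (exp (- (n / 2) * (t - a)) + exp (- (n / 2) * (b - t)))"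
proof -
  let ?w = "M * (exp (- (n / 2) * (t - a)) + exp (- (n / 2) * (b - t)))"
  have M: "0 \<le> M" using bdry(1) norm_ge_zero order_trans by blast
  have "f (v t) \<le> ?w" if f: "bounded_linear f" "\<And>x. f x \<le> norm x" for f
    using radial_ode_barrier[OF radial_ode_bounded_linear[OF f(1) ode] \<open>a \<le> b\<close> \<open>0 < n\<close> n _ _ M t]
      f(2) bdry order_trans by blast
  note bound = this
  have "\<bar>Re (v t)\<bar> \<le> ?w"
    using bound[OF bounded_linear_Re complex_Re_le_cmod]
      bound[OF bounded_linear_minus[OF bounded_linear_Re]] abs_Re_le_cmod
    by (fastforce simp: abs_le_iff)
  moreover have "\<bar>Im (v t)\<bar> \<le> ?w"
    using bound[OF bounded_linear_Im] bound[OF bounded_linear_minus[OF bounded_linear_Im]] abs_Im_le_cmod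
    by (fastforce simp: abs_le_iff)
  ultimately show ?thesis
    using cmod_le[of "v t"] by linarith
qed

text \<open>The mean value theorem yields one point where \<open>v'\<close> is small. The
  integrating factor \<open>exp (- \<alpha> * t)\<close> removes the damping, so the weighted
  derivative changes at a rate controlled by \<open>v\<close>; \<open>E\<close> bounds this factor
  and its inverse. The bound grows only quadratically in \<open>n\<close>, which exponential decay
  of \<open>v\<close> absorbs.\<close>

lemma radial_ode_deriv_bound_real:
  fixes v :: "real \<Rightarrow> real"
  assumes ode: "radial_ode \<alpha> \<beta> n v v'" and "a < b"
    and v_le: "\<And>t. t \<in> {a..b} \<Longrightarrow> \<bar>v t\<bar> \<le> \<epsilon>" and t: "t \<in> {a..b}"
  defines "E \<equiv> exp (\<bar>\<alpha>\<bar> * (\<bar>a\<bar> + \<bar>b\<bar>))"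
  shows "\<bar>v' t\<bar> \<le> E\<^sup>2 * (2 / (b - a) + (b - a) * (n\<^sup>2 + \<beta>\<^sup>2 * exp (2 * b))) * \<epsilon>"
proof -
  define Q where "Q = n\<^sup>2 + \<beta>\<^sup>2 * exp (2 * b)"
  have v: "(v has_real_derivative v' t) (at t)"
    "(v' has_real_derivative \<alpha> * v' t + (n\<^sup>2 - \<beta>\<^sup>2 * exp (2 * t)) * v t) (at t)" for t
    using ode unfolding radial_ode_def has_real_derivative_iff_has_vector_derivative by auto
  have \<epsilon>: "0 \<le> \<epsilon>" using v_le[OF t] by linarith
  have E: "exp (- \<alpha> * s) \<le> E" "exp (\<alpha> * s) \<le> E" if "s \<in> {a..b}" for s
  proof -
    have "\<bar>\<alpha> * s\<bar> \<le> \<bar>\<alpha>\<bar> * (\<bar>a\<bar> + \<bar>b\<bar>)"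
      unfolding abs_mult using that by (intro mult_left_mono) auto
    then show "exp (- \<alpha> * s) \<le> E" "exp (\<alpha> * s) \<le> E" by (auto simp: E_def abs_le_iff)
  qed
  obtain \<xi> where \<xi>: "a < \<xi>" "\<xi> < b" "v b - v a = (b - a) * v' \<xi>"
    using MVT2[OF \<open>a < b\<close>, of v v'] v(1) by blast
  then have "\<bar>(b - a) * v' \<xi>\<bar> \<le> 2 * \<epsilon>"
    using v_le[of a] v_le[of b] \<open>a < b\<close> by (simp flip: \<xi>(3))
  then have v\<xi>: "\<bar>v' \<xi>\<bar> \<le> 2 / (b - a) * \<epsilon>"
    using \<open>a < b\<close> by (simp add: abs_mult field_simps)
  define g where "g t = exp (- \<alpha> * t) * v' t" for t
  have g: "(g has_real_derivative exp (- \<alpha> * t) * ((n\<^sup>2 - \<beta>\<^sup>2 * exp (2 * t)) * v t)) (at t)" for t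
    unfolding g_def by (rule derivative_eq_intros v refl)+ (simp add: algebra_simps)
  have g': "norm (exp (- \<alpha> * s) * ((n\<^sup>2 - \<beta>\<^sup>2 * exp (2 * s)) * v s)) \<le> E * (Q * \<epsilon>)" if s: "s \<in> {a..b}" for s
  proof -
    have "\<beta>\<^sup>2 * exp (2 * s) \<le> \<beta>\<^sup>2 * exp (2 * b)"
      using s by (intro mult_left_mono) auto
    moreover have "0 \<le> \<beta>\<^sup>2 * exp (2 * s)" "0 \<le> n\<^sup>2" by auto
    ultimately have "\<bar>n\<^sup>2 - \<beta>\<^sup>2 * exp (2 * s)\<bar> \<le> Q"
      unfolding Q_def abs_le_iff by linarith
    then show ?thesis
      unfolding real_norm_def abs_mult using E(1)[OF s] v_le[OF s]
      by (intro mult_mono) (auto simp: E_def)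
  qed
  have "norm (g t - g \<xi>) \<le> E * (Q * \<epsilon>) * norm (t - \<xi>)"
    by (rule field_differentiable_bound[of "{a..b}"])
      (use g g' t \<xi> in \<open>auto intro: has_field_derivative_at_within\<close>)
  also have "\<dots> \<le> E * (Q * \<epsilon>) * (b - a)"
    using t \<xi> \<epsilon> by (intro mult_left_mono) (auto simp: E_def Q_def)
  finally have "\<bar>g t\<bar> \<le> \<bar>g \<xi>\<bar> + E * (Q * \<epsilon>) * (b - a)"
    unfolding real_norm_def by linarith
  also have "\<bar>g \<xi>\<bar> \<le> E * (2 / (b - a) * \<epsilon>)"
    unfolding g_def abs_mult using E(1)[of \<xi>] \<xi> v\<xi> by (intro mult_mono) (auto simp: E_def)
  finally have "\<bar>g t\<bar> \<le> E * (2 / (b - a) + (b - a) * Q) * \<epsilon>"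
    by (simp add: algebra_simps)
  moreover have "\<bar>v' t\<bar> = exp (\<alpha> * t) * \<bar>g t\<bar>"
    by (simp add: g_def abs_mult exp_minus field_simps)
  moreover have "exp (\<alpha> * t) * \<bar>g t\<bar> \<le> E * (E * (2 / (b - a) + (b - a) * Q) * \<epsilon>)"
    using E(2)[OF t] calculation(1) by (intro mult_mono) (auto simp: E_def)
  ultimately show ?thesis
    unfolding Q_def[symmetric] by (simp add: power2_eq_square mult_ac)
qed

lemma radial_ode_deriv_bound:
  fixes v :: "real \<Rightarrow> complex"
  assumes ode: "radial_ode \<alpha> \<beta> n v v'" and "a < b"
    and v_le: "\<And>t. t \<in> {a..b} \<Longrightarrow> norm (v t) \<le> \<epsilon>" and t: "t \<in> {a..b}"
  defines "E \<equiv> exp (\<bar>\<alpha>\<bar> * (\<bar>a\<bar> + \<bar>b\<bar>))"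
  shows "norm (v' t) \<le> 2 * (E\<^sup>2 * (2 / (b - a) + (b - a) * (n\<^sup>2 + \<beta>\<^sup>2 * exp (2 * b))) * \<epsilon>)"
proof -
  have "\<bar>f (v' t)\<bar> \<le> E\<^sup>2 * (2 / (b - a) + (b - a) * (n\<^sup>2 + \<beta>\<^sup>2 * exp (2 * b))) * \<epsilon>"
    if f: "bounded_linear f" "\<And>x. \<bar>f x\<bar> \<le> norm x" for f
    unfolding E_def
    by (rule radial_ode_deriv_bound_real[OF radial_ode_bounded_linear[OF f(1) ode] \<open>a < b\<close> _ t])
      (use f(2) v_le order_trans in blast)
  from this[OF bounded_linear_Re abs_Re_le_cmod] this[OF bounded_linear_Im abs_Im_le_cmod]
  show ?thesis
    using cmod_le[of "v' t"] by linarith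
qed

section \<open>Exponential decay in the index, locally uniform in the radius\<close>

text \<open>Uniformity near \<open>r\<close> is what the Weierstrass test requires. An exponential
  rate is demanded instead of mere summability because it survives multiplication by
  \<open>n\<close>, hence repeated differentiation.\<close>

definition decays_at :: "(nat \<Rightarrow> real \<Rightarrow> complex) \<Rightarrow> real \<Rightarrow> bool" where
  "decays_at u r \<longleftrightarrow>
     (\<exists>c K N. 0 < c \<and> (\<forall>\<^sub>F x in nhds r. \<forall>n\<ge>N. norm (u n x) \<le> K * exp (- c * real n)))"

lemma decays_at_add:
  assumes "decays_at u r" "decays_at w r"
  shows "decays_at (\<lambda>n x. u n x + w n x) r"
proof -
  obtain c K N where c: "0 < c" and u: "\<forall>\<^sub>F x in nhds r. \<forall>n\<ge>N. norm (u n x) \<le> K * exp (- c * real n)"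
    using assms(1) unfolding decays_at_def by blast
  obtain d L P where d: "0 < d" and w: "\<forall>\<^sub>F x in nhds r. \<forall>n\<ge>P. norm (w n x) \<le> L * exp (- d * real n)"
    using assms(2) unfolding decays_at_def by blast
  have "\<forall>\<^sub>F x in nhds r. \<forall>n\<ge>max N P. norm (u n x + w n x) \<le> (\<bar>K\<bar> + \<bar>L\<bar>) * exp (- min c d * real n)"
    using u w
  proof eventually_elim
    case (elim x)
    show ?case
    proof (intro allI impI)
      fix n assume n: "max N P \<le> n"
      have "K * exp (- c * real n) \<le> \<bar>K\<bar> * exp (- min c d * real n)"
        "L * exp (- d * real n) \<le> \<bar>L\<bar> * exp (- min c d * real n)"
        by (intro mult_mono; simp add: mult_right_mono)+
      then show "norm (u n x + w n x) \<le> (\<bar>K\<bar> + \<bar>L\<bar>) * exp (- min c d * real n)"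
        using elim n norm_triangle_ineq[of "u n x" "w n x"] by (fastforce simp: ring_distribs)
    qed
  qed
  moreover have "0 < min c d" using c d by simp
  ultimately show ?thesis unfolding decays_at_def by blast
qed

text \<open>Half of the rate is given up: \<open>real n\<close> is at most
  \<open>2 / c * exp (c / 2 * real n)\<close>.\<close>

lemma decays_at_nat_mult:
  assumes "decays_at u r"
  shows "decays_at (\<lambda>n x. of_nat n * u n x) r"
proof -
  obtain c K N where c: "0 < c" and u: "\<forall>\<^sub>F x in nhds r. \<forall>n\<ge>N. norm (u n x) \<le> K * exp (- c * real n)"
    using assms(1) unfolding decays_at_def by blast
  have "\<forall>\<^sub>F x in nhds r. \<forall>n\<ge>N. norm (of_nat n * u n x) \<le> (2 / c * K) * exp (- (c / 2) * real n)"
    using u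
  proof eventually_elim
    case (elim x)
    show ?case
    proof (intro allI impI)
      fix n assume n: "N \<le> n"
      have K: "norm (u n x) \<le> K * exp (- c * real n)" using elim n by blast
      have "c / 2 * real n \<le> exp (c / 2 * real n)"
        using exp_ge_add_one_self[of "c / 2 * real n"] by linarith
      then have "real n \<le> 2 / c * exp (c / 2 * real n)"
        using c by (simp add: field_simps)
      then have "real n * norm (u n x) \<le> 2 / c * exp (c / 2 * real n) * (K * exp (- c * real n))"
        using K c by (intro mult_mono) auto
      also have "\<dots> = 2 / c * K * (exp (c / 2 * real n) * exp (- c * real n))"
        by simp
      also have "exp (c / 2 * real n) * exp (- c * real n) = exp (- (c / 2) * real n)"
        unfolding exp_add[symmetric] by (simp add: field_simps)
      finally show "norm (of_nat n * u n x) \<le> (2 / c * K) * exp (- (c / 2) * real n)"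
        by (simp add: norm_mult)
    qed
  qed
  moreover have "0 < c / 2" using c by simp
  ultimately show ?thesis unfolding decays_at_def by blast
qed

lemma decays_at_dominated:
  assumes "decays_at u r" and "\<forall>\<^sub>F x in nhds r. \<forall>n\<ge>N. norm (w n x) \<le> C * norm (u n x)"
  shows "decays_at w r"
proof -
  obtain c K P where c: "0 < c" and u: "\<forall>\<^sub>F x in nhds r. \<forall>n\<ge>P. norm (u n x) \<le> K * exp (- c * real n)"
    using assms(1) unfolding decays_at_def by blast
  have "\<forall>\<^sub>F x in nhds r. \<forall>n\<ge>max N P. norm (w n x) \<le> \<bar>C\<bar> * K * exp (- c * real n)"
    using u assms(2)
  proof eventually_elim
    case (elim x)
    show ?case
    proof (intro allI impI)
      fix n assume n: "max N P \<le> n"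
      then have "norm (w n x) \<le> C * norm (u n x)" "norm (u n x) \<le> K * exp (- c * real n)"
        using elim by auto
      moreover have "C * norm (u n x) \<le> \<bar>C\<bar> * norm (u n x)"
        by (intro mult_right_mono) auto
      moreover have "\<bar>C\<bar> * norm (u n x) \<le> \<bar>C\<bar> * (K * exp (- c * real n))"
        using calculation(2) by (intro mult_left_mono) auto
      ultimately show "norm (w n x) \<le> \<bar>C\<bar> * K * exp (- c * real n)"
        by (simp add: mult_ac)
    qed
  qed
  then show ?thesis using c unfolding decays_at_def by blast
qed

lemma decays_at_mult:
  assumes "decays_at u r" "isCont f r"
  shows "decays_at (\<lambda>n x. f x * u n x) r"
proof (rule decays_at_dominated[OF assms(1)])
  have "\<forall>\<^sub>F x in nhds r. norm (f x) < norm (f r) + 1"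
  proof (rule order_tendstoD)
    show "((\<lambda>x. norm (f x)) \<longlongrightarrow> norm (f r)) (nhds r)"
      using assms(2) by (intro tendsto_norm) (simp add: isCont_def tendsto_at_iff_tendsto_nhds)
  qed simp
  then show "\<forall>\<^sub>F x in nhds r. \<forall>n\<ge>0. norm (f x * u n x) \<le> (norm (f r) + 1) * norm (u n x)"
    by eventually_elim (auto simp: norm_mult intro!: mult_right_mono)
qed

lemma decays_at_compose:
  assumes "decays_at u (g r)" "isCont g r"
  shows "decays_at (\<lambda>n x. u n (g x)) r"
proof -
  have "filterlim g (nhds (g r)) (nhds r)"
    using assms(2) by (simp add: isCont_def tendsto_at_iff_tendsto_nhds)
  then show ?thesis
    using assms(1) unfolding decays_at_def
    by (elim exE conjE) (intro exI conjI, assumption, rule eventually_compose_filterlim)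
qed

text \<open>The barriers decay at a rate proportional to the distance from the endpoints. Halving
  the interval towards \<open>r\<close> keeps this distance bounded below on a whole neighbourhood
  and leaves room for the derivative estimate.\<close>

lemma decays_at_radial_ode:
  fixes v :: "nat \<Rightarrow> real \<Rightarrow> complex"
  assumes ode: "\<And>n. radial_ode \<alpha> \<beta> (real n) (v n) (v' n)"
    and "a < r" "r < b"
    and bdd: "\<And>t. t \<in> {a, b} \<Longrightarrow> \<exists>M N. \<forall>n\<ge>N. norm (v n t) \<le> M"
  shows "decays_at v r" "decays_at v' r"
proof -
  obtain M1 N1 where 1: "\<And>n. n \<ge> N1 \<Longrightarrow> norm (v n a) \<le> M1" using bdd[of a] by auto
  obtain M2 N2 where 2: "\<And>n. n \<ge> N2 \<Longrightarrow> norm (v n b) \<le> M2" using bdd[of b] by auto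
  define M where "M = max M1 M2"
  \<comment> \<open>For \<open>n \<ge> B\<close> the square of \<open>n\<close> is at least
    \<open>B * n\<close>, so the damping and exponential terms of the barrier condition take up at
    most half of it. The summand 1 ensures \<open>n \<ge> 1\<close>.\<close>
  define B where "B = 2 * \<bar>\<alpha>\<bar> + 2 * \<beta>\<^sup>2 * exp (2 * b) + 1"
  obtain N3 :: nat where N3: "B \<le> real N3" using real_arch_simple by blast
  define N where "N = max N1 (max N2 N3)"
  define a2 b2 where "a2 = (a + r) / 2" and "b2 = (r + b) / 2"
  \<comment> \<open>On \<open>{a2..b2}\<close> each endpoint is at least half as far away as it is
    from \<open>r\<close>, and the barrier has rate \<open>n / 2\<close>; this gives the
    quarter.\<close>
  define c where "c = min (r - a) (b - r) / 4"
  have ab2: "a < a2" "a2 < r" "r < b2" "b2 < b" and "0 < c"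
    using \<open>a < r\<close> \<open>r < b\<close> by (auto simp: a2_def b2_def c_def)
  have v: "norm (v n t) \<le> 4 * M * exp (- c * real n)" if n: "n \<ge> N" and t: "t \<in> {a2..b2}" for n t
  proof -
    have "B \<le> real n" using n N3 by (simp add: N_def)
    moreover have "1 \<le> B" by (simp add: B_def)
    ultimately have n1: "1 \<le> real n" by linarith
    have large: "(real n)\<^sup>2 / 4 + \<bar>\<alpha>\<bar> * real n / 2 + \<beta>\<^sup>2 * exp (2 * b) \<le> (real n)\<^sup>2"
    proof -
      have "B * real n \<le> real n * real n" using \<open>B \<le> real n\<close> by (intro mult_right_mono) auto
      moreover have "\<beta>\<^sup>2 * exp (2 * b) * 1 \<le> \<beta>\<^sup>2 * exp (2 * b) * real n"
        using n1 by (intro mult_left_mono) auto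
      moreover have "B * real n = 2 * (\<bar>\<alpha>\<bar> * real n) + 2 * (\<beta>\<^sup>2 * exp (2 * b) * real n) + real n"
        by (simp add: B_def ring_distribs)
      moreover have "0 \<le> \<beta>\<^sup>2 * exp (2 * b)" "0 \<le> \<bar>\<alpha>\<bar> * real n" "0 \<le> real n" by auto
      ultimately show ?thesis
        unfolding power2_eq_square[of "real n"] by linarith
    qed
    have "norm (v n t) \<le> 2 * M * (exp (- (real n / 2) * (t - a)) + exp (- (real n / 2) * (b - t)))"
    proof (rule radial_ode_decay[OF ode _ _ large])
      show "norm (v n a) \<le> M" "norm (v n b) \<le> M"
        using 1[of n] 2[of n] n by (auto simp: M_def N_def)
    qed (use n1 t ab2 in auto)
    also have "\<dots> \<le> 2 * M * (exp (- c * real n) + exp (- c * real n))"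
    proof (intro mult_left_mono add_mono)
      have "c \<le> (t - a) / 2" "c \<le> (b - t) / 2"
        using t by (auto simp: c_def a2_def b2_def min_def field_simps)
      then have "c * real n \<le> (t - a) / 2 * real n" "c * real n \<le> (b - t) / 2 * real n"
        by (auto intro!: mult_right_mono simp del: times_divide_eq_left)
      then show "exp (- (real n / 2) * (t - a)) \<le> exp (- c * real n)"
        "exp (- (real n / 2) * (b - t)) \<le> exp (- c * real n)"
        by (auto simp: algebra_simps)
      show "0 \<le> 2 * M"
        using 1[of n] n norm_ge_zero[of "v n a"] by (auto simp: M_def N_def simp del: norm_ge_zero)
    qed
    finally show ?thesis by (simp add: algebra_simps)
  qed
  have near: "\<forall>\<^sub>F x in nhds r. x \<in> {a2..b2}"
    by (rule eventually_nhds_in_nhd) (use ab2 in \<open>auto simp: interior_atLeastAtMost_real\<close>)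
  have "\<forall>\<^sub>F x in nhds r. \<forall>n\<ge>N. norm (v n x) \<le> 4 * M * exp (- c * real n)"
    using near by eventually_elim (use v in blast)
  then show "decays_at v r"
    unfolding decays_at_def using \<open>0 < c\<close> by blast
  let ?E = "exp (\<bar>\<alpha>\<bar> * (\<bar>a2\<bar> + \<bar>b2\<bar>))"
  \<comment> \<open>A sequence that does not depend on the radius. The bound for \<open>v'\<close>
    is \<open>?k + ?l * n * n\<close> times it, so decay follows from the closure rules.\<close>
  let ?u = "\<lambda>n x::real. complex_of_real (4 * M * exp (- c * real n))"
  let ?k = "2 * (?E\<^sup>2 * (2 / (b2 - a2) + (b2 - a2) * (\<beta>\<^sup>2 * exp (2 * b2))))"
  let ?l = "2 * (?E\<^sup>2 * (b2 - a2))"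
  have u: "decays_at ?u r"
    unfolding decays_at_def
    by (intro exI[of _ c] exI[of _ "\<bar>4 * M\<bar>"] exI[of _ 0])
      (simp add: \<open>0 < c\<close> norm_mult abs_mult del: of_real_mult)
  have "decays_at (\<lambda>n x. of_real ?k * ?u n x + of_real ?l * (of_nat n * (of_nat n * ?u n x))) r"
    by (intro decays_at_add decays_at_mult decays_at_nat_mult u continuous_const)
  then show "decays_at v' r"
  proof (rule decays_at_dominated)
    show "\<forall>\<^sub>F x in nhds r. \<forall>n\<ge>N. norm (v' n x)
        \<le> 1 * norm (of_real ?k * ?u n x + of_real ?l * (of_nat n * (of_nat n * ?u n x)))"
      using near
    proof eventually_elim
      case (elim x)
      show ?case
      proof (intro allI impI)
        fix n assume n: "N \<le> n"
        let ?\<epsilon> = "4 * M * exp (- c * real n)"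
        have "norm (v' n x) \<le> 2 * (?E\<^sup>2 * (2 / (b2 - a2) + (b2 - a2) * ((real n)\<^sup>2 + \<beta>\<^sup>2 * exp (2 * b2))) * ?\<epsilon>)"
          by (rule radial_ode_deriv_bound[OF ode _ _ elim]) (use ab2 v[OF n] in auto)
        also have "\<dots> = ?k * ?\<epsilon> + ?l * (real n * (real n * ?\<epsilon>))"
          by (simp only: ring_distribs power2_eq_square mult_ac)
        also have "\<dots> \<le> norm (of_real (?k * ?\<epsilon> + ?l * (real n * (real n * ?\<epsilon>))) :: complex)"
          by (simp only: norm_of_real abs_ge_self)
        finally show "norm (v' n x)
            \<le> 1 * norm (of_real ?k * ?u n x + of_real ?l * (of_nat n * (of_nat n * ?u n x)))"
          by (simp only: of_real_add of_real_mult of_real_of_nat_eq mult_1)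
      qed
    qed
  qed
qed

section \<open>The Cantor-Lebesgue argument\<close>

text \<open>Baire's theorem provides a ball of angles on which all terms share one bound
  \<open>k\<close>. Once the period \<open>2 * pi / n\<close> is shorter than its radius, the phases
  \<open>0\<close> and \<open>pi / 2\<close> both occur inside it, and at these phases the term is
  exactly \<open>P n\<close> or \<open>Q n\<close>.\<close>

lemma cantor_lebesgue_bounded:
  fixes P Q :: "nat \<Rightarrow> complex"
  assumes "a < b"
    and bdd: "\<And>\<theta>. \<theta> \<in> {a..b} \<Longrightarrow> \<exists>B. \<forall>n. norm (of_real (cos (real n * \<theta>)) * P n + of_real (sin (real n * \<theta>)) * Q n) \<le> B"
  shows "\<exists>M N. \<forall>n\<ge>N. norm (P n) \<le> M \<and> norm (Q n) \<le> M"
proof -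
  define f where "f n \<theta> = of_real (cos (real n * \<theta>)) * P n + of_real (sin (real n * \<theta>)) * Q n" for n \<theta>
  define F where "F k = {\<theta> \<in> {a..b}. \<forall>n. norm (f n \<theta>) \<le> real k}" for k :: nat
  have clF: "closed (F k)" for k
  proof -
    have "F k = {a..b} \<inter> (\<Inter>n. {\<theta>. norm (f n \<theta>) \<le> real k})"
      by (auto simp: F_def)
    then show ?thesis
      by (auto simp: f_def intro!: closed_Int closed_INT closed_Collect_le continuous_intros)
  qed
  have "\<exists>k. interior (F k) \<noteq> {}"
  proof (rule ccontr)
    assume no: "\<nexists>k. interior (F k) \<noteq> {}"
    have "{a..b} \<subseteq> closure (\<Inter>k. {a..b} - F k)"
    proof (rule Baire)
      fix T assume "T \<in> range (\<lambda>k. {a..b} - F k)"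
      then obtain k where T: "T = {a..b} - F k" by blast
      have "{a..b} = closure {a<..<b}" using \<open>a < b\<close> by simp
      \<comment> \<open>An interior point outside \<open>closure T\<close> would have an open
        neighbourhood contained in \<open>F k\<close>, which is assumed to have empty
        interior.\<close>
      also have "\<dots> \<subseteq> closure T"
      proof (rule closure_minimal)
        show "{a<..<b} \<subseteq> closure T"
        proof
          fix x assume x: "x \<in> {a<..<b}"
          show "x \<in> closure T"
          proof (rule ccontr)
            assume "x \<notin> closure T"
            then have "x \<in> {a<..<b} - closure T" using x by blast
            moreover have "open ({a<..<b} - closure T)" by (intro open_Diff) auto
            moreover have "{a<..<b} - closure T \<subseteq> F k"
            proof
              fix y assume y: "y \<in> {a<..<b} - closure T"
              then have "y \<notin> T" using closure_subset by blast
              then show "y \<in> F k" using y by (simp add: T)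
            qed
            ultimately show False using no interior_maximal by blast
          qed
        qed
      qed simp
      finally have "{a..b} \<subseteq> closure T" by simp
      moreover have "openin (top_of_set {a..b}) T"
        unfolding T Diff_eq openin_open using clF[of k] open_Compl by blast
      ultimately show "openin (top_of_set {a..b}) T \<and> {a..b} \<subseteq> closure T" by blast
    qed auto
    moreover have "(\<Inter>k. {a..b} - F k) = {}"
    proof -
      have "\<exists>k. \<theta> \<in> F k" if \<theta>: "\<theta> \<in> {a..b}" for \<theta>
      proof -
        obtain B where B: "\<And>n. norm (f n \<theta>) \<le> B" using bdd[OF \<theta>] unfolding f_def by blast
        obtain k :: nat where "B \<le> real k" using real_arch_simple by blast
        then show ?thesis using B \<theta> order_trans unfolding F_def by blast
      qed
      then show ?thesis by blast
    qed
    ultimately have "{a..b} \<subseteq> closure {}" by (simp only:)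
    then show False using \<open>a < b\<close> by auto
  qed
  then obtain k x where "x \<in> interior (F k)" by blast
  then obtain e where e: "0 < e" "ball x e \<subseteq> F k"
    using mem_interior by blast
  obtain N :: nat where N: "2 * pi / e < real N" using reals_Archimedean2 by blast
  have pt: "\<exists>\<theta>\<in>F k. \<exists>m::int. real n * \<theta> = \<phi> + 2 * pi * of_int m" if "n \<ge> N" for n \<phi>
  proof -
    have n: "2 * pi / e < real n" using N that by linarith
    then have "0 < real n" using e(1) by (smt (verit) divide_nonneg_pos pi_gt_zero)
    \<comment> \<open>Rounding up places the resulting angle between \<open>x\<close> and
      \<open>x + 2 * pi / n\<close>, hence inside the ball.\<close>
    define m where "m = \<lceil>(real n * x - \<phi>) / (2 * pi)\<rceil>"
    define \<theta> where "\<theta> = (\<phi> + 2 * pi * of_int m) / real n"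
    have m: "(real n * x - \<phi>) / (2 * pi) \<le> of_int m" "of_int m < (real n * x - \<phi>) / (2 * pi) + 1"
      unfolding m_def by linarith+
    have "real n * x - \<phi> \<le> 2 * pi * of_int m" "2 * pi * of_int m < real n * x - \<phi> + 2 * pi"
      using m by (simp_all add: field_simps)
    moreover have "\<theta> - x = (\<phi> + 2 * pi * of_int m - real n * x) / real n"
      using \<open>0 < real n\<close> by (simp add: \<theta>_def field_simps)
    ultimately have "0 \<le> \<theta> - x" "\<theta> - x < 2 * pi / real n"
      using \<open>0 < real n\<close> by (simp_all add: divide_strict_right_mono)
    moreover have "2 * pi / real n < e"
      using n e(1) \<open>0 < real n\<close> by (simp add: field_simps)
    ultimately have "\<theta> \<in> ball x e" by (simp add: dist_real_def)
    moreover have "real n * \<theta> = \<phi> + 2 * pi * of_int m" using \<open>0 < real n\<close> by (simp add: \<theta>_def)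
    ultimately show ?thesis using e(2) by blast
  qed
  have "norm (P n) \<le> real k \<and> norm (Q n) \<le> real k" if n: "n \<ge> N" for n
  proof
    obtain \<theta> m where \<theta>: "\<theta> \<in> F k" "real n * \<theta> = 0 + 2 * pi * of_int m" using pt[OF n] by blast
    then have "f n \<theta> = P n" using cos_int_2pin[of m] sin_int_2pin[of m] by (simp add: f_def)
    moreover have "norm (f n \<theta>) \<le> real k" using \<theta>(1) by (simp add: F_def)
    ultimately show "norm (P n) \<le> real k" by (simp only:)
    obtain \<theta> m where \<theta>: "\<theta> \<in> F k" "real n * \<theta> = pi / 2 + 2 * pi * of_int m" using pt[OF n] by blast
    then have "f n \<theta> = Q n"
      using cos_int_2pin[of m] sin_int_2pin[of m] by (simp add: f_def cos_add sin_add)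
    moreover have "norm (f n \<theta>) \<le> real k" using \<theta>(1) by (simp add: F_def)
    ultimately show "norm (Q n) \<le> real k" by (simp only:)
  qed
  then show ?thesis by blast
qed

subsection \<open>Trigonometric series with decaying coefficients\<close>

lemma has_vector_derivative_suminf:
  fixes f :: "nat \<Rightarrow> real \<Rightarrow> 'a :: banach"
  assumes S: "convex S" "open S" "x \<in> S"
    and f: "\<And>n x. x \<in> S \<Longrightarrow> (f n has_vector_derivative f' n x) (at x)"
    and lim: "uniform_limit S (\<lambda>n x. \<Sum>i<n. f' i x) g' sequentially"
    and summ: "\<And>x. x \<in> S \<Longrightarrow> summable (\<lambda>n. f n x)"
  shows "((\<lambda>x. \<Sum>n. f n x) has_vector_derivative g' x) (at x)"
proof -
  have "\<exists>g. \<forall>x\<in>S. (\<lambda>n. f n x) sums g x \<and> (g has_derivative (\<lambda>h. h *\<^sub>R g' x)) (at x within S)"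
  proof (rule has_derivative_series[OF S(1) _ _ S(3)])
    show "(f n has_derivative (\<lambda>h. h *\<^sub>R f' n x)) (at x within S)" if "x \<in> S" for n x
      using f[OF that] unfolding has_vector_derivative_def by (rule has_derivative_at_withinI)
    show "\<forall>\<^sub>F n in sequentially. \<forall>x\<in>S. \<forall>h. norm ((\<Sum>i<n. h *\<^sub>R f' i x) - h *\<^sub>R g' x) \<le> e * norm h"
      if "0 < e" for e
      using uniform_limitD[OF lim that]
    proof eventually_elim
      case (elim n)
      have eq: "norm ((\<Sum>i<n. h *\<^sub>R f' i x) - h *\<^sub>R g' x) = \<bar>h\<bar> * dist (\<Sum>i<n. f' i x) (g' x)" for h x
        unfolding dist_norm scaleR_sum_right[symmetric] scaleR_diff_right[symmetric] by simp
      have le: "\<bar>h\<bar> * dist (\<Sum>i<n. f' i x) (g' x) \<le> \<bar>h\<bar> * e" if "x \<in> S" for h x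
        by (rule mult_left_mono[OF less_imp_le]) (use elim that in auto)
      show ?case
      proof (intro ballI allI)
        fix x h assume "x \<in> S"
        then show "norm ((\<Sum>i<n. h *\<^sub>R f' i x) - h *\<^sub>R g' x) \<le> e * norm h"
          unfolding eq real_norm_def mult.commute[of e "\<bar>h\<bar>"] by (rule le)
      qed
    qed
    show "(\<lambda>n. f n x) sums (\<Sum>n. f n x)"
      using summ[OF S(3)] by (rule summable_sums)
  qed
  then obtain g where g: "\<And>x. x \<in> S \<Longrightarrow> (\<lambda>n. f n x) sums g x"
    "\<And>x. x \<in> S \<Longrightarrow> (g has_derivative (\<lambda>h. h *\<^sub>R g' x)) (at x within S)"
    by (elim exE) blast
  have "(g has_derivative (\<lambda>h. h *\<^sub>R g' x)) (at x)"
    using g(2)[OF S(3)] unfolding at_within_open[OF S(3,2)] .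
  then have "((\<lambda>x. \<Sum>n. f n x) has_derivative (\<lambda>h. h *\<^sub>R g' x)) (at x)"
    by (rule has_derivative_transform_within_open[OF _ S(2,3)]) (erule sums_unique[OF g(1)])
  then show ?thesis unfolding has_vector_derivative_def .
qed

definition trig_term :: "(nat \<Rightarrow> real \<Rightarrow> complex) \<Rightarrow> (nat \<Rightarrow> real \<Rightarrow> complex) \<Rightarrow> nat \<Rightarrow> real \<Rightarrow> real \<Rightarrow> complex" where
  "trig_term u w n \<theta> \<rho> = of_real (cos (real n * \<theta>)) * u n \<rho> + of_real (sin (real n * \<theta>)) * w n \<rho>"

lemma decays_at_bound:
  assumes "decays_at u r"
  obtains W M N where "open W" "r \<in> W" "summable M" "\<And>n x. n \<ge> N \<Longrightarrow> x \<in> W \<Longrightarrow> norm (u n x) \<le> M n"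
proof -
  obtain c K N where c: "0 < c" and u: "\<forall>\<^sub>F x in nhds r. \<forall>n\<ge>N. norm (u n x) \<le> K * exp (- c * real n)"
    using assms unfolding decays_at_def by blast
  obtain W where W: "open W" "r \<in> W" "\<And>x. x \<in> W \<Longrightarrow> \<forall>n\<ge>N. norm (u n x) \<le> K * exp (- c * real n)"
    using u unfolding eventually_nhds by blast
  have "summable (\<lambda>n. K * exp (- c) ^ n)"
    using c by (intro summable_mult summable_geometric) simp
  moreover have "exp (- c) ^ n = exp (- c * real n)" for n
    by (rule exp_of_nat2_mult[symmetric])
  ultimately show ?thesis
    using that[OF W(1,2), of "\<lambda>n. K * exp (- c * real n)" N] W(3) by simp
qed

lemma uniform_limit_trig_series:
  assumes "decays_at u r" "decays_at w r"
  obtains W where "open W" "r \<in> W"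
    "uniform_limit (UNIV \<times> W) (\<lambda>n (\<theta>, \<rho>). \<Sum>i<n. trig_term u w i \<theta> \<rho>)
       (\<lambda>(\<theta>, \<rho>). \<Sum>i. trig_term u w i \<theta> \<rho>) sequentially"
proof -
  obtain W1 M1 N1 where 1: "open W1" "r \<in> W1" "summable M1" "\<And>n x. n \<ge> N1 \<Longrightarrow> x \<in> W1 \<Longrightarrow> norm (u n x) \<le> M1 n"
    using decays_at_bound[OF assms(1)] by blast
  obtain W2 M2 N2 where 2: "open W2" "r \<in> W2" "summable M2" "\<And>n x. n \<ge> N2 \<Longrightarrow> x \<in> W2 \<Longrightarrow> norm (w n x) \<le> M2 n"
    using decays_at_bound[OF assms(2)] by blast
  have "uniform_limit (UNIV \<times> (W1 \<inter> W2)) (\<lambda>n x. \<Sum>i<n. (\<lambda>i (\<theta>, \<rho>). trig_term u w i \<theta> \<rho>) i x)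
       (\<lambda>x. \<Sum>i. (\<lambda>i (\<theta>, \<rho>). trig_term u w i \<theta> \<rho>) i x) sequentially"
  proof (rule Weierstrass_m_test_ev)
    show "summable (\<lambda>n. M1 n + M2 n)" using 1 2 by (intro summable_add)
    show "\<forall>\<^sub>F n in sequentially. \<forall>x\<in>UNIV \<times> (W1 \<inter> W2). norm (case x of (\<theta>, \<rho>) \<Rightarrow> trig_term u w n \<theta> \<rho>) \<le> M1 n + M2 n"
      using eventually_ge_at_top[of "max N1 N2"]
    proof (eventually_elim, clarify)
      fix n \<theta> \<rho> assume n: "max N1 N2 \<le> n" and \<rho>: "\<rho> \<in> W1" "\<rho> \<in> W2"
      have "norm (of_real (cos (real n * \<theta>)) * u n \<rho>) \<le> 1 * norm (u n \<rho>)"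
        "norm (of_real (sin (real n * \<theta>)) * w n \<rho>) \<le> 1 * norm (w n \<rho>)"
        unfolding norm_mult norm_of_real by (intro mult_right_mono; simp)+
      then show "norm (trig_term u w n \<theta> \<rho>) \<le> M1 n + M2 n"
        using 1(4)[of n \<rho>] 2(4)[of n \<rho>] n \<rho> unfolding trig_term_def by (intro norm_triangle_le) simp
    qed
  qed
  then show ?thesis
    using that[of "W1 \<inter> W2"] 1 2 by (simp add: open_Int split_def)
qed

lemma summable_trig_series:
  assumes "decays_at u \<rho>" "decays_at w \<rho>"
  shows "summable (\<lambda>n. trig_term u w n \<theta> \<rho>)"
proof -
  obtain W where W: "\<rho> \<in> W"
    "uniform_limit (UNIV \<times> W) (\<lambda>n (\<theta>, \<rho>). \<Sum>i<n. trig_term u w i \<theta> \<rho>)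
       (\<lambda>(\<theta>, \<rho>). \<Sum>i. trig_term u w i \<theta> \<rho>) sequentially"
    using uniform_limit_trig_series[OF assms] .
  have "(\<lambda>n. \<Sum>i<n. trig_term u w i \<theta> \<rho>) \<longlonglongrightarrow> (\<Sum>i. trig_term u w i \<theta> \<rho>)"
    using tendsto_uniform_limitI[OF W(2), of "(\<theta>, \<rho>)"] W(1) by simp
  then show ?thesis by (auto simp: summable_def sums_def)
qed

text \<open>These are the ingredients for a continuous sum: uniform convergence near each radius and
  continuous terms. The property is stable under multiplication by \<open>n\<close>, so angular
  derivatives keep it.\<close>

definition smooth_decay :: "real set \<Rightarrow> (nat \<Rightarrow> real \<Rightarrow> complex) \<Rightarrow> bool" where
  "smooth_decay R u \<longleftrightarrow> (\<forall>r\<in>R. decays_at u r \<and> (\<forall>n. isCont (u n) r))"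

lemma smooth_decay_nat_mult:
  "smooth_decay R u \<Longrightarrow> smooth_decay R (\<lambda>n x. of_nat n * u n x)"
  unfolding smooth_decay_def by (auto intro: decays_at_nat_mult)

lemma smooth_decay_uminus:
  "smooth_decay R u \<Longrightarrow> smooth_decay R (\<lambda>n x. - u n x)"
  unfolding smooth_decay_def by (auto simp: decays_at_def)

text \<open>The continuity is joint in angle and radius, as the notion of a continuously
  differentiable function on a region demands. The limit is uniform over all angles and a
  neighbourhood of radii at once.\<close>

lemma continuous_on_trig_series:
  assumes "open R" "smooth_decay R u" "smooth_decay R w"
  shows "continuous_on (UNIV \<times> R) (\<lambda>(\<theta>, \<rho>). \<Sum>n. trig_term u w n \<theta> \<rho>)"
proof (rule continuous_at_imp_continuous_on, safe)
  fix \<theta> r assume r: "r \<in> R"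
  then obtain W where W: "open W" "r \<in> W"
    "uniform_limit (UNIV \<times> W) (\<lambda>n (\<theta>, \<rho>). \<Sum>i<n. trig_term u w i \<theta> \<rho>)
       (\<lambda>(\<theta>, \<rho>). \<Sum>i. trig_term u w i \<theta> \<rho>) sequentially"
    using uniform_limit_trig_series[of u r w] assms unfolding smooth_decay_def by blast
  have "continuous_on (UNIV \<times> (W \<inter> R)) (\<lambda>(\<theta>, \<rho>). \<Sum>i. trig_term u w i \<theta> \<rho>)"
  proof (rule uniform_limit_theorem)
    show "uniform_limit (UNIV \<times> (W \<inter> R)) (\<lambda>n (\<theta>, \<rho>). \<Sum>i<n. trig_term u w i \<theta> \<rho>)
       (\<lambda>(\<theta>, \<rho>). \<Sum>i. trig_term u w i \<theta> \<rho>) sequentially"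
      by (rule uniform_limit_on_subset[OF W(3)]) auto
    have "continuous_on R (u i)" "continuous_on R (w i)" for i
      using assms(2,3) unfolding smooth_decay_def by (auto intro: continuous_at_imp_continuous_on)
    then have u: "continuous_on (UNIV \<times> (W \<inter> R)) (\<lambda>x. u i (snd x))"
      and w: "continuous_on (UNIV \<times> (W \<inter> R)) (\<lambda>x. w i (snd x))" for i
      by (auto intro!: continuous_on_compose2[where f = snd] continuous_on_snd)
    show "\<forall>\<^sub>F n in sequentially. continuous_on (UNIV \<times> (W \<inter> R)) (\<lambda>(\<theta>, \<rho>). \<Sum>i<n. trig_term u w i \<theta> \<rho>)"
      unfolding split_def trig_term_def by (intro always_eventually allI continuous_intros u w)
  qed simp
  then show "isCont (\<lambda>(\<theta>, \<rho>). \<Sum>n. trig_term u w n \<theta> \<rho>) (\<theta>, r)"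
    by (rule continuous_on_interior) (use W r assms(1) in \<open>auto simp: interior_open open_Times open_Int\<close>)
qed

lemma has_vector_derivative_trig_series_angle:
  assumes "decays_at u \<rho>" "decays_at w \<rho>"
  shows "((\<lambda>\<theta>. \<Sum>n. trig_term u w n \<theta> \<rho>) has_vector_derivative
    (\<Sum>n. trig_term (\<lambda>n x. of_nat n * w n x) (\<lambda>n x. - (of_nat n * u n x)) n \<theta> \<rho>)) (at \<theta>)"
proof (rule has_vector_derivative_suminf[OF convex_UNIV open_UNIV])
  let ?t = "trig_term (\<lambda>n x. of_nat n * w n x) (\<lambda>n x. - (of_nat n * u n x))"
  have "decays_at (\<lambda>n x. - (of_nat n * u n x)) \<rho>"
    using decays_at_nat_mult[OF assms(1)] by (simp add: decays_at_def)
  from uniform_limit_trig_series[OF decays_at_nat_mult[OF assms(2)] this]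
  obtain W where W: "\<rho> \<in> W" "uniform_limit (UNIV \<times> W) (\<lambda>n (\<theta>, \<rho>). \<Sum>i<n. ?t i \<theta> \<rho>)
       (\<lambda>(\<theta>, \<rho>). \<Sum>i. ?t i \<theta> \<rho>) sequentially" .
  show "uniform_limit UNIV (\<lambda>n \<theta>. \<Sum>i<n. ?t i \<theta> \<rho>) (\<lambda>\<theta>. \<Sum>i. ?t i \<theta> \<rho>) sequentially"
  proof -
    have "(\<lambda>\<theta>. (\<theta>, \<rho>)) \<in> UNIV \<rightarrow> UNIV \<times> W" using W(1) by auto
    from uniform_limit_compose'[OF W(2) this] show ?thesis by simp
  qed
  fix n \<theta>
  have "((\<lambda>\<theta>. complex_of_real (cos (real n * \<theta>))) has_vector_derivative
      of_real (- real n * sin (real n * \<theta>))) (at \<theta>)"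
    "((\<lambda>\<theta>. complex_of_real (sin (real n * \<theta>))) has_vector_derivative
      of_real (real n * cos (real n * \<theta>))) (at \<theta>)"
    by (rule has_vector_derivative_of_real; auto intro!: derivative_eq_intros)+
  then show "((\<lambda>\<theta>. trig_term u w n \<theta> \<rho>) has_vector_derivative ?t n \<theta> \<rho>) (at \<theta>)"
    unfolding trig_term_def
    by (auto intro!: derivative_eq_intros has_vector_derivative_mult_left simp: algebra_simps)
qed (auto intro: summable_trig_series assms)

lemma has_vector_derivative_trig_series_radius:
  assumes "open R" "\<rho> \<in> R"
    and dec: "smooth_decay R u" "smooth_decay R w" "smooth_decay R u'" "smooth_decay R w'"
    and u: "\<And>n r. r \<in> R \<Longrightarrow> (u n has_vector_derivative u' n r) (at r)"
    and w: "\<And>n r. r \<in> R \<Longrightarrow> (w n has_vector_derivative w' n r) (at r)"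
  shows "((\<lambda>\<rho>. \<Sum>n. trig_term u w n \<theta> \<rho>) has_vector_derivative
    (\<Sum>n. trig_term u' w' n \<theta> \<rho>)) (at \<rho>)"
proof -
  obtain W where W: "open W" "\<rho> \<in> W" "uniform_limit (UNIV \<times> W) (\<lambda>n (\<theta>, \<rho>). \<Sum>i<n. trig_term u' w' i \<theta> \<rho>)
       (\<lambda>(\<theta>, \<rho>). \<Sum>i. trig_term u' w' i \<theta> \<rho>) sequentially"
    using uniform_limit_trig_series[of u' \<rho> w'] dec(3,4) \<open>\<rho> \<in> R\<close> unfolding smooth_decay_def by blast
  obtain e where e: "0 < e" "ball \<rho> e \<subseteq> W \<inter> R"
    using openE[OF open_Int[OF W(1) assms(1)], of \<rho>] W(2) assms(2) by blast
  show ?thesis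
  proof (rule has_vector_derivative_suminf[where S = "ball \<rho> e"])
    show "uniform_limit (ball \<rho> e) (\<lambda>n \<rho>. \<Sum>i<n. trig_term u' w' i \<theta> \<rho>)
        (\<lambda>\<rho>. \<Sum>i. trig_term u' w' i \<theta> \<rho>) sequentially"
    proof -
      have "Pair \<theta> \<in> ball \<rho> e \<rightarrow> UNIV \<times> W" using e(2) by auto
      from uniform_limit_compose'[OF W(3) this] show ?thesis by simp
    qed
    fix r assume "r \<in> ball \<rho> e"
    then have r: "r \<in> R" using e by blast
    show "((\<lambda>\<rho>. trig_term u w n \<theta> \<rho>) has_vector_derivative trig_term u' w' n \<theta> r) (at r)" for n
      unfolding trig_term_def
      by (intro has_vector_derivative_add has_vector_derivative_mult_right u w r)
    show "summable (\<lambda>n. trig_term u w n \<theta> r)"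
      using dec(1,2) r by (intro summable_trig_series) (simp_all add: smooth_decay_def)
  qed (use e in simp_all)
qed

section \<open>Superpositions with a separated axial factor\<close>

text \<open>Decay of the coefficients depends only on the radius, so the natural domain of the sum
  contains all axial positions and all angles over \<open>R\<close>.\<close>

definition cyl_region :: "real set \<Rightarrow> (real \<times> real \<times> real) set" where
  "cyl_region R = {(x0, \<theta>, \<rho>). \<rho> \<in> R}"

text \<open>This class is closed under the three partial derivatives, each of which changes only one
  ingredient. Higher derivatives can therefore be handled by repeating one lemma.\<close>

definition series_rep ::
  "real set \<Rightarrow> cyl_fun \<Rightarrow> (real \<Rightarrow> complex) \<Rightarrow> (nat \<Rightarrow> real \<Rightarrow> complex) \<Rightarrow> (nat \<Rightarrow> real \<Rightarrow> complex) \<Rightarrow> bool" where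
  "series_rep R h X u w \<longleftrightarrow>
     (\<forall>x0 \<theta> \<rho>. \<rho> \<in> R \<longrightarrow> h x0 \<theta> \<rho> = X x0 * (\<Sum>n. trig_term u w n \<theta> \<rho>))"

lemma series_rep_cont_on:
  assumes "open R" "smooth_decay R u" "smooth_decay R w" "series_rep R h X u w" "continuous_on UNIV X"
  shows "cont_on (cyl_region R) h"
proof -
  have "continuous_on (cyl_region R) (\<lambda>p. X (fst p) * (\<lambda>(\<theta>, \<rho>). \<Sum>n. trig_term u w n \<theta> \<rho>) (snd p))"
  proof (intro continuous_on_mult)
    show "continuous_on (cyl_region R) (\<lambda>p. X (fst p))"
      by (rule continuous_on_compose2[OF assms(5)]) (auto intro: continuous_intros)
    show "continuous_on (cyl_region R) (\<lambda>p. (\<lambda>(\<theta>, \<rho>). \<Sum>n. trig_term u w n \<theta> \<rho>) (snd p))"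
      by (rule continuous_on_compose2[OF continuous_on_trig_series[OF assms(1-3)]])
        (auto simp: cyl_region_def intro: continuous_intros)
  qed
  then show ?thesis
    unfolding cont_on_def
    by (rule continuous_on_eq) (use assms(4) in \<open>auto simp: series_rep_def cyl_region_def\<close>)
qed

lemma D_eqI: "(f has_vector_derivative f') (at x) \<Longrightarrow> D f x = f'"
  unfolding D_def by (rule vector_derivative_at)

text \<open>The axial derivative acts on \<open>X\<close>, the angular one exchanges the two
  coefficient sequences with a factor \<open>n\<close>, the radial one acts on the coefficients. The
  derivatives are returned in the same form so that the lemma applies to them again.\<close>

lemma series_rep_C1:
  assumes "open R" and rep: "series_rep R h X u w"
    and X: "\<And>x. (X has_vector_derivative X' x) (at x)" "continuous_on UNIV X'"
    and dec: "smooth_decay R u" "smooth_decay R w" "smooth_decay R u'" "smooth_decay R w'"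
    and u: "\<And>n r. r \<in> R \<Longrightarrow> (u n has_vector_derivative u' n r) (at r)"
    and w: "\<And>n r. r \<in> R \<Longrightarrow> (w n has_vector_derivative w' n r) (at r)"
  shows "C1_on (cyl_region R) h"
    and "series_rep R (D_x0 h) X' u w"
    and "series_rep R (D_theta h) X (\<lambda>n x. of_nat n * w n x) (\<lambda>n x. - (of_nat n * u n x))"
    and "series_rep R (D_rho h) X u' w'"
proof -
  let ?S = "\<lambda>u w \<theta> \<rho>. \<Sum>n. trig_term u w n \<theta> \<rho>"
  let ?nw = "\<lambda>n x. of_nat n * w n x" and ?nu = "\<lambda>n x. - (of_nat n * u n x)"
  have dx: "((\<lambda>t. h t \<theta> \<rho>) has_vector_derivative X' x0 * ?S u w \<theta> \<rho>) (at x0)"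
    if \<rho>: "\<rho> \<in> R" for x0 \<theta> \<rho>
  proof -
    have "(\<lambda>t. h t \<theta> \<rho>) = (\<lambda>t. X t * ?S u w \<theta> \<rho>)"
      using rep \<rho> by (auto simp: series_rep_def)
    then show ?thesis by (simp add: has_vector_derivative_mult_left X)
  qed
  have dt: "((\<lambda>t. h x0 t \<rho>) has_vector_derivative X x0 * ?S ?nw ?nu \<theta> \<rho>) (at \<theta>)"
    if \<rho>: "\<rho> \<in> R" for x0 \<theta> \<rho>
  proof -
    have "(\<lambda>t. h x0 t \<rho>) = (\<lambda>t. X x0 * ?S u w t \<rho>)"
      using rep \<rho> by (auto simp: series_rep_def)
    then show ?thesis
      using dec \<rho> by (simp add: has_vector_derivative_mult_right has_vector_derivative_trig_series_angle
        smooth_decay_def)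
  qed
  have dr: "((\<lambda>t. h x0 \<theta> t) has_vector_derivative X x0 * ?S u' w' \<theta> \<rho>) (at \<rho>)"
    if \<rho>: "\<rho> \<in> R" for x0 \<theta> \<rho>
  proof (rule has_vector_derivative_transform_within_open[OF _ \<open>open R\<close> \<rho>])
    show "((\<lambda>t. X x0 * ?S u w \<theta> t) has_vector_derivative X x0 * ?S u' w' \<theta> \<rho>) (at \<rho>)"
      by (intro has_vector_derivative_mult_right
        has_vector_derivative_trig_series_radius[OF \<open>open R\<close> \<rho> dec u w])
  qed (use rep in \<open>auto simp: series_rep_def\<close>)
  show reps: "series_rep R (D_x0 h) X' u w" "series_rep R (D_theta h) X ?nw ?nu"
    "series_rep R (D_rho h) X u' w'"
    unfolding series_rep_def D_x0_def D_theta_def D_rho_def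
    using D_eqI[OF dx] D_eqI[OF dt] D_eqI[OF dr] by auto
  have cX: "continuous_on UNIV X"
    using X(1) by (meson continuous_at_imp_continuous_on has_vector_derivative_continuous)
  show "C1_on (cyl_region R) h"
    unfolding C1_on_def
  proof (intro conjI ballI)
    show "cont_on (cyl_region R) h"
      using series_rep_cont_on[OF \<open>open R\<close> dec(1,2) rep cX] .
    show "cont_on (cyl_region R) (D_x0 h)"
      using series_rep_cont_on[OF \<open>open R\<close> dec(1,2) reps(1) X(2)] .
    show "cont_on (cyl_region R) (D_theta h)"
      using series_rep_cont_on[OF \<open>open R\<close> smooth_decay_nat_mult smooth_decay_uminus[OF smooth_decay_nat_mult] reps(2) cX]
        dec by blast
    show "cont_on (cyl_region R) (D_rho h)"
      using series_rep_cont_on[OF \<open>open R\<close> dec(3,4) reps(3) cX] .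
  qed (auto simp: cyl_region_def intro: dx dt dr differentiableI_vector[OF dx]
      differentiableI_vector[OF dt] differentiableI_vector[OF dr])
qed

text \<open>After termwise differentiation the equation splits into the coefficients of the cosines
  and of the sines, and each of these is the radial equation.\<close>

lemma series_rep_solution_on:
  assumes "open R" and rep: "series_rep R h X u w"
    and X: "\<And>x. (X has_vector_derivative X' x) (at x)"
      "\<And>x. (X' has_vector_derivative of_real (\<beta>\<^sup>2) * X x) (at x)"
    and dec: "smooth_decay R u" "smooth_decay R w" "smooth_decay R u'" "smooth_decay R w'"
      "smooth_decay R u''" "smooth_decay R w''"
    and u: "\<And>n r. r \<in> R \<Longrightarrow> (u n has_vector_derivative u' n r) (at r)"
      "\<And>n r. r \<in> R \<Longrightarrow> (u' n has_vector_derivative u'' n r) (at r)"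
    and w: "\<And>n r. r \<in> R \<Longrightarrow> (w n has_vector_derivative w' n r) (at r)"
      "\<And>n r. r \<in> R \<Longrightarrow> (w' n has_vector_derivative w'' n r) (at r)"
    and odeu: "\<And>n r. r \<in> R \<Longrightarrow> of_real (r\<^sup>2) * (of_real (\<beta>\<^sup>2) * u n r + u'' n r)
      - of_real ((\<alpha> - 1) * r) * u' n r - of_nat n * (of_nat n * u n r) = 0"
    and odew: "\<And>n r. r \<in> R \<Longrightarrow> of_real (r\<^sup>2) * (of_real (\<beta>\<^sup>2) * w n r + w'' n r)
      - of_real ((\<alpha> - 1) * r) * w' n r - of_nat n * (of_nat n * w n r) = 0"
  shows "solution_on \<alpha> (cyl_region R) h"
proof -
  let ?nw = "\<lambda>n x. of_nat n * w n x" and ?nu = "\<lambda>n x. - (of_nat n * u n x)"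
  \<comment> \<open>The exact form that two angular differentiations produce; the minus sign lands
    in different places in the two sequences.\<close>
  let ?nnw = "\<lambda>n x. - (of_nat n * (of_nat n * w n x))" and ?nnu = "\<lambda>n x. of_nat n * (- (of_nat n * u n x))"
  have cX: "continuous_on UNIV X" "continuous_on UNIV X'"
    using X by (meson continuous_at_imp_continuous_on has_vector_derivative_continuous)+
  then have cX'': "continuous_on UNIV (\<lambda>x. of_real (\<beta>\<^sup>2) * X x)"
    by (intro continuous_intros)
  note r0 = series_rep_C1[OF \<open>open R\<close> rep X(1) cX(2) dec(1-4) u(1) w(1)]
  note rx = series_rep_C1[OF \<open>open R\<close> r0(2) X(2) cX'' dec(1-4) u(1) w(1)]
  have "smooth_decay R ?nw" "smooth_decay R ?nu"
    "smooth_decay R (\<lambda>n x. of_nat n * w' n x)" "smooth_decay R (\<lambda>n x. - (of_nat n * u' n x))"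
    using dec by (auto intro: smooth_decay_nat_mult smooth_decay_uminus)
  note rt = series_rep_C1[OF \<open>open R\<close> r0(3) X(1) cX(2) this
      has_vector_derivative_mult_right[OF w(1)]
      has_vector_derivative_minus[OF has_vector_derivative_mult_right[OF u(1)]]]
  note rr = series_rep_C1[OF \<open>open R\<close> r0(4) X(1) cX(2) dec(3-6) u(2) w(2)]
  have "C2_on (cyl_region R) h"
    unfolding C2_on_def using r0(1) rx(1) rt(1) rr(1) by blast
  moreover have "of_real (\<rho>\<^sup>2) * (D_x0 (D_x0 h) x0 \<theta> \<rho> + D_rho (D_rho h) x0 \<theta> \<rho>)
        - of_real ((\<alpha> - 1) * \<rho>) * D_rho h x0 \<theta> \<rho> + D_theta (D_theta h) x0 \<theta> \<rho> = 0"
    if \<rho>: "\<rho> \<in> R" for x0 \<theta> \<rho>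
  proof -
    have summ: "summable (\<lambda>n. trig_term u w n \<theta> \<rho>)" "summable (\<lambda>n. trig_term u' w' n \<theta> \<rho>)"
      "summable (\<lambda>n. trig_term u'' w'' n \<theta> \<rho>)" "summable (\<lambda>n. trig_term ?nnu ?nnw n \<theta> \<rho>)"
      using dec[unfolded smooth_decay_def] \<rho>
        smooth_decay_nat_mult[OF smooth_decay_uminus[OF smooth_decay_nat_mult[OF dec(1)]]]
        smooth_decay_uminus[OF smooth_decay_nat_mult[OF smooth_decay_nat_mult[OF dec(2)]]]
      by (auto intro!: summable_trig_series simp: smooth_decay_def)
    have "of_real (\<rho>\<^sup>2) * (of_real (\<beta>\<^sup>2) * trig_term u w n \<theta> \<rho> + trig_term u'' w'' n \<theta> \<rho>)
        - of_real ((\<alpha> - 1) * \<rho>) * trig_term u' w' n \<theta> \<rho> + trig_term ?nnu ?nnw n \<theta> \<rho> = 0" for n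
    proof -
      have "of_real (\<rho>\<^sup>2) * (of_real (\<beta>\<^sup>2) * trig_term u w n \<theta> \<rho> + trig_term u'' w'' n \<theta> \<rho>)
        - of_real ((\<alpha> - 1) * \<rho>) * trig_term u' w' n \<theta> \<rho> + trig_term ?nnu ?nnw n \<theta> \<rho>
        = of_real (cos (real n * \<theta>)) * (of_real (\<rho>\<^sup>2) * (of_real (\<beta>\<^sup>2) * u n \<rho> + u'' n \<rho>)
            - of_real ((\<alpha> - 1) * \<rho>) * u' n \<rho> - of_nat n * (of_nat n * u n \<rho>))
        + of_real (sin (real n * \<theta>)) * (of_real (\<rho>\<^sup>2) * (of_real (\<beta>\<^sup>2) * w n \<rho> + w'' n \<rho>)
            - of_real ((\<alpha> - 1) * \<rho>) * w' n \<rho> - of_nat n * (of_nat n * w n \<rho>))"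
        unfolding trig_term_def by (simp add: algebra_simps)
      then show ?thesis unfolding odeu[OF \<rho>] odew[OF \<rho>] by simp
    qed
    moreover have "(\<lambda>n. of_real (\<rho>\<^sup>2) * (of_real (\<beta>\<^sup>2) * trig_term u w n \<theta> \<rho> + trig_term u'' w'' n \<theta> \<rho>)
        - of_real ((\<alpha> - 1) * \<rho>) * trig_term u' w' n \<theta> \<rho> + trig_term ?nnu ?nnw n \<theta> \<rho>) sums
      (of_real (\<rho>\<^sup>2) * (of_real (\<beta>\<^sup>2) * (\<Sum>n. trig_term u w n \<theta> \<rho>) + (\<Sum>n. trig_term u'' w'' n \<theta> \<rho>))
        - of_real ((\<alpha> - 1) * \<rho>) * (\<Sum>n. trig_term u' w' n \<theta> \<rho>) + (\<Sum>n. trig_term ?nnu ?nnw n \<theta> \<rho>))"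
      using summ by (intro sums_add sums_diff sums_mult summable_sums)
    ultimately have "of_real (\<rho>\<^sup>2) * (of_real (\<beta>\<^sup>2) * (\<Sum>n. trig_term u w n \<theta> \<rho>) + (\<Sum>n. trig_term u'' w'' n \<theta> \<rho>))
        - of_real ((\<alpha> - 1) * \<rho>) * (\<Sum>n. trig_term u' w' n \<theta> \<rho>) + (\<Sum>n. trig_term ?nnu ?nnw n \<theta> \<rho>) = 0"
      using sums_unique2[OF _ sums_zero] by (simp only:)
    then have "X x0 * (of_real (\<rho>\<^sup>2) * (of_real (\<beta>\<^sup>2) * (\<Sum>n. trig_term u w n \<theta> \<rho>) + (\<Sum>n. trig_term u'' w'' n \<theta> \<rho>))
        - of_real ((\<alpha> - 1) * \<rho>) * (\<Sum>n. trig_term u' w' n \<theta> \<rho>) + (\<Sum>n. trig_term ?nnu ?nnw n \<theta> \<rho>)) = 0"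
      by simp
    moreover have "D_x0 (D_x0 h) x0 \<theta> \<rho> = of_real (\<beta>\<^sup>2) * X x0 * (\<Sum>n. trig_term u w n \<theta> \<rho>)"
      "D_rho (D_rho h) x0 \<theta> \<rho> = X x0 * (\<Sum>n. trig_term u'' w'' n \<theta> \<rho>)"
      "D_rho h x0 \<theta> \<rho> = X x0 * (\<Sum>n. trig_term u' w' n \<theta> \<rho>)"
      "D_theta (D_theta h) x0 \<theta> \<rho> = X x0 * (\<Sum>n. trig_term ?nnu ?nnw n \<theta> \<rho>)"
      using rx(2) rr(4) r0(4) rt(3) \<rho> unfolding series_rep_def by blast+
    ultimately show ?thesis
      by (simp add: algebra_simps)
  qed
  ultimately show ?thesis
    unfolding solution_on_def by (auto simp: cyl_region_def)
qed

lemma solution_on_subset: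
  assumes "solution_on \<alpha> V h" "U \<subseteq> V"
  shows "solution_on \<alpha> U h"
proof -
  have "C1_on U f" if "C1_on V f" for f
    using that assms(2) unfolding C1_on_def cont_on_def by (blast intro: continuous_on_subset)
  then show ?thesis
    using assms unfolding solution_on_def C2_on_def by blast
qed

subsection \<open>The separated solutions\<close>

text \<open>The power of \<open>\<rho>\<close> becomes the factor \<open>exp (a * z)\<close> with
  \<open>a = \<alpha> / 2\<close>. It creates the damping \<open>\<alpha>\<close> and subtracts
  \<open>a * a\<close> from the zeroth-order coefficient; the order \<open>\<nu>\<close> is such
  that exactly the square of \<open>l\<close> remains.\<close>

lemma Upsilon_fun_radial_ode:
  assumes "\<beta> \<noteq> 0"
  shows "\<exists>v v'. radial_ode \<alpha> \<beta> (of_int l) v v' \<and> (\<forall>\<rho>>0. Upsilon_fun \<alpha> A1 A2 l \<beta> \<rho> = v (ln \<rho>))"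
proof -
  define r where "r = sqrt (\<alpha>\<^sup>2 + 4 * (of_int l)\<^sup>2) / 2"
  define \<nu> where "\<nu> = complex_of_real r"
  define a where "a = complex_of_real (\<alpha> / 2)"
  \<comment> \<open>The translation that absorbs \<open>\<beta>\<close>; for
    \<open>\<beta> < 0\<close> it has imaginary part \<open>pi\<close>. Since \<open>exp b\<close>
    is \<open>\<beta> / 2\<close>, the translated equation has real coefficients again.\<close>
  define b where "b = Ln (of_real \<beta> / 2)"
  have "0 \<le> r" unfolding r_def by simp
  then obtain yY where yY: "bessel_ode \<nu> (\<lambda>_. 0) yY" "\<And>z. z \<noteq> 0 \<Longrightarrow> bessel_Y \<nu> z = yY (Ln (z / 2))"
    using bessel_Y_ode unfolding \<nu>_def by blast
  define y where "y \<tau> = of_real (A1 l \<beta>) * bessel_J_log \<nu> \<tau> + of_real (A2 l \<beta>) * yY \<tau>" for \<tau>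
  have "bessel_ode \<nu> (\<lambda>_. 0) y"
    using bessel_ode_linear_combination[OF bessel_ode_J_log yY(1)] unfolding y_def by simp
  then obtain y' where y: "\<And>\<tau>. (y has_field_derivative y' \<tau>) (at \<tau>)"
    "\<And>\<tau>. (y' has_field_derivative (\<nu>\<^sup>2 - 4 * exp (2 * \<tau>)) * y \<tau>) (at \<tau>)"
    unfolding bessel_ode_def by auto
  define V where "V z = exp (a * z) * y (z + b)" for z
  define V' where "V' z = exp (a * z) * (a * y (z + b) + y' (z + b))" for z
  have exp_b: "4 * exp (2 * (z + b)) = of_real (\<beta>\<^sup>2) * exp (2 * z)" for z
  proof -
    have b: "exp b = of_real \<beta> / 2" using assms by (simp add: b_def)
    have "exp (2 * (z + b)) = exp (2 * z) * (exp b * exp b)"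
      by (simp only: exp_add[symmetric]) (simp add: algebra_simps)
    then have "4 * exp (2 * (z + b)) = 4 * (exp (2 * z) * (of_real \<beta> / 2 * (of_real \<beta> / 2)))"
      by (simp only: b)
    also have "\<dots> = of_real (\<beta>\<^sup>2) * exp (2 * z)"
      by (simp add: power2_eq_square)
    finally show ?thesis .
  qed
  have \<nu>: "\<nu>\<^sup>2 = a * a + (of_int l)\<^sup>2"
  proof -
    have "r\<^sup>2 = (\<alpha> / 2) * (\<alpha> / 2) + (of_int l)\<^sup>2"
      by (simp add: r_def power_divide field_simps power2_eq_square)
    then show ?thesis
      unfolding \<nu>_def a_def by (metis of_real_add of_real_mult of_real_of_int_eq of_real_power)
  qed
  have y_shift: "((\<lambda>z. y (z + b)) has_field_derivative y' (z + b)) (at z)"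
    "((\<lambda>z. y' (z + b)) has_field_derivative (\<nu>\<^sup>2 - 4 * exp (2 * (z + b))) * y (z + b)) (at z)" for z
    using y[of "z + b"] by (simp_all add: DERIV_shift)
  have V: "(V has_field_derivative V' z) (at z)" for z
    unfolding V_def V'_def
    by (rule derivative_eq_intros y_shift refl)+ (simp add: algebra_simps)
  have "(V' has_field_derivative exp (a * z) *
      (a * (a * y (z + b) + y' (z + b))
        + a * y' (z + b) + (\<nu>\<^sup>2 - 4 * exp (2 * (z + b))) * y (z + b))) (at z)" for z
    unfolding V'_def
    by (rule derivative_eq_intros y_shift refl)+ (simp add: algebra_simps)
  moreover have "exp (a * z) *
      (a * (a * y (z + b) + y' (z + b))
        + a * y' (z + b) + (\<nu>\<^sup>2 - 4 * exp (2 * (z + b))) * y (z + b))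
    = of_real \<alpha> * V' z + ((of_int l)\<^sup>2 - of_real (\<beta>\<^sup>2) * exp (2 * z)) * V z" for z
  proof -
    have "of_real \<alpha> = a + a"
      by (simp add: a_def)
    then show ?thesis
      unfolding exp_b \<nu> V_def V'_def by (simp only:) (simp only: ring_distribs mult_ac add_ac diff_conv_add_uminus minus_mult_left[symmetric] minus_mult_right[symmetric])
  qed
  ultimately have V': "(V' has_field_derivative
      of_real \<alpha> * V' z + ((of_int l)\<^sup>2 - of_real (\<beta>\<^sup>2) * exp (2 * z)) * V z) (at z)" for z
    by simp
  have "radial_ode \<alpha> \<beta> (of_int l) (\<lambda>t. V (of_real t)) (\<lambda>t. V' (of_real t))"
    unfolding radial_ode_def
  proof (intro allI conjI)
    fix t
    show "((\<lambda>t. V (of_real t)) has_vector_derivative V' (of_real t)) (at t)"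
      by (rule has_vector_derivative_real_field[OF V])
    have "((\<lambda>t. V' (of_real t)) has_vector_derivative
        of_real \<alpha> * V' (of_real t) + ((of_int l)\<^sup>2 - of_real (\<beta>\<^sup>2) * exp (2 * of_real t)) * V (of_real t)) (at t)"
      by (rule has_vector_derivative_real_field[OF V'])
    moreover have "exp (2 * of_real t) = (of_real (exp (2 * t)) :: complex)"
      by (simp flip: exp_of_real)
    ultimately show "((\<lambda>t. V' (of_real t)) has_vector_derivative
        \<alpha> *\<^sub>R V' (of_real t) + ((of_int l)\<^sup>2 - \<beta>\<^sup>2 * exp (2 * t)) *\<^sub>R V (of_real t)) (at t)"
      by (simp add: scaleR_conv_of_real)
  qed
  moreover have "Upsilon_fun \<alpha> A1 A2 l \<beta> \<rho> = V (of_real (ln \<rho>))" if "\<rho> > 0" for \<rho>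
  proof -
    have z: "of_real (\<rho> * \<beta>) \<noteq> (0 :: complex)" using that assms by simp
    have "Ln (of_real (\<rho> * \<beta>) / 2) = Ln (of_real \<rho> * (of_real \<beta> / 2))"
      by simp
    \<comment> \<open>No branch correction occurs because the factor \<open>\<rho>\<close> is
      positive.\<close>
    also have "\<dots> = of_real (ln \<rho>) + b"
      unfolding b_def using Ln_times_of_real[of \<rho> "of_real \<beta> / 2"] that assms by (simp add: Ln_of_real)
    finally have Ln: "Ln (of_real (\<rho> * \<beta>) / 2) = of_real (ln \<rho>) + b" .
    have "of_real (\<rho> powr (\<alpha> / 2)) = exp (a * complex_of_real (ln \<rho>))"
      using that unfolding a_def powr_def of_real_mult[symmetric] exp_of_real by simp
    then show ?thesis
      unfolding Upsilon_fun_def Let_def r_def[symmetric] \<nu>_def[symmetric] V_def y_def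
      by (simp only: bessel_J_eq_log[OF z] yY(2)[OF z] Ln)
  qed
  ultimately show ?thesis by blast
qed

text \<open>The substitution \<open>t = ln \<rho>\<close> turns the radial equation into one with constant damping.\<close>

lemma radial_ode_ln:
  fixes v :: "real \<Rightarrow> complex"
  assumes "radial_ode \<alpha> \<beta> n v v'" "0 < \<rho>"
  defines "u'' \<equiv> of_real (1 / \<rho>\<^sup>2) * (of_real (\<alpha> - 1) * v' (ln \<rho>) + of_real (n\<^sup>2 - \<beta>\<^sup>2 * \<rho>\<^sup>2) * v (ln \<rho>))"
  shows "((\<lambda>\<rho>. v (ln \<rho>)) has_vector_derivative of_real (1 / \<rho>) * v' (ln \<rho>)) (at \<rho>)"
    and "((\<lambda>\<rho>. of_real (1 / \<rho>) * v' (ln \<rho>)) has_vector_derivative u'') (at \<rho>)"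
    and "of_real (\<rho>\<^sup>2) * (of_real (\<beta>\<^sup>2) * v (ln \<rho>) + u'')
      - of_real ((\<alpha> - 1) * \<rho>) * (of_real (1 / \<rho>) * v' (ln \<rho>)) = of_real (n\<^sup>2) * v (ln \<rho>)"
proof -
  have ln: "(ln has_vector_derivative 1 / \<rho>) (at \<rho>)"
    using assms(2) by (auto intro!: derivative_eq_intros simp flip: has_real_derivative_iff_has_vector_derivative)
  have exp: "exp (2 * ln \<rho>) = \<rho>\<^sup>2"
    using assms(2) by (simp add: exp_double)
  have v: "(v has_vector_derivative v' (ln \<rho>)) (at (ln \<rho>))"
    "(v' has_vector_derivative \<alpha> *\<^sub>R v' (ln \<rho>) + (n\<^sup>2 - \<beta>\<^sup>2 * \<rho>\<^sup>2) *\<^sub>R v (ln \<rho>)) (at (ln \<rho>))"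
    using assms(1) unfolding radial_ode_def exp[symmetric] by blast+
  show "((\<lambda>\<rho>. v (ln \<rho>)) has_vector_derivative of_real (1 / \<rho>) * v' (ln \<rho>)) (at \<rho>)"
    using vector_diff_chain_at[OF ln v(1)] by (simp add: o_def scaleR_conv_of_real)
  have v'ln: "((\<lambda>\<rho>. v' (ln \<rho>)) has_vector_derivative
      of_real (1 / \<rho>) * (of_real \<alpha> * v' (ln \<rho>) + of_real (n\<^sup>2 - \<beta>\<^sup>2 * \<rho>\<^sup>2) * v (ln \<rho>))) (at \<rho>)"
    using vector_diff_chain_at[OF ln v(2)] by (simp add: o_def scaleR_conv_of_real)
  have "((\<lambda>\<rho>. complex_of_real (1 / \<rho>)) has_vector_derivative of_real (- 1 / \<rho>\<^sup>2)) (at \<rho>)"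
    using assms(2)
    by (intro has_vector_derivative_of_real) (auto intro!: derivative_eq_intros simp: power2_eq_square)
  from has_vector_derivative_mult[OF this v'ln]
  have "((\<lambda>\<rho>. of_real (1 / \<rho>) * v' (ln \<rho>)) has_vector_derivative
      of_real (1 / \<rho>) * (of_real (1 / \<rho>) * (of_real \<alpha> * v' (ln \<rho>) + of_real (n\<^sup>2 - \<beta>\<^sup>2 * \<rho>\<^sup>2) * v (ln \<rho>)))
      + of_real (- 1 / \<rho>\<^sup>2) * v' (ln \<rho>)) (at \<rho>)" .
  moreover have "of_real (1 / \<rho>) * (of_real (1 / \<rho>) * (of_real \<alpha> * v' (ln \<rho>) + of_real (n\<^sup>2 - \<beta>\<^sup>2 * \<rho>\<^sup>2) * v (ln \<rho>)))
      + of_real (- 1 / \<rho>\<^sup>2) * v' (ln \<rho>) = u''"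
    using assms(2) by (simp add: u''_def field_simps power2_eq_square)
  ultimately show "((\<lambda>\<rho>. of_real (1 / \<rho>) * v' (ln \<rho>)) has_vector_derivative u'') (at \<rho>)"
    by simp
  have "of_real (\<rho>\<^sup>2) * u'' = of_real (\<alpha> - 1) * v' (ln \<rho>) + of_real (n\<^sup>2 - \<beta>\<^sup>2 * \<rho>\<^sup>2) * v (ln \<rho>)"
    using assms(2) by (simp add: u''_def)
  note 1 = this
  have 2: "of_real ((\<alpha> - 1) * \<rho>) * (of_real (1 / \<rho>) * v' (ln \<rho>)) = of_real (\<alpha> - 1) * v' (ln \<rho>)"
    using assms(2) by simp
  show "of_real (\<rho>\<^sup>2) * (of_real (\<beta>\<^sup>2) * v (ln \<rho>) + u'')
      - of_real ((\<alpha> - 1) * \<rho>) * (of_real (1 / \<rho>) * v' (ln \<rho>)) = of_real (n\<^sup>2) * v (ln \<rho>)"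
    unfolding distrib_left[of "of_real (\<rho>\<^sup>2)"] 1 2 by (simp add: algebra_simps)
qed

section \<open>The separation relations\<close>

lemma twice_differentiableI:
  assumes "open S" "x \<in> S" and f: "\<And>y. y \<in> S \<Longrightarrow> (f has_vector_derivative f' y) (at y)"
    and f': "(f' has_vector_derivative f'') (at x)"
  shows "twice_differentiable_at f x" "D f x = f' x" "D (D f) x = f''"
proof -
  have D: "D f y = f' y" if "y \<in> S" for y
    by (rule D_eqI[OF f[OF that]])
  have DD: "(D f has_vector_derivative f'') (at x)"
    by (rule has_vector_derivative_transform_within_open[OF f' assms(1,2)]) (simp add: D)
  have "\<forall>\<^sub>F y in nhds x. f differentiable (at y)"
    using eventually_nhds_in_open[OF assms(1,2)]
    by eventually_elim (rule differentiableI_vector[OF f])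
  then show "twice_differentiable_at f x"
    unfolding twice_differentiable_at_def using differentiableI_vector[OF DD] by blast
  show "D f x = f' x" by (rule D[OF assms(2)])
  show "D (D f) x = f''" by (rule D_eqI[OF DD])
qed

text \<open>The radial equation is recorded without quotients, so it holds at zeros of the radial
  factor too; both separation relations come from it by division.\<close>

lemma Upsilon_fun_derivs:
  assumes "\<beta> \<noteq> 0"
  obtains u' u'' where
    "\<And>\<rho>. 0 < \<rho> \<Longrightarrow> (Upsilon_fun \<alpha> A1 A2 l \<beta> has_vector_derivative u' \<rho>) (at \<rho>)"
    "\<And>\<rho>. 0 < \<rho> \<Longrightarrow> (u' has_vector_derivative u'' \<rho>) (at \<rho>)"
    "\<And>\<rho>. 0 < \<rho> \<Longrightarrow> of_real (\<rho>\<^sup>2) * (of_real (\<beta>\<^sup>2) * Upsilon_fun \<alpha> A1 A2 l \<beta> \<rho> + u'' \<rho>)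
      - of_real ((\<alpha> - 1) * \<rho>) * u' \<rho> = of_int (l\<^sup>2) * Upsilon_fun \<alpha> A1 A2 l \<beta> \<rho>"
proof -
  obtain v v' where v: "radial_ode \<alpha> \<beta> (of_int l) v v'"
    "\<And>\<rho>. 0 < \<rho> \<Longrightarrow> Upsilon_fun \<alpha> A1 A2 l \<beta> \<rho> = v (ln \<rho>)"
    using Upsilon_fun_radial_ode[OF assms] by blast
  note ode = radial_ode_ln[OF v(1)]
  have Upsilon: "(Upsilon_fun \<alpha> A1 A2 l \<beta> has_vector_derivative of_real (1 / \<rho>) * v' (ln \<rho>)) (at \<rho>)"
    if "0 < \<rho>" for \<rho>
    by (rule has_vector_derivative_transform_within_open[OF ode(1)[OF that], of "{0<..}"])
      (use that in \<open>auto simp: v(2)\<close>)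
  show ?thesis
    by (rule that[OF Upsilon ode(2)]) (use ode(3) in \<open>simp_all add: v(2)\<close>)
qed

lemma s_fun_derivs:
  fixes C1 C2 l
  defines "s' \<equiv> \<lambda>\<theta>. complex_of_real (of_int l * (C2 l * cos (of_int l * \<theta>) - C1 l * sin (of_int l * \<theta>)))"
  shows "(s_fun C1 C2 l has_vector_derivative s' \<theta>) (at \<theta>)"
    "(s' has_vector_derivative - of_int (l\<^sup>2) * s_fun C1 C2 l \<theta>) (at \<theta>)"
proof -
  show "(s_fun C1 C2 l has_vector_derivative s' \<theta>) (at \<theta>)"
    unfolding s_fun_def s'_def
    by (rule has_vector_derivative_of_real) (auto intro!: derivative_eq_intros simp: algebra_simps)
  have "(s' has_vector_derivative of_real (- (of_int (l\<^sup>2) * (C1 l * cos (of_int l * \<theta>) + C2 l * sin (of_int l * \<theta>))))) (at \<theta>)"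
    unfolding s'_def
    by (rule has_vector_derivative_of_real)
      (auto intro!: derivative_eq_intros simp: algebra_simps power2_eq_square)
  then show "(s' has_vector_derivative - of_int (l\<^sup>2) * s_fun C1 C2 l \<theta>) (at \<theta>)"
    by (simp add: s_fun_def)
qed

lemma Xi_fun_derivs:
  fixes B1 B2 \<beta>
  defines "X' \<equiv> \<lambda>x. complex_of_real (\<beta> * (B1 \<beta> * sinh (\<beta> * x) + B2 \<beta> * cosh (\<beta> * x)))"
  shows "(Xi_fun B1 B2 \<beta> has_vector_derivative X' x) (at x)"
    "(X' has_vector_derivative of_real (\<beta>\<^sup>2) * Xi_fun B1 B2 \<beta> x) (at x)"
proof -
  show "(Xi_fun B1 B2 \<beta> has_vector_derivative X' x) (at x)"
    unfolding Xi_fun_def X'_def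
    by (rule has_vector_derivative_of_real) (auto intro!: derivative_eq_intros simp: algebra_simps)
  have "(X' has_vector_derivative of_real (\<beta>\<^sup>2 * (B1 \<beta> * cosh (\<beta> * x) + B2 \<beta> * sinh (\<beta> * x)))) (at x)"
    unfolding X'_def
    by (rule has_vector_derivative_of_real)
      (auto intro!: derivative_eq_intros simp: algebra_simps power2_eq_square)
  then show "(X' has_vector_derivative of_real (\<beta>\<^sup>2) * Xi_fun B1 B2 \<beta> x) (at x)"
    by (simp add: Xi_fun_def)
qed

lemma second_separation_Xi_Upsilon:
  assumes "\<beta> \<noteq> 0"
  shows "second_separation \<alpha> l \<beta> (Xi_fun B1 B2 \<beta>) (Upsilon_fun \<alpha> A1 A2 l \<beta>)"
  unfolding second_separation_def
proof (intro conjI allI impI)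
  fix x
  note X = twice_differentiableI[OF open_UNIV UNIV_I Xi_fun_derivs]
  show "twice_differentiable_at (Xi_fun B1 B2 \<beta>) x" by (rule X)
  show "- (1 / Xi_fun B1 B2 \<beta> x) * D (D (Xi_fun B1 B2 \<beta>)) x = - of_real (\<beta>\<^sup>2)" if "Xi_fun B1 B2 \<beta> x \<noteq> 0"
  proof -
    have "D (D (Xi_fun B1 B2 \<beta>)) x = of_real (\<beta>\<^sup>2) * Xi_fun B1 B2 \<beta> x" by (rule X)
    then show ?thesis using that by simp
  qed
next
  fix \<rho> :: real assume \<rho>: "0 < \<rho>"
  let ?Y = "Upsilon_fun \<alpha> A1 A2 l \<beta>"
  obtain u' u'' where u: "\<And>\<rho>. 0 < \<rho> \<Longrightarrow> (?Y has_vector_derivative u' \<rho>) (at \<rho>)"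
    "\<And>\<rho>. 0 < \<rho> \<Longrightarrow> (u' has_vector_derivative u'' \<rho>) (at \<rho>)"
    "\<And>\<rho>. 0 < \<rho> \<Longrightarrow> of_real (\<rho>\<^sup>2) * (of_real (\<beta>\<^sup>2) * ?Y \<rho> + u'' \<rho>)
      - of_real ((\<alpha> - 1) * \<rho>) * u' \<rho> = of_int (l\<^sup>2) * ?Y \<rho>"
    using Upsilon_fun_derivs[OF assms] by blast
  have "\<rho> \<in> {0<..}" using \<rho> by simp
  note Y = twice_differentiableI[OF open_greaterThan this u(1) u(2)[OF \<rho>]]
  show "twice_differentiable_at ?Y \<rho>" by (rule Y) simp
  assume nz: "?Y \<rho> \<noteq> 0"
  \<comment> \<open>The quotient expression differs from the separation constant by the cleared
    radial equation divided by the square of \<open>\<rho>\<close> times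
    \<open>?Y \<rho>\<close>.\<close>
  have "1 / ?Y \<rho> * u'' \<rho> - of_real (\<alpha> - 1) / (?Y \<rho> * of_real \<rho>) * u' \<rho> - of_real ((of_int l)\<^sup>2 / \<rho>\<^sup>2)
    = (of_real (\<rho>\<^sup>2) * (of_real (\<beta>\<^sup>2) * ?Y \<rho> + u'' \<rho>) - of_real ((\<alpha> - 1) * \<rho>) * u' \<rho> - of_int (l\<^sup>2) * ?Y \<rho>)
      / (of_real (\<rho>\<^sup>2) * ?Y \<rho>) - of_real (\<beta>\<^sup>2)"
    using nz \<rho> by (simp add: field_simps power2_eq_square)
  also have "\<dots> = - of_real (\<beta>\<^sup>2)"
    unfolding u(3)[OF \<rho>] by simp
  finally have "1 / ?Y \<rho> * u'' \<rho> - of_real (\<alpha> - 1) / (?Y \<rho> * of_real \<rho>) * u' \<rho>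
    - of_real ((of_int l)\<^sup>2 / \<rho>\<^sup>2) = - of_real (\<beta>\<^sup>2)" .
  then show "1 / ?Y \<rho> * D (D ?Y) \<rho> - of_real (\<alpha> - 1) / (?Y \<rho> * of_real \<rho>) * D ?Y \<rho>
      - of_real ((of_int l)\<^sup>2 / \<rho>\<^sup>2) = - of_real (\<beta>\<^sup>2)"
    using Y by simp
qed

lemma first_separation_s_g:
  assumes "\<beta> \<noteq> 0"
  shows "first_separation \<alpha> l (s_fun C1 C2 l) (g_fun \<alpha> B1 B2 A1 A2 l \<beta>)"
  unfolding first_separation_def
proof (intro conjI allI impI)
  fix \<theta>
  note s = twice_differentiableI[OF open_UNIV UNIV_I s_fun_derivs]
  show "twice_differentiable_at (s_fun C1 C2 l) \<theta>" by (rule s)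
  show "- (1 / s_fun C1 C2 l \<theta>) * D (D (s_fun C1 C2 l)) \<theta> = of_int (l\<^sup>2)" if "s_fun C1 C2 l \<theta> \<noteq> 0"
  proof -
    have "D (D (s_fun C1 C2 l)) \<theta> = - of_int (l\<^sup>2) * s_fun C1 C2 l \<theta>" by (rule s)
    then show ?thesis using that by simp
  qed
next
  fix x0 \<rho> :: real assume \<rho>: "0 < \<rho>"
  let ?Y = "Upsilon_fun \<alpha> A1 A2 l \<beta>" and ?X = "Xi_fun B1 B2 \<beta>" and ?g = "g_fun \<alpha> B1 B2 A1 A2 l \<beta>"
  obtain u' u'' where u: "\<And>\<rho>. 0 < \<rho> \<Longrightarrow> (?Y has_vector_derivative u' \<rho>) (at \<rho>)"
    "\<And>\<rho>. 0 < \<rho> \<Longrightarrow> (u' has_vector_derivative u'' \<rho>) (at \<rho>)"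
    "\<And>\<rho>. 0 < \<rho> \<Longrightarrow> of_real (\<rho>\<^sup>2) * (of_real (\<beta>\<^sup>2) * ?Y \<rho> + u'' \<rho>)
      - of_real ((\<alpha> - 1) * \<rho>) * u' \<rho> = of_int (l\<^sup>2) * ?Y \<rho>"
    using Upsilon_fun_derivs[OF assms] by blast
  have "\<rho> \<in> {0<..}" using \<rho> by simp
  note gr = twice_differentiableI[OF open_greaterThan this
      has_vector_derivative_mult_right[OF u(1)] has_vector_derivative_mult_right[OF u(2)[OF \<rho>]]]
  note gx = twice_differentiableI[OF open_UNIV UNIV_I
      has_vector_derivative_mult_left[OF Xi_fun_derivs(1)]
      has_vector_derivative_mult_left[OF Xi_fun_derivs(2)]]
  show "twice_differentiable_at (\<lambda>t. ?g t \<rho>) x0"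
    unfolding g_fun_def by (rule gx)
  show "twice_differentiable_at (\<lambda>t. ?g x0 t) \<rho>"
    unfolding g_fun_def by (rule gr) simp
  assume nz: "?g x0 \<rho> \<noteq> 0"
  have "D (D (\<lambda>t. ?g t \<rho>)) x0 = of_real (\<beta>\<^sup>2) * ?X x0 * ?Y \<rho>"
    unfolding g_fun_def by (rule gx)
  moreover have "D (D (\<lambda>t. ?g x0 t)) \<rho> = ?X x0 * u'' \<rho>" "D (\<lambda>t. ?g x0 t) \<rho> = ?X x0 * u' \<rho>"
    unfolding g_fun_def by (rule gr; simp)+
  \<comment> \<open>The second axial derivative reproduces the axial factor, so that factor comes
    out of the whole expression and leaves the radial equation.\<close>
  moreover have "of_real (\<rho>\<^sup>2) / ?g x0 \<rho> * (of_real (\<beta>\<^sup>2) * ?X x0 * ?Y \<rho> + ?X x0 * u'' \<rho>)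
      - of_real ((\<alpha> - 1) * \<rho>) / ?g x0 \<rho> * (?X x0 * u' \<rho>)
    = ?X x0 / ?g x0 \<rho> * (of_real (\<rho>\<^sup>2) * (of_real (\<beta>\<^sup>2) * ?Y \<rho> + u'' \<rho>) - of_real ((\<alpha> - 1) * \<rho>) * u' \<rho>)"
    by (simp add: algebra_simps diff_divide_distrib add_divide_distrib)
  ultimately show "of_real (\<rho>\<^sup>2) / ?g x0 \<rho> * (D (D (\<lambda>t. ?g t \<rho>)) x0 + D (D (\<lambda>t. ?g x0 t)) \<rho>)
           - of_real ((\<alpha> - 1) * \<rho>) / ?g x0 \<rho> * D (\<lambda>t. ?g x0 t) \<rho> = of_int (l\<^sup>2)"
    using nz unfolding u(3)[OF \<rho>] by (simp add: g_fun_def)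
qed

subsection \<open>Superposition\<close>

text \<open>Passing from \<open>ln \<rho>\<close> back to \<open>\<rho>\<close> multiplies by
  functions continuous at positive radii, which preserves decay.\<close>

lemma series_rep_radial_solution:
  assumes "open R" "R \<subseteq> {0<..}"
    and p: "\<And>n. radial_ode \<alpha> \<beta> (real n) (p n) (p' n)"
    and q: "\<And>n. radial_ode \<alpha> \<beta> (real n) (q n) (q' n)"
    and dec: "\<And>r. r \<in> R \<Longrightarrow> decays_at p (ln r) \<and> decays_at p' (ln r) \<and> decays_at q (ln r) \<and> decays_at q' (ln r)"
    and rep: "series_rep R h (Xi_fun B1 B2 \<beta>) (\<lambda>n \<rho>. p n (ln \<rho>)) (\<lambda>n \<rho>. q n (ln \<rho>))"
  shows "solution_on \<alpha> (cyl_region R) h"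
proof -
  have smooth: "smooth_decay R (\<lambda>n \<rho>. v n (ln \<rho>))"
    "smooth_decay R (\<lambda>n \<rho>. of_real (1 / \<rho>) * v' n (ln \<rho>))"
    "smooth_decay R (\<lambda>n \<rho>. of_real (1 / \<rho>\<^sup>2) *
      (of_real (\<alpha> - 1) * v' n (ln \<rho>) + of_real ((real n)\<^sup>2 - \<beta>\<^sup>2 * \<rho>\<^sup>2) * v n (ln \<rho>)))"
    if ode: "\<And>n. radial_ode \<alpha> \<beta> (real n) (v n) (v' n)"
      and dec: "\<And>r. r \<in> R \<Longrightarrow> decays_at v (ln r) \<and> decays_at v' (ln r)" for v v'
    unfolding smooth_decay_def
  proof (safe)
    fix r assume r: "r \<in> R"
    then have "0 < r" using assms(2) by auto
    then have ln: "isCont ln r" by (simp add: isCont_ln)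
    have v: "decays_at (\<lambda>n \<rho>. v n (ln \<rho>)) r" "decays_at (\<lambda>n \<rho>. v' n (ln \<rho>)) r"
      using dec[OF r] ln by (auto intro: decays_at_compose)
    show "decays_at (\<lambda>n \<rho>. v n (ln \<rho>)) r" by (rule v)
    have i: "isCont (\<lambda>\<rho>. complex_of_real (1 / \<rho>)) r" "isCont (\<lambda>\<rho>. complex_of_real (1 / \<rho>\<^sup>2)) r"
      "isCont (\<lambda>\<rho>. complex_of_real (- (\<beta>\<^sup>2 * \<rho>\<^sup>2))) r"
      using \<open>0 < r\<close> by (auto intro!: continuous_intros)
    show "decays_at (\<lambda>n \<rho>. of_real (1 / \<rho>) * v' n (ln \<rho>)) r"
      by (intro decays_at_mult v i)
    \<comment> \<open>The square of \<open>n\<close> in the second derivative is written as two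
      multiplications by \<open>n\<close>, each of which preserves exponential decay.\<close>
    have "decays_at (\<lambda>n \<rho>. of_real (1 / \<rho>\<^sup>2) * (of_real (\<alpha> - 1) * v' n (ln \<rho>)
        + (of_nat n * (of_nat n * v n (ln \<rho>)) + of_real (- (\<beta>\<^sup>2 * \<rho>\<^sup>2)) * v n (ln \<rho>)))) r"
      by (intro decays_at_mult decays_at_add decays_at_nat_mult v i continuous_const)
    then show "decays_at (\<lambda>n \<rho>. of_real (1 / \<rho>\<^sup>2) *
      (of_real (\<alpha> - 1) * v' n (ln \<rho>) + of_real ((real n)\<^sup>2 - \<beta>\<^sup>2 * \<rho>\<^sup>2) * v n (ln \<rho>))) r"
      by (rule back_subst[of "\<lambda>u. decays_at u r"])
        (intro ext, simp add: algebra_simps power2_eq_square)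
    fix n
    note ln_ode = radial_ode_ln[OF ode \<open>0 < r\<close>, of n]
    show "isCont (\<lambda>\<rho>. v n (ln \<rho>)) r" by (rule has_vector_derivative_continuous[OF ln_ode(1)])
    show c: "isCont (\<lambda>\<rho>. of_real (1 / \<rho>) * v' n (ln \<rho>)) r" by (rule has_vector_derivative_continuous[OF ln_ode(2)])
    have "isCont (v n) (ln r)" "isCont (v' n) (ln r)"
      using ode[of n] unfolding radial_ode_def by (blast intro: has_vector_derivative_continuous)+
    then have "isCont (\<lambda>\<rho>. v n (ln \<rho>)) r" "isCont (\<lambda>\<rho>. v' n (ln \<rho>)) r"
      using ln isCont_o2 by blast+
    then show "isCont (\<lambda>\<rho>. of_real (1 / \<rho>\<^sup>2) *
      (of_real (\<alpha> - 1) * v' n (ln \<rho>) + of_real ((real n)\<^sup>2 - \<beta>\<^sup>2 * \<rho>\<^sup>2) * v n (ln \<rho>))) r"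
      using \<open>0 < r\<close> by (intro continuous_intros) auto
  qed
  have pos: "0 < r" if "r \<in> R" for r using assms(2) that by auto
  have "decays_at p (ln r) \<and> decays_at p' (ln r)" "decays_at q (ln r) \<and> decays_at q' (ln r)"
    if "r \<in> R" for r
    using dec[OF that] by blast+
  note P = smooth[OF p this(1)] and Q = smooth[OF q this(2)]
  have eq: "of_real (r\<^sup>2) * (of_real (\<beta>\<^sup>2) * (v n (ln r) :: complex) + of_real (1 / r\<^sup>2) *
      (of_real (\<alpha> - 1) * v' n (ln r) + of_real ((real n)\<^sup>2 - \<beta>\<^sup>2 * r\<^sup>2) * v n (ln r)))
      - of_real ((\<alpha> - 1) * r) * (of_real (1 / r) * v' n (ln r)) - of_nat n * (of_nat n * v n (ln r)) = 0"
    if "\<And>n. radial_ode \<alpha> \<beta> (real n) (v n) (v' n)" "r \<in> R" for n r v v'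
    using radial_ode_ln(3)[OF that(1) pos[OF that(2)]] by (simp add: power2_eq_square mult.assoc)
  show ?thesis
    by (rule series_rep_solution_on[OF \<open>open R\<close> rep Xi_fun_derivs P(1) Q(1) P(2) Q(2) P(3) Q(3)
          radial_ode_ln(1)[OF p pos] radial_ode_ln(2)[OF p pos]
          radial_ode_ln(1)[OF q pos] radial_ode_ln(2)[OF q pos] eq[OF p] eq[OF q]])
qed

text \<open>Two zeros give a linear system for the two constants with determinant
  \<open>sinh (\<beta> * x - \<beta> * y)\<close> up to sign. Thus a nontrivial axial factor can be
  made nonzero by moving along the axis.\<close>

lemma Xi_fun_two_zeros:
  assumes "\<beta> \<noteq> 0" "x \<noteq> y" "Xi_fun B1 B2 \<beta> x = 0" "Xi_fun B1 B2 \<beta> y = 0"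
  shows "B1 \<beta> = 0 \<and> B2 \<beta> = 0"
proof -
  have eqs: "B1 \<beta> * cosh (\<beta> * x) + B2 \<beta> * sinh (\<beta> * x) = 0"
    "B1 \<beta> * cosh (\<beta> * y) + B2 \<beta> * sinh (\<beta> * y) = 0"
    using assms(3,4) unfolding Xi_fun_def of_real_eq_0_iff .
  have nz: "sinh (\<beta> * x - \<beta> * y) \<noteq> 0" using assms(1,2) by simp
  have "B1 \<beta> * sinh (\<beta> * x - \<beta> * y)
    = sinh (\<beta> * x) * (B1 \<beta> * cosh (\<beta> * y) + B2 \<beta> * sinh (\<beta> * y))
      - sinh (\<beta> * y) * (B1 \<beta> * cosh (\<beta> * x) + B2 \<beta> * sinh (\<beta> * x))"
    by (simp add: sinh_diff algebra_simps)
  then have B1: "B1 \<beta> = 0" using eqs nz by simp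
  have "B2 \<beta> * sinh (\<beta> * x - \<beta> * y)
    = cosh (\<beta> * y) * (B1 \<beta> * cosh (\<beta> * x) + B2 \<beta> * sinh (\<beta> * x))
      - cosh (\<beta> * x) * (B1 \<beta> * cosh (\<beta> * y) + B2 \<beta> * sinh (\<beta> * y))"
    by (simp add: sinh_diff algebra_simps)
  then have "B2 \<beta> = 0" using eqs nz by simp
  with B1 show ?thesis ..
qed

text \<open>The symmetric sum up to \<open>N\<close> corresponds to \<open>Suc N\<close> terms of
  the one-sided series; a shift by one does not affect the limit.\<close>

lemma bilateral_sum_eq_suminf:
  assumes f: "\<And>N :: nat. (\<Sum>l\<in>{- int N..int N}. f l) = (\<Sum>n<Suc N. g n)"
  shows bilateral_convergent_iff_summable: "bilateral_convergent f \<longleftrightarrow> summable g"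
    and "summable g \<Longrightarrow> bilateral_sum f = suminf g"
proof -
  have "bilateral_convergent f \<longleftrightarrow> convergent (\<lambda>N. \<Sum>n<Suc N. g n)"
    unfolding bilateral_convergent_def f ..
  also have "\<dots> \<longleftrightarrow> summable g"
    unfolding summable_iff_convergent by (rule convergent_Suc_iff)
  finally show "bilateral_convergent f \<longleftrightarrow> summable g" .
  assume "summable g"
  then have "(\<lambda>N. \<Sum>n<Suc N. g n) \<longlonglongrightarrow> suminf g"
    using summable_LIMSEQ LIMSEQ_Suc by blast
  then show "bilateral_sum f = suminf g"
    unfolding bilateral_sum_def f by (rule limI)
qed

lemma sum_int_symmetric:
  fixes f :: "int \<Rightarrow> 'a :: comm_monoid_add"
  shows "(\<Sum>l\<in>{- int N..int N}. f l) = (\<Sum>n<Suc N. if n = 0 then f 0 else f (int n) + f (- int n))"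
proof (induction N)
  case (Suc N)
  have "{- int (Suc N)..int (Suc N)} = insert (int (Suc N)) (insert (- int (Suc N)) {- int N..int N})"
    by auto
  then show ?case using Suc by (simp add: add_ac)
qed simp

text \<open>
  The terms \<open>l\<close> and \<open>- l\<close> are combined, since only symmetric partial sums are known to converge.
\<close>

lemma h_fun_trig_series:
  assumes "\<beta> \<noteq> 0"
  obtains p p' q q' where
    "\<And>n. radial_ode \<alpha> \<beta> (real n) (p n) (p' n)"
    "\<And>n. radial_ode \<alpha> \<beta> (real n) (q n) (q' n)"
    "\<And>x0 \<theta> \<rho> N. 0 < \<rho> \<Longrightarrow> (\<Sum>l\<in>{- int N..int N}. h_term \<alpha> C1 C2 B1 B2 A1 A2 l \<beta> x0 \<theta> \<rho>)
      = (\<Sum>n<Suc N. Xi_fun B1 B2 \<beta> x0 * trig_term (\<lambda>n \<rho>. p n (ln \<rho>)) (\<lambda>n \<rho>. q n (ln \<rho>)) n \<theta> \<rho>)"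
proof -
  obtain v v' where v: "\<And>l. radial_ode \<alpha> \<beta> (of_int l) (v l) (v' l)"
    "\<And>l \<rho>. 0 < \<rho> \<Longrightarrow> Upsilon_fun \<alpha> A1 A2 l \<beta> \<rho> = v l (ln \<rho>)"
    using Upsilon_fun_radial_ode[OF assms, of \<alpha> _ A1 A2] by metis
  \<comment> \<open>The radial factors for \<open>n\<close> and \<open>- n\<close> may be different
    functions, as the constants depend on the sign of \<open>l\<close>, but they solve the same
    equation.\<close>
  have ode: "radial_ode \<alpha> \<beta> (real n) (v (int n)) (v' (int n))"
    "radial_ode \<alpha> \<beta> (real n) (v (- int n)) (v' (- int n))" for n
    using v(1)[of "int n"] v(1)[of "- int n"] by (simp_all add: radial_ode_def)
  define c where "c n = complex_of_real (C1 (int n))" for n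
  \<comment> \<open>The index 0 is its own mirror image and must not be counted twice. The minus
    sign in \<open>f\<close> below reflects that the sine is odd.\<close>
  define d where "d n = complex_of_real (if n = 0 then 0 else C1 (- int n))" for n
  define e where "e n = complex_of_real (C2 (int n))" for n
  define f where "f n = complex_of_real (if n = 0 then 0 else - C2 (- int n))" for n
  show ?thesis
  proof (rule that)
    show "radial_ode \<alpha> \<beta> (real n) (\<lambda>t. c n * v (int n) t + d n * v (- int n) t)
        (\<lambda>t. c n * v' (int n) t + d n * v' (- int n) t)" for n
      by (rule radial_ode_linear_combination[OF ode])
    show "radial_ode \<alpha> \<beta> (real n) (\<lambda>t. e n * v (int n) t + f n * v (- int n) t)
        (\<lambda>t. e n * v' (int n) t + f n * v' (- int n) t)" for n
      by (rule radial_ode_linear_combination[OF ode])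
    fix x0 \<theta> \<rho> :: real and N assume \<rho>: "0 < \<rho>"
    let ?h = "\<lambda>l. h_term \<alpha> C1 C2 B1 B2 A1 A2 l \<beta> x0 \<theta> \<rho>"
    show "(\<Sum>l\<in>{- int N..int N}. ?h l) = (\<Sum>n<Suc N. Xi_fun B1 B2 \<beta> x0 *
        trig_term (\<lambda>n \<rho>. c n * v (int n) (ln \<rho>) + d n * v (- int n) (ln \<rho>))
          (\<lambda>n \<rho>. e n * v (int n) (ln \<rho>) + f n * v (- int n) (ln \<rho>)) n \<theta> \<rho>)"
      unfolding sum_int_symmetric
      by (intro sum.cong refl)
        (auto simp: h_term_def s_fun_def g_fun_def v(2)[OF \<rho>] trig_term_def c_def d_def e_def f_def algebra_simps)
  qed
qed

lemma open_snd_snd_image: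
  fixes U :: "('a :: topological_space \<times> 'b :: topological_space \<times> 'c :: topological_space) set"
  assumes "open U"
  shows "open ((\<lambda>(x, y, z). z) ` U)"
proof -
  have "(\<lambda>(x, y, z). z) ` U = snd ` snd ` U" by (force simp: image_image)
  then show ?thesis using assms open_image_snd by metis
qed

text \<open>A box inside \<open>U\<close> around a point of radius \<open>r\<close> supplies an
  interval of angles at two radii on either side of \<open>r\<close>. Bounded terms there give
  bounded coefficients, and the radial equation turns these into decay at \<open>r\<close>.\<close>

lemma h_fun_solution_on:
  assumes "\<beta> \<noteq> 0" "open U" "U \<subseteq> half_space"
    and conv: "\<And>x0 \<theta> \<rho>. (x0, \<theta>, \<rho>) \<in> U \<Longrightarrow>
      bilateral_convergent (\<lambda>l. h_term \<alpha> C1 C2 B1 B2 A1 A2 l \<beta> x0 \<theta> \<rho>)"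
  shows "solution_on \<alpha> U (h_fun \<alpha> C1 C2 B1 B2 A1 A2 \<beta>)"
proof -
  let ?h = "h_fun \<alpha> C1 C2 B1 B2 A1 A2 \<beta>" and ?X = "Xi_fun B1 B2 \<beta>"
  define R where "R = (\<lambda>(x0, \<theta>, \<rho>). \<rho>) ` U"
  have R: "open R" "R \<subseteq> {0<..}" "U \<subseteq> cyl_region R"
    using open_snd_snd_image[OF assms(2)] assms(3)
    by (auto simp: R_def half_space_def cyl_region_def intro: rev_image_eqI)
  obtain p p' q q' where p: "\<And>n. radial_ode \<alpha> \<beta> (real n) (p n) (p' n)"
    and q: "\<And>n. radial_ode \<alpha> \<beta> (real n) (q n) (q' n)"
    and sums: "\<And>x0 \<theta> \<rho> N. 0 < \<rho> \<Longrightarrow> (\<Sum>l\<in>{- int N..int N}. h_term \<alpha> C1 C2 B1 B2 A1 A2 l \<beta> x0 \<theta> \<rho>)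
      = (\<Sum>n<Suc N. ?X x0 * trig_term (\<lambda>n \<rho>. p n (ln \<rho>)) (\<lambda>n \<rho>. q n (ln \<rho>)) n \<theta> \<rho>)"
    using h_fun_trig_series[OF assms(1), where \<alpha> = \<alpha> and ?C1.0 = C1 and ?C2.0 = C2 and ?B1.0 = B1
        and ?B2.0 = B2 and ?A1.0 = A1 and ?A2.0 = A2] by blast
  let ?t = "trig_term (\<lambda>n \<rho>. p n (ln \<rho>)) (\<lambda>n \<rho>. q n (ln \<rho>))"
  have "solution_on \<alpha> (cyl_region R) ?h"
  \<comment> \<open>If the axial factor vanishes identically, convergence carries no information
    about the radial coefficients, but then the sum is zero and zero sequences represent it.\<close>
  proof (cases "B1 \<beta> = 0 \<and> B2 \<beta> = 0")
    case True
    then have X: "?X x = 0" for x by (simp add: Xi_fun_def)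
    have "series_rep R ?h ?X (\<lambda>n \<rho>. 0) (\<lambda>n \<rho>. 0)"
      by (simp add: series_rep_def h_fun_def h_term_def g_fun_def X bilateral_sum_def)
    moreover have "radial_ode \<alpha> \<beta> n (\<lambda>t. 0 :: complex) (\<lambda>t. 0)" for n
      by (simp add: radial_ode_def)
    moreover have "decays_at (\<lambda>n x. 0) r" for r
      unfolding decays_at_def by (intro exI[of _ 1] exI[of _ 0]) simp
    ultimately show ?thesis
      by (intro series_rep_radial_solution[OF R(1,2), where p = "\<lambda>n t. 0" and p' = "\<lambda>n t. 0"
          and q = "\<lambda>n t. 0" and q' = "\<lambda>n t. 0"] conjI)
  next
    case False
    have dec: "decays_at p (ln r) \<and> decays_at p' (ln r) \<and> decays_at q (ln r) \<and> decays_at q' (ln r)"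
      if "r \<in> R" for r
    proof -
      have "0 < r" using R(2) that by auto
      obtain x0 \<theta>0 where "(x0, \<theta>0, r) \<in> U" using \<open>r \<in> R\<close> by (auto simp: R_def)
      with assms(2) obtain A V where AV: "open A" "open V" "(x0, \<theta>0, r) \<in> A \<times> V" "A \<times> V \<subseteq> U"
        by (rule open_prod_elim)
      then have "(\<theta>0, r) \<in> V" by simp
      with AV(2) obtain B C where BC: "open B" "open C" "(\<theta>0, r) \<in> B \<times> C" "B \<times> C \<subseteq> V"
        by (rule open_prod_elim)
      have ABC: "open A" "open B" "open C" "x0 \<in> A" "\<theta>0 \<in> B" "r \<in> C"
        "\<And>x \<theta> \<rho>. x \<in> A \<Longrightarrow> \<theta> \<in> B \<Longrightarrow> \<rho> \<in> C \<Longrightarrow> (x, \<theta>, \<rho>) \<in> U"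
        using AV BC by auto
      obtain \<epsilon> where \<epsilon>: "0 < \<epsilon>" "cball x0 \<epsilon> \<subseteq> A" using ABC open_contains_cball by blast
      obtain \<delta> where \<delta>: "0 < \<delta>" "cball \<theta>0 \<delta> \<subseteq> B" using ABC open_contains_cball by blast
      \<comment> \<open>The two radii are chosen symmetrically about \<open>r\<close> in the
        logarithmic variable, in which the radial equation was estimated.\<close>
      have "open (exp -` C)" by (intro open_vimage ABC continuous_intros)
      moreover have "ln r \<in> exp -` C" using ABC \<open>0 < r\<close> by simp
      ultimately obtain \<eta> where \<eta>: "0 < \<eta>" "cball (ln r) \<eta> \<subseteq> exp -` C" using open_contains_cball by blast
      \<comment> \<open>Division by the axial factor requires a point of the box where it is
        nonzero.\<close>
      obtain x1 where x1: "x1 \<in> A" "?X x1 \<noteq> 0"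
      proof (cases "?X x0 = 0")
        case True
        then have "?X (x0 + \<epsilon>) \<noteq> 0"
          using Xi_fun_two_zeros[OF assms(1), of x0 "x0 + \<epsilon>" B1 B2] False \<epsilon>(1) by auto
        moreover have "x0 + \<epsilon> \<in> A" using \<epsilon> by (auto simp: dist_real_def)
        ultimately show ?thesis using that by blast
      qed (use ABC that in blast)
      have bdd: "\<exists>M N. \<forall>n\<ge>N. norm (p n t) \<le> M \<and> norm (q n t) \<le> M" if t: "t \<in> {ln r - \<eta>, ln r + \<eta>}" for t
      proof (rule cantor_lebesgue_bounded)
        show "\<theta>0 - \<delta> < \<theta>0 + \<delta>" using \<delta> by simp
        fix \<theta> assume \<theta>: "\<theta> \<in> {\<theta>0 - \<delta>..\<theta>0 + \<delta>}"
        have "\<theta> \<in> B" using \<theta> \<delta>(2) by (auto simp: dist_real_def abs_le_iff subset_iff)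
        moreover have "exp t \<in> C" using t \<eta> by (auto simp: dist_real_def subset_iff)
        ultimately have "(x1, \<theta>, exp t) \<in> U" using x1(1) by (intro ABC(7))
        then have "summable (\<lambda>n. ?X x1 * ?t n \<theta> (exp t))"
          by (intro iffD1[OF bilateral_convergent_iff_summable[OF sums[OF exp_gt_zero]] conv])
        then have "Bseq (\<lambda>n. ?X x1 * ?t n \<theta> (exp t))"
          by (rule convergent_imp_Bseq[OF convergentI[OF summable_LIMSEQ_zero]])
        then obtain K where K: "\<And>n. norm (?X x1 * ?t n \<theta> (exp t)) \<le> K" by (auto simp: Bseq_def)
        have "norm (?t n \<theta> (exp t)) \<le> K / norm (?X x1)" for n
          using K[of n] x1(2) by (simp add: norm_mult field_simps)
        then show "\<exists>B. \<forall>n. norm (of_real (cos (real n * \<theta>)) * p n t + of_real (sin (real n * \<theta>)) * q n t) \<le> B"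
          unfolding trig_term_def ln_exp by blast
      qed
      have ends: "ln r - \<eta> < ln r" "ln r < ln r + \<eta>" using \<eta> by auto
      have "\<exists>M N. \<forall>n\<ge>N. norm (p n t) \<le> M" "\<exists>M N. \<forall>n\<ge>N. norm (q n t) \<le> M"
        if "t \<in> {ln r - \<eta>, ln r + \<eta>}" for t
        using bdd[OF that] by blast+
      then show ?thesis
        using decays_at_radial_ode[OF p ends] decays_at_radial_ode[OF q ends] by simp
    qed
    \<comment> \<open>This holds for every \<open>x0\<close> and \<open>\<theta>\<close>:
      convergence now comes from the decay and no longer from the hypothesis on
      \<open>U\<close>.\<close>
    have rep: "series_rep R ?h ?X (\<lambda>n \<rho>. p n (ln \<rho>)) (\<lambda>n \<rho>. q n (ln \<rho>))"
      unfolding series_rep_def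
    proof (intro allI impI)
      fix x0 \<theta> \<rho> assume \<rho>: "\<rho> \<in> R"
      then have pos: "0 < \<rho>" using R(2) by auto
      then have "isCont ln \<rho>" by (simp add: isCont_ln)
      then have summ: "summable (\<lambda>n. ?t n \<theta> \<rho>)"
        using dec[OF \<rho>] decays_at_compose[of p ln \<rho>] decays_at_compose[of q ln \<rho>]
        by (intro summable_trig_series) blast+
      have "?h x0 \<theta> \<rho> = (\<Sum>n. ?X x0 * ?t n \<theta> \<rho>)"
        unfolding h_fun_def by (rule bilateral_sum_eq_suminf(2)[OF sums[OF pos] summable_mult[OF summ]])
      also have "\<dots> = ?X x0 * (\<Sum>n. ?t n \<theta> \<rho>)" by (rule suminf_mult[OF summ])
      finally show "?h x0 \<theta> \<rho> = ?X x0 * (\<Sum>n. ?t n \<theta> \<rho>)" .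
    qed
    show ?thesis
      by (rule series_rep_radial_solution[OF R(1,2) p q dec rep])
  qed
  then show ?thesis using R(3) by (rule solution_on_subset)
qed

text \<open>Truncating the angular constants to one index makes the symmetric sums eventually
  constant. A single separated term is thus an everywhere convergent series, and the result for
  series yields that it is a solution.\<close>

lemma h_term_eq_h_fun:
  fixes C1 C2 :: "int \<Rightarrow> real"
  defines "E \<equiv> \<lambda>C l k :: int. if k = l then C k else (0 :: real)"
  shows "bilateral_convergent (\<lambda>k. h_term \<alpha> (E C1 l) (E C2 l) B1 B2 A1 A2 k \<beta> x0 \<theta> \<rho>)"
    and "h_fun \<alpha> (E C1 l) (E C2 l) B1 B2 A1 A2 \<beta> x0 \<theta> \<rho> = h_term \<alpha> C1 C2 B1 B2 A1 A2 l \<beta> x0 \<theta> \<rho>"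
proof -
  let ?f = "\<lambda>k. h_term \<alpha> (E C1 l) (E C2 l) B1 B2 A1 A2 k \<beta> x0 \<theta> \<rho>"
  have f: "?f k = (if k = l then h_term \<alpha> C1 C2 B1 B2 A1 A2 l \<beta> x0 \<theta> \<rho> else 0)" for k
    by (simp add: h_term_def s_fun_def E_def)
  have "\<forall>\<^sub>F N in sequentially. (\<Sum>k\<in>{- int N..int N}. ?f k) = h_term \<alpha> C1 C2 B1 B2 A1 A2 l \<beta> x0 \<theta> \<rho>"
    using eventually_ge_at_top[of "nat \<bar>l\<bar>"]
    by eventually_elim (auto simp: f sum.delta)
  then have "(\<lambda>N. \<Sum>k\<in>{- int N..int N}. ?f k) \<longlonglongrightarrow> h_term \<alpha> C1 C2 B1 B2 A1 A2 l \<beta> x0 \<theta> \<rho>"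
    by (rule tendsto_eventually)
  then show "bilateral_convergent ?f"
    "h_fun \<alpha> (E C1 l) (E C2 l) B1 B2 A1 A2 \<beta> x0 \<theta> \<rho> = h_term \<alpha> C1 C2 B1 B2 A1 A2 l \<beta> x0 \<theta> \<rho>"
    unfolding bilateral_convergent_def h_fun_def bilateral_sum_def
    by (auto intro: convergentI limI)
qed

lemma h_term_solution_on:
  assumes "\<beta> \<noteq> 0"
  shows "solution_on \<alpha> half_space (h_term \<alpha> C1 C2 B1 B2 A1 A2 l \<beta>)"
proof -
  let ?E = "\<lambda>C k :: int. if k = l then C k else (0 :: real)"
  have "half_space = UNIV \<times> UNIV \<times> {0<..}"
    by (auto simp: half_space_def)
  then have "open half_space"
    by (metis open_Times open_UNIV open_greaterThan)
  then have "solution_on \<alpha> half_space (h_fun \<alpha> (?E C1) (?E C2) B1 B2 A1 A2 \<beta>)"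
    by (rule h_fun_solution_on[OF assms]) (auto intro: h_term_eq_h_fun(1))
  moreover have "h_fun \<alpha> (?E C1) (?E C2) B1 B2 A1 A2 \<beta> = h_term \<alpha> C1 C2 B1 B2 A1 A2 l \<beta>"
    by (intro ext h_term_eq_h_fun(2))
  ultimately show ?thesis by simp
qed

section \<open>Real values for positive arguments\<close>

lemma tendsto_in_Reals:
  assumes "f \<longlonglongrightarrow> (x :: complex)" "\<And>n. f n \<in> \<real>"
  shows "x \<in> \<real>"
  using Lim_in_closed_set[OF closed_complex_Reals _ _ assms(1)] assms(2) by simp

lemma bessel_J_Reals:
  assumes "0 < x"
  shows "bessel_J (of_real \<nu>) (of_real x) \<in> \<real>"
proof -
  have real_term: "(- 1) ^ k * rGamma (of_real \<nu> + of_nat k + 1) / fact k * (of_real x / 2) ^ (2 * k)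
      = complex_of_real ((- 1) ^ k * rGamma (\<nu> + real k + 1) / fact k * (x / 2) ^ (2 * k))" for k
    using rGamma_complex_of_real[of "\<nu> + real k + 1"] by simp
  have "(\<lambda>n. \<Sum>k<n. (- 1) ^ k * rGamma (of_real \<nu> + of_nat k + 1) / fact k * (of_real x / 2) ^ (2 * k))
      \<longlonglongrightarrow> (\<Sum>k. (- 1) ^ k * rGamma (of_real \<nu> + of_nat k + 1) / fact k * (of_real x / 2 :: complex) ^ (2 * k))"
    using summable_LIMSEQ[OF summable_bessel_coeff[of "of_real \<nu>" "(of_real x / 2)\<^sup>2"]]
    by (simp add: bessel_coeff_def power_mult)
  then have "(\<Sum>k. (- 1) ^ k * rGamma (of_real \<nu> + of_nat k + 1) / fact k * (of_real x / 2 :: complex) ^ (2 * k)) \<in> \<real>"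
    by (rule tendsto_in_Reals) (intro sum_in_Reals, simp only: real_term Reals_of_real)
  moreover have "(of_real x / 2) powr of_real \<nu> = complex_of_real ((x / 2) powr \<nu>)"
    using assms powr_of_real[of "x / 2" \<nu>] by simp
  ultimately show ?thesis
    unfolding bessel_J_def by (simp add: Reals_mult)
qed

lemma bessel_Y_quotient_Reals:
  assumes "0 < x"
  shows "bessel_Y_quotient (of_real \<nu>) (of_real x) \<in> \<real>"
proof -
  have "cos (of_real pi * of_real \<nu>) = complex_of_real (cos (pi * \<nu>))"
    "sin (of_real pi * of_real \<nu>) = complex_of_real (sin (pi * \<nu>))"
    by (simp_all flip: cos_of_real sin_of_real)
  then show ?thesis
    unfolding bessel_Y_quotient_def
    using bessel_J_Reals[OF assms, of \<nu>] bessel_J_Reals[OF assms, of "- \<nu>"]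
    by (intro Reals_divide Reals_diff Reals_mult) simp_all
qed

lemma bessel_Y_Reals:
  assumes "0 < x" "0 \<le> \<nu>"
  shows "bessel_Y (of_real \<nu>) (of_real x) \<in> \<real>"
proof (cases "complex_of_real \<nu> \<in> \<int>")
  case True
  then obtain m where "complex_of_real \<nu> = of_int m"
    by (elim Ints_cases)
  then have "\<nu> = of_int m"
    by (metis of_real_eq_iff of_real_of_int_eq)
  then obtain n where n: "\<nu> = real n"
    using assms(2) by (metis of_int_0_le_iff of_int_of_nat_eq zero_le_imp_eq_int)
  have "complex_of_real x \<noteq> 0" using assms by simp
  note lim = tendsto_bessel_Y_quotient[OF this, of n]
  then have Y: "bessel_Y (of_real \<nu>) (of_real x) = 1 / of_real pi * bessel_J_log_order_deriv (of_nat n) (Ln (of_real x / 2))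
    + (- 1) ^ n / of_real pi * bessel_J_log_order_deriv (- of_nat n) (Ln (of_real x / 2))"
    using tendsto_Lim[OF _ lim] True by (simp add: bessel_Y_def n)
  \<comment> \<open>At integer order \<open>Y\<close> is a limit over complex orders. Evaluating it
    along the real orders \<open>n + 1 / (j + 1)\<close>, where the quotient is real, shows that the
    limit is real.\<close>
  have "filterlim (\<lambda>j. complex_of_real (real n + inverse (real (Suc j)))) (at (of_nat n)) sequentially"
    unfolding filterlim_at
  proof
    have "(\<lambda>j. complex_of_real (real n + inverse (real (Suc j)))) \<longlonglongrightarrow> of_real (real n + 0)"
      by (intro tendsto_of_real tendsto_add tendsto_const LIMSEQ_inverse_real_of_nat)
    then show "(\<lambda>j. complex_of_real (real n + inverse (real (Suc j)))) \<longlonglongrightarrow> of_nat n" by simp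
    have "complex_of_real (real n + inverse (real (Suc j))) \<noteq> of_nat n" for j
    proof
      assume "complex_of_real (real n + inverse (real (Suc j))) = of_nat n"
      then have "real n + inverse (real (Suc j)) = real n"
        by (metis of_real_eq_iff of_real_of_nat_eq)
      then show False by simp
    qed
    then show "\<forall>\<^sub>F j in sequentially. complex_of_real (real n + inverse (real (Suc j))) \<in> UNIV
        \<and> complex_of_real (real n + inverse (real (Suc j))) \<noteq> of_nat n" by simp
  qed
  from filterlim_compose[OF lim this] show ?thesis
    unfolding Y by (rule tendsto_in_Reals) (rule bessel_Y_quotient_Reals[OF assms(1)])
next
  case False
  then show ?thesis
    using bessel_Y_quotient_Reals[OF assms(1)] by (simp add: bessel_Y_def)
qed

lemma h_term_Reals:
  assumes "0 < \<beta>" "0 < \<rho>"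
  shows "h_term \<alpha> C1 C2 B1 B2 A1 A2 l \<beta> x0 \<theta> \<rho> \<in> \<real>"
proof -
  have "0 < \<rho> * \<beta>" using assms by simp
  moreover have "0 \<le> sqrt (\<alpha>\<^sup>2 + 4 * (of_int l)\<^sup>2) / 2" by simp
  ultimately show ?thesis
    unfolding h_term_def s_fun_def g_fun_def Xi_fun_def Upsilon_fun_def Let_def
    by (intro Reals_mult Reals_add Reals_of_real bessel_J_Reals bessel_Y_Reals)
qed

theorem theorem3p5:
  fixes \<alpha> \<beta> :: real
    and C1 C2 :: "int \<Rightarrow> real"
    and B1 B2 :: "real \<Rightarrow> real"
    and A1 A2 :: "int \<Rightarrow> real \<Rightarrow> real"
  assumes "\<beta> \<noteq> 0"
  shows "(\<forall>l. first_separation \<alpha> l (s_fun C1 C2 l) (g_fun \<alpha> B1 B2 A1 A2 l \<beta>) \<and>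
              second_separation \<alpha> l \<beta> (Xi_fun B1 B2 \<beta>) (Upsilon_fun \<alpha> A1 A2 l \<beta>) \<and>
              solution_on \<alpha> half_space (h_term \<alpha> C1 C2 B1 B2 A1 A2 l \<beta>)) \<and>
         (\<forall>U. open U \<and> U \<subseteq> half_space \<and>
              (\<forall>(x0, \<theta>, \<rho>) \<in> U.
                 bilateral_convergent (\<lambda>l. h_term \<alpha> C1 C2 B1 B2 A1 A2 l \<beta> x0 \<theta> \<rho>)) \<longrightarrow>
              solution_on \<alpha> U (h_fun \<alpha> C1 C2 B1 B2 A1 A2 \<beta>) \<and>
              (\<beta> > 0 \<longrightarrow> (\<forall>(x0, \<theta>, \<rho>) \<in> U. h_fun \<alpha> C1 C2 B1 B2 A1 A2 \<beta> x0 \<theta> \<rho> \<in> \<real>)))"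
proof (intro conjI allI impI)
  fix l
  show "first_separation \<alpha> l (s_fun C1 C2 l) (g_fun \<alpha> B1 B2 A1 A2 l \<beta>)"
    by (rule first_separation_s_g[OF assms])
  show "second_separation \<alpha> l \<beta> (Xi_fun B1 B2 \<beta>) (Upsilon_fun \<alpha> A1 A2 l \<beta>)"
    by (rule second_separation_Xi_Upsilon[OF assms])
  show "solution_on \<alpha> half_space (h_term \<alpha> C1 C2 B1 B2 A1 A2 l \<beta>)"
    by (rule h_term_solution_on[OF assms])
next
  fix U assume U: "open U \<and> U \<subseteq> half_space \<and>
    (\<forall>(x0, \<theta>, \<rho>) \<in> U. bilateral_convergent (\<lambda>l. h_term \<alpha> C1 C2 B1 B2 A1 A2 l \<beta> x0 \<theta> \<rho>))"
  then have conv: "bilateral_convergent (\<lambda>l. h_term \<alpha> C1 C2 B1 B2 A1 A2 l \<beta> x0 \<theta> \<rho>)"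
    if "(x0, \<theta>, \<rho>) \<in> U" for x0 \<theta> \<rho>
    using that by blast
  show "solution_on \<alpha> U (h_fun \<alpha> C1 C2 B1 B2 A1 A2 \<beta>)"
    using U conv by (intro h_fun_solution_on[OF assms]) auto
  show "\<forall>(x0, \<theta>, \<rho>) \<in> U. h_fun \<alpha> C1 C2 B1 B2 A1 A2 \<beta> x0 \<theta> \<rho> \<in> \<real>" if "0 < \<beta>"
  proof safe
    fix x0 \<theta> \<rho> assume x: "(x0, \<theta>, \<rho>) \<in> U"
    then have "0 < \<rho>" using U by (auto simp: half_space_def)
    \<comment> \<open>Convergence at the point makes \<open>lim\<close> a genuine limit, here of
      real partial sums.\<close>
    have "(\<lambda>N. \<Sum>l\<in>{- int N..int N}. h_term \<alpha> C1 C2 B1 B2 A1 A2 l \<beta> x0 \<theta> \<rho>)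
        \<longlonglongrightarrow> h_fun \<alpha> C1 C2 B1 B2 A1 A2 \<beta> x0 \<theta> \<rho>"
      using conv[OF x] unfolding bilateral_convergent_def h_fun_def bilateral_sum_def
      by (simp add: convergent_LIMSEQ_iff)
    then show "h_fun \<alpha> C1 C2 B1 B2 A1 A2 \<beta> x0 \<theta> \<rho> \<in> \<real>"
      by (rule tendsto_in_Reals) (intro sum_in_Reals h_term_Reals \<open>0 < \<beta>\<close> \<open>0 < \<rho>\<close>)
  qed
qed

end
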